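(* Let $n\ge1$. The non-trivial symmetry classes of spanning trees of the mixed Aztec diamond $MD_n$ not involving rotations are enumerated by $$\mathrm{t}_{\langle h\rangle}(MD_n)=\mathrm{M}(C_{2n-2})=\frac{1}{2^{2n-2}}\prod_{\substack{1\leq j\leq k\leq 2n-2\\ j+k\ \text{even}}}\left(4-2\cos\frac{j\pi}{2n-1}-2\cos\frac{k\pi}{2n-1}\right)$$ and $$\mathrm{t}_{\langle h,v\rangle}(MD_n)=\mathrm{M}(B_{n-1})=2^{n-1}\prod_{j=1}^{n-1}\cos\frac{j\pi}{2n-1}\prod_{1\leq j<k\leq n-1}\left(4\cos^2\frac{j\pi}{2n-1}+4\cos^2\frac{k\pi}{2n-1}\right).$$
   Context: $MD_n$ is the graph whose vertices are the black unit squares of a $2n\times 2n$ chessboard, two vertices being adjacent if the corresponding squares share a corner. It is drawn rotated by $45^\circ$ so that its edges are horizontal and vertical and the black diagonal of the board is horizontal; in this drawing $MD_n$ is the subgraph of the grid $(\mathbb{Z}+1/2)\times\mathbb{Z}$ (nearest-neighbor edges) induced by the points $(x,y)$ with $|x|+|y|\le n-\tfrac12$. Let $h$ and $v$ be the reflections across the horizontal axis ($y=0$) and across the vertical axis ($x=0$) in this drawing. For a graph $G$ and a group $H$ of symmetries of $G$, $\mathrm{t}_H(G)$ is the number of spanning trees of $G$ invariant under $H$, and $\mathrm{M}(G)$ is the number of perfect matchings of $G$ (equal to $1$ for the empty graph). The following are induced subgraphs of the grid $\mathbb{Z}^2$. Let $NE(i,j)$ be the infinite zig-zag lattice path starting at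 $(i,j)$ and taking alternately two unit steps north and two unit steps east; $NW(i,j)$ is the analogous path alternating two steps north and two steps west. $B_n$ is induced by the points $(i,j)$ with $0\le i,j\le 2n-1$ that are on or above $NE(0,0)$, i.e. the points with $0\le i\le 2n-1$ and $2\lceil i/2\rceil\le j\le 2n-1$. $C_n$ is induced by the points $(i,j)$ with $j\ge0$ that are on or below both $NE(-n+1,-1)$ and $NW(n-1,-1)$, i.e. the points with $j\ge0$ and $|i|\le n-1-2\lfloor j/2\rfloor$. Empty products equal $1$. *)

theory Defs
  imports Complex_Main "HOL-Algebra.Bij" "HOL-Algebra.Generated_Groups"
begin

text \<open>Simple graphs: edges are meant to be two-element sets of vertices. The record does not
  enforce this, but all graphs built below satisfy it.\<close>

record 'a ugraph =
  verts :: "'a set"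
  edges :: "'a set set"

definition map_graph :: "('a \<Rightarrow> 'b) \<Rightarrow> 'a ugraph \<Rightarrow> 'b ugraph" where
  "map_graph f G = \<lparr>verts = f ` verts G, edges = (\<lambda>e. f ` e) ` edges G\<rparr>"

definition adj :: "'a ugraph \<Rightarrow> ('a \<times> 'a) set" where
  "adj G = {(u, v). u \<noteq> v \<and> {u, v} \<in> edges G}"

definition graph_connected :: "'a ugraph \<Rightarrow> bool" where
  "graph_connected G \<longleftrightarrow> verts G \<noteq> {} \<and> (\<forall>u\<in>verts G. \<forall>v\<in>verts G. (u, v) \<in> (adj G)\<^sup>*)"

definition is_cycle :: "'a ugraph \<Rightarrow> 'a list \<Rightarrow> bool" where
  "is_cycle G c \<longleftrightarrow> 3 \<le> length c \<and> distinct c \<and>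
     (\<forall>i<length c. (c ! i, c ! (Suc i mod length c)) \<in> adj G)"

definition is_tree :: "'a ugraph \<Rightarrow> bool" where
  "is_tree G \<longleftrightarrow> graph_connected G \<and> (\<nexists>c. is_cycle G c)"

definition spanning_trees :: "'a ugraph \<Rightarrow> 'a ugraph set" where
  "spanning_trees G = {T. verts T = verts G \<and> edges T \<subseteq> edges G \<and> is_tree T}"

text \<open>Invariance means that each symmetry maps the tree onto itself, not that it fixes
  the tree edge by edge.\<close>

definition num_inv_spanning_trees :: "('a \<Rightarrow> 'a) set \<Rightarrow> 'a ugraph \<Rightarrow> nat" where
  "num_inv_spanning_trees H G = card {T \<in> spanning_trees G. \<forall>g\<in>H. map_graph g T = T}"

definition perfect_matchings :: "'a ugraph \<Rightarrow> 'a set set set" where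
  "perfect_matchings G = {M. M \<subseteq> edges G \<and> (\<forall>v\<in>verts G. \<exists>!e. e \<in> M \<and> v \<in> e)}"

definition num_perfect_matchings :: "'a ugraph \<Rightarrow> nat" where
  "num_perfect_matchings G = card (perfect_matchings G)"

text \<open>On subsets of \<open>\<int> \<times> \<int>\<close> or \<open>(\<int> + 1/2) \<times> \<int>\<close> the points at \<open>\<ell>\<^sub>1\<close>-distance \<open>1\<close> are
  exactly the nearest neighbours in the grid.\<close>

definition grid_graph :: "('a::linordered_idom \<times> 'a) set \<Rightarrow> ('a \<times> 'a) ugraph" where
  "grid_graph S = \<lparr>verts = S,
     edges = {{p, q} | p q. p \<in> S \<and> q \<in> S \<and> \<bar>fst p - fst q\<bar> + \<bar>snd p - snd q\<bar> = 1}\<rparr>"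

definition MD :: "nat \<Rightarrow> (real \<times> real) ugraph" where
  "MD n = grid_graph {(x, y). x - 1/2 \<in> \<int> \<and> y \<in> \<int> \<and> \<bar>x\<bar> + \<bar>y\<bar> \<le> real n - 1/2}"

definition hrefl :: "real \<times> real \<Rightarrow> real \<times> real" where
  "hrefl = (\<lambda>(x, y). (x, - y))"

definition vrefl :: "real \<times> real \<Rightarrow> real \<times> real" where
  "vrefl = (\<lambda>(x, y). (- x, y))"

text \<open>The subgroup of the group of all bijections of the plane generated by \<open>S\<close>.\<close>

definition sym_generated :: "(real \<times> real \<Rightarrow> real \<times> real) set \<Rightarrow> (real \<times> real \<Rightarrow> real \<times> real) set" where
  "sym_generated S = generate (BijGroup UNIV) S"

lemma sym_generated_h: "sym_generated {hrefl} = {id, hrefl}"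
  and sym_generated_hv: "sym_generated {hrefl, vrefl} = {id, hrefl, vrefl, hrefl \<circ> vrefl}"
proof -
  have comp: "compose UNIV f g = f \<circ> g" for f :: "'b \<Rightarrow> 'c" and g :: "'a \<Rightarrow> 'b"
    by (simp add: compose_def restrict_def fun_eq_iff)
  have one: "\<one>\<^bsub>BijGroup UNIV\<^esub> = (id :: 'a \<Rightarrow> 'a)"
    by (simp add: BijGroup_def restrict_def fun_eq_iff)
  have inv_eq: "bij_betw g UNIV UNIV" "inv\<^bsub>BijGroup UNIV\<^esub> g = g" if "g \<circ> g = id" for g :: "'a \<Rightarrow> 'a"
  proof -
    show b: "bij_betw g UNIV UNIV" using o_bij[OF that that] .
    then have c: "g \<in> carrier (BijGroup UNIV)" by (simp add: BijGroup_def Bij_def)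
    interpret group "BijGroup UNIV :: ('a \<Rightarrow> 'a) monoid" by (rule group_BijGroup)
    show "inv\<^bsub>BijGroup UNIV\<^esub> g = g"
      by (rule inv_equality[OF _ c c]) (use b that in \<open>simp add: one, simp add: BijGroup_def Bij_def comp\<close>)
  qed
  have mult: "f \<otimes>\<^bsub>BijGroup UNIV\<^esub> g = f \<circ> g" if "bij f" "bij g" for f g :: "'a \<Rightarrow> 'a"
    using that by (simp add: BijGroup_def Bij_def comp)
  have hh: "hrefl \<circ> hrefl = id" and vv: "vrefl \<circ> vrefl = id" and vh: "vrefl \<circ> hrefl = hrefl \<circ> vrefl"
    by (auto simp: hrefl_def vrefl_def)
  have bh: "bij hrefl" and bv: "bij vrefl" using inv_eq(1) hh vv by blast+
  have bid: "bij (\<lambda>x :: real \<times> real. x)" using bij_id by (simp add: id_def)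
  have bhv: "bij (hrefl \<circ> vrefl)" using bh bv by (rule bij_comp[rotated])
  have ih: "inv\<^bsub>BijGroup UNIV\<^esub> hrefl = hrefl" and iv: "inv\<^bsub>BijGroup UNIV\<^esub> vrefl = vrefl"
    using inv_eq(2) hh vv by blast+
  have pt: "hrefl (hrefl p) = p" "vrefl (vrefl p) = p" "vrefl (hrefl p) = hrefl (vrefl p)" for p
    by (simp_all add: hrefl_def vrefl_def case_prod_beta)
  have "g \<in> {id, hrefl}" if "g \<in> sym_generated {hrefl}" for g
    using that unfolding sym_generated_def
    by (induction rule: generate.induct) (auto simp: one ih mult bid bh hh)
  then show "sym_generated {hrefl} = {id, hrefl}"
    unfolding sym_generated_def by (auto intro: generate.incl generate.one[of "BijGroup UNIV", unfolded one])
  have "g \<in> {id, hrefl, vrefl, hrefl \<circ> vrefl}" if "g \<in> sym_generated {hrefl, vrefl}" for g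
    using that unfolding sym_generated_def
    by (induction rule: generate.induct) (auto simp: one ih iv mult comp_def bid bh bv bhv[unfolded comp_def] pt)
  moreover have "hrefl \<circ> vrefl \<in> sym_generated {hrefl, vrefl}"
    unfolding sym_generated_def
    using generate.eng[OF generate.incl generate.incl, of hrefl "{hrefl, vrefl}" vrefl "BijGroup UNIV"]
    by (simp add: mult bh bv)
  ultimately show "sym_generated {hrefl, vrefl} = {id, hrefl, vrefl, hrefl \<circ> vrefl}"
    unfolding sym_generated_def by (auto intro: generate.incl generate.one[of "BijGroup UNIV", unfolded one])
qed

text \<open>The zig-zag path \<open>NE(0,0)\<close> has its lowest point in column \<open>i \<ge> 0\<close> at height
  \<open>2\<lceil>i/2\<rceil>\<close>.\<close>

definition B :: "nat \<Rightarrow> (int \<times> int) ugraph" where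
  "B n = grid_graph {(i, j). 0 \<le> i \<and> i \<le> 2 * int n - 1 \<and>
     2 * \<lceil>real_of_int i / 2\<rceil> \<le> j \<and> j \<le> 2 * int n - 1}"

text \<open>Lying on or below \<open>NE(-n+1,-1)\<close> means \<open>i \<ge> -(n - 1 - 2\<lfloor>j/2\<rfloor>)\<close> for \<open>j \<ge> 0\<close>, and
  symmetrically for \<open>NW(n-1,-1)\<close>.\<close>

definition C :: "nat \<Rightarrow> (int \<times> int) ugraph" where
  "C n = grid_graph {(i, j). 0 \<le> j \<and> \<bar>i\<bar> \<le> int n - 1 - 2 * \<lfloor>real_of_int j / 2\<rfloor>}"

text \<open>\<^const>\<open>MD\<close> is the rotated drawing of the graph of black squares of the \<open>2n \<times> 2n\<close>
  chessboard; the black diagonal \<open>a = b\<close> is drawn on the horizontal axis.\<close>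

definition chessboard_graph :: "nat \<Rightarrow> (int \<times> int) ugraph" where
  "chessboard_graph n = (let S = {(a, b). a \<in> {1..2 * int n} \<and> b \<in> {1..2 * int n} \<and> even (a + b)} in
     \<lparr>verts = S,
      edges = {{p, q} | p q. p \<in> S \<and> q \<in> S \<and>
        p \<noteq> q \<and> \<bar>fst p - fst q\<bar> \<le> 1 \<and> \<bar>snd p - snd q\<bar> \<le> 1}\<rparr>)"

definition draw :: "nat \<Rightarrow> int \<times> int \<Rightarrow> real \<times> real" where
  "draw n = (\<lambda>(a, b). ((of_int a + of_int b) / 2 - real n - 1/2, (of_int b - of_int a) / 2))"

lemma draw_inj: "inj (draw n)"
  by (auto simp: inj_on_def draw_def)

lemma draw_verts: "draw n ` verts (chessboard_graph n) = verts (MD n)"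
proof (intro equalityI subsetI)
  fix p assume "p \<in> draw n ` verts (chessboard_graph n)"
  then obtain a b where ab: "p = draw n (a, b)" "1 \<le> a" "a \<le> 2 * int n" "1 \<le> b" "b \<le> 2 * int n"
    "even (a + b)" by (auto simp: chessboard_graph_def)
  from ab(6) obtain s where s: "a + b = 2 * s" by (rule evenE)
  have 1: "(of_int a + of_int b) / 2 - real n - 1/2 - 1/2 = of_int (s - int n - 1)"
    using arg_cong[OF s, of real_of_int] by (simp add: field_simps)
  have 2: "(real_of_int b - of_int a) / 2 = of_int (s - a)"
    using arg_cong[OF s, of real_of_int] by (simp add: field_simps)
  have "1 \<le> real_of_int a" "real_of_int a \<le> 2 * real n" "1 \<le> real_of_int b" "real_of_int b \<le> 2 * real n"
    using ab(2-5) by linarith+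
  then have 3: "\<bar>(of_int a + of_int b) / 2 - real n - 1/2\<bar> + \<bar>(of_int b - of_int a) / 2\<bar> \<le> real n - 1/2"
    by (simp add: field_simps abs_if)
  have "(real_of_int a + of_int b) / 2 - real n - 1/2 - 1/2 \<in> \<int>" "(real_of_int b - of_int a) / 2 \<in> \<int>"
    unfolding 1 2 by (rule Ints_of_int)+
  with 3 show "p \<in> verts (MD n)"
    unfolding ab(1) MD_def grid_graph_def draw_def by simp
next
  fix p assume "p \<in> verts (MD n)"
  then obtain x y where p: "p = (x, y)" "x - 1/2 \<in> \<int>" "y \<in> \<int>" "\<bar>x\<bar> + \<bar>y\<bar> \<le> real n - 1/2"
    by (auto simp: MD_def grid_graph_def)
  from p(2,3) obtain k l where kl: "x - 1/2 = of_int k" "y = of_int l" by (auto elim!: Ints_cases)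
  then have x: "x = of_int k + 1/2" by simp
  let ?a = "k + int n + 1 - l" and ?b = "k + int n + 1 + l"
  have "p = draw n (?a, ?b)" by (simp add: p(1) draw_def x kl(2) field_simps)
  moreover have "1 \<le> ?a" "?a \<le> 2 * int n" "1 \<le> ?b" "?b \<le> 2 * int n"
    using p(4) unfolding x kl(2) by linarith+
  moreover have "even (?a + ?b)" by presburger
  ultimately show "p \<in> draw n ` verts (chessboard_graph n)" by (auto simp: chessboard_graph_def)
qed

lemma draw_adj:
  assumes "even (fst p + snd p)" "even (fst q + snd q)"
  shows "\<bar>fst (draw n p) - fst (draw n q)\<bar> + \<bar>snd (draw n p) - snd (draw n q)\<bar> = 1
    \<longleftrightarrow> p \<noteq> q \<and> \<bar>fst p - fst q\<bar> \<le> 1 \<and> \<bar>snd p - snd q\<bar> \<le> 1" (is "?l = 1 \<longleftrightarrow> ?R")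
proof -
  have "?l = max \<bar>of_int (fst p - fst q)\<bar> \<bar>of_int (snd p - snd q)\<bar>"
    by (simp add: draw_def case_prod_beta field_simps max_def abs_if)
  also have "\<dots> = of_int (max \<bar>fst p - fst q\<bar> \<bar>snd p - snd q\<bar>)" by (simp add: of_int_max)
  finally have "?l = 1 \<longleftrightarrow> max \<bar>fst p - fst q\<bar> \<bar>snd p - snd q\<bar> = 1" by linarith
  also have "\<dots> \<longleftrightarrow> ?R" by (auto simp: prod_eq_iff)
  finally show ?thesis .
qed

lemma MD_chessboard: "map_graph (draw n) (chessboard_graph n) = MD n"
proof -
  let ?S = "verts (chessboard_graph n)" and ?f = "draw n"
  have eq: "(\<bar>fst (?f p) - fst (?f q)\<bar> + \<bar>snd (?f p) - snd (?f q)\<bar> = 1)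
      = (p \<noteq> q \<and> \<bar>fst p - fst q\<bar> \<le> 1 \<and> \<bar>snd p - snd q\<bar> \<le> 1)" if "p \<in> ?S" "q \<in> ?S" for p q
    using that by (intro draw_adj) (auto simp: chessboard_graph_def)
  have 1: "edges (MD n) = {{p, q} | p q. p \<in> ?f ` ?S \<and> q \<in> ?f ` ?S \<and>
      \<bar>fst p - fst q\<bar> + \<bar>snd p - snd q\<bar> = 1}"
    unfolding draw_verts by (simp add: MD_def grid_graph_def)
  have 2: "edges (chessboard_graph n) = {{p, q} | p q. p \<in> ?S \<and> q \<in> ?S \<and>
      p \<noteq> q \<and> \<bar>fst p - fst q\<bar> \<le> 1 \<and> \<bar>snd p - snd q\<bar> \<le> 1}"
    by (simp add: chessboard_graph_def Let_def)
  have img: "(\<lambda>e. f ` e) ` {{p, q} | p q. p \<in> S \<and> q \<in> S \<and> Q p q} =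
      {{p, q} | p q. p \<in> f ` S \<and> q \<in> f ` S \<and> R p q}"
    if QR: "\<And>p q. p \<in> S \<Longrightarrow> q \<in> S \<Longrightarrow> R (f p) (f q) = Q p q" for f :: "'a \<Rightarrow> 'b" and S Q R
  proof (intro equalityI subsetI)
    fix e assume "e \<in> (\<lambda>e. f ` e) ` {{p, q} | p q. p \<in> S \<and> q \<in> S \<and> Q p q}"
    then obtain p q where "e = f ` {p, q}" "p \<in> S" "q \<in> S" "Q p q" by blast
    then have "e = {f p, f q}" "f p \<in> f ` S" "f q \<in> f ` S" "R (f p) (f q)" by (simp_all add: QR)
    then show "e \<in> {{p, q} | p q. p \<in> f ` S \<and> q \<in> f ` S \<and> R p q}" by blast
  next
    fix e assume "e \<in> {{p, q} | p q. p \<in> f ` S \<and> q \<in> f ` S \<and> R p q}"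
    then obtain p q where "e = {f p, f q}" "p \<in> S" "q \<in> S" "R (f p) (f q)" by blast
    then have "e = f ` {p, q}" "p \<in> S" "q \<in> S" "Q p q" by (simp_all add: QR)
    then show "e \<in> (\<lambda>e. f ` e) ` {{p, q} | p q. p \<in> S \<and> q \<in> S \<and> Q p q}" by blast
  qed
  have "(\<lambda>e. ?f ` e) ` edges (chessboard_graph n) = edges (MD n)"
    unfolding 1 2 by (rule img) (rule eq)
  then show ?thesis
    using draw_verts[of n] by (simp add: map_graph_def)
qed

end

theory Submission
  imports Defs "Jordan_Normal_Form.Determinant"
begin

text \<open>An \<open>h\<close>-invariant spanning tree of \<open>MD\<^bsub>n\<^esub>\<close> contains the whole horizontal axis, so it is determined by
  the spanning forest that it induces on the upper half, rooted at the axis. Temperley's correspondence on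
  the doubled lattice matches these forests with the perfect matchings of \<open>C\<^bsub>2n-2\<^esub>\<close>, and these in
  turn with the rooted forests of the planar dual. The dual forests are counted by the matrix-tree theorem:
  in the coordinates of the chessboard the dual Laplacian is diagonalized by symmetrized products of sines.
  If the tree is also \<open>v\<close>-invariant, then the forest does not cross the vertical axis, so that
  everything takes place in the right half of \<open>C\<^bsub>2n-2\<^esub>\<close>, which is a copy of \<open>B\<^bsub>n-1\<^esub>\<close>; on the spectral
  side only the modes vanishing on the vertical axis survive.\<close>

section \<open>Rooted functions\<close>

text \<open>Forests are handled as parent functions, and \<open>rooted_on\<close> forbids nonempty
  invariant sets instead of speaking of paths or iterates; most acyclicity arguments then consist in
  exhibiting an invariant set. Planar duality needs an inside and an outside. In place of topology,
  a node counts as enclosed if the vertical ray above it meets an odd number of edges of the cycle;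
  in place of Euler's formula, the two colour classes of the region are counted. The determinant is
  evaluated for the faces since sines meet their boundary conditions: a face is an interior white
  square of the board, all edges across the staircase are present and lead to roots in the border
  rows and columns \<open>0\<close> and \<open>2 * m + 1\<close>, and the edges missing along the
  horizontal axis are absorbed by symmetry under transposition. For the primal forests it is the
  staircase that lacks edges. The eigenvalue \<open>4 - 4 * cos x * cos y\<close> contains a product
  because the edges of the diamond are diagonal steps on the board; trigonometric identities bring
  it to the stated forms. The prefactor of the second formula equals 1.\<close>

text \<open>Points outside \<open>A\<close> are roots: for finite \<open>A\<close> the condition says that every orbit of \<open>f\<close> leaves \<open>A\<close>.\<close>

definition rooted_on :: "'a set \<Rightarrow> ('a \<Rightarrow> 'a) \<Rightarrow> bool" where
  "rooted_on A f \<longleftrightarrow> (\<forall>X\<subseteq>A. X \<noteq> {} \<longrightarrow> (\<exists>x\<in>X. f x \<notin> X))"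

lemma rooted_onD: "rooted_on A f \<Longrightarrow> X \<subseteq> A \<Longrightarrow> X \<noteq> {} \<Longrightarrow> \<exists>x\<in>X. f x \<notin> X"
  by (auto simp: rooted_on_def)

lemma rooted_on_cong:
  assumes "\<And>x. x \<in> A \<Longrightarrow> f x = g x"
  shows "rooted_on A f \<longleftrightarrow> rooted_on A g"
  unfolding rooted_on_def using assms by (metis subsetD)

lemma rooted_on_neq: "rooted_on A f \<Longrightarrow> x \<in> A \<Longrightarrow> f x \<noteq> x"
  using rooted_onD[of A f "{x}"] by auto

lemma rooted_on_no_2cycle: "rooted_on A f \<Longrightarrow> x \<in> A \<Longrightarrow> f x \<in> A \<Longrightarrow> f (f x) \<noteq> x"
  using rooted_onD[of A f "{x, f x}"] by auto

text \<open>Injectivity has to cover the values too: otherwise \<open>\<phi>\<close> could send a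
  root into the image of \<open>A\<close> and so create an invariant set.\<close>

lemma rooted_on_image:
  assumes "rooted_on A f" "inj_on \<phi> (A \<union> f ` A)" "\<And>x. x \<in> A \<Longrightarrow> g (\<phi> x) = \<phi> (f x)"
  shows "rooted_on (\<phi> ` A) g"
  unfolding rooted_on_def
proof (intro allI impI)
  fix X assume X: "X \<subseteq> \<phi> ` A" "X \<noteq> {}"
  let ?Y = "{x \<in> A. \<phi> x \<in> X}"
  obtain x where x: "x \<in> ?Y" "f x \<notin> ?Y" using rooted_onD[OF assms(1), of ?Y] X by blast
  have "\<phi> (f x) \<notin> X"
  proof
    assume "\<phi> (f x) \<in> X"
    then obtain y where y: "y \<in> A" "\<phi> (f x) = \<phi> y" using X(1) by blast
    then have "f x = y" using assms(2) x(1) by (auto simp: inj_on_def)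
    then show False using x y \<open>\<phi> (f x) \<in> X\<close> by simp
  qed
  then show "\<exists>x\<in>X. g x \<notin> X" using x assms(3) by (intro bexI[of _ "\<phi> x"]) auto
qed

text \<open>A finite \<open>X\<close> contained in its image is permuted by \<open>f\<close>, hence
  invariant. This allows arguing with predecessors instead of images.\<close>

lemma rooted_on_no_surj:
  assumes "rooted_on A f" "X \<subseteq> A" "finite X" "X \<subseteq> f ` X"
  shows "X = {}"
proof (rule ccontr)
  assume "X \<noteq> {}"
  have "f ` X = X" using assms(3,4) by (metis card_image_le card_seteq finite_imageI)
  then show False using rooted_onD[OF assms(1,2) \<open>X \<noteq> {}\<close>] by blast
qed

text \<open>A rooted forest is determined by its undirected edges. If \<open>f\<close> and
  \<open>g\<close> differ at \<open>x\<close>, the edge of \<open>x\<close> under \<open>f\<close>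
  must be the edge of \<open>f x\<close> under \<open>g\<close>, so \<open>g (f x) = x\<close>; as
  \<open>f\<close> has no 2-cycle, they differ at \<open>f x\<close> as well, and the set of
  disagreements is invariant.\<close>

lemma rooted_on_same_edges:
  assumes f: "rooted_on A f" and g: "rooted_on A g"
    and eq: "\<And>v. v \<in> A \<Longrightarrow> \<exists>w\<in>A. {v, f v} = {w, g w}"
    and v: "v \<in> A"
  shows "f v = g v"
proof (rule ccontr)
  assume neq: "f v \<noteq> g v"
  let ?X = "{v \<in> A. f v \<noteq> g v}"
  have "f x \<in> ?X" if x: "x \<in> ?X" for x
  proof -
    from x eq obtain w where w: "w \<in> A" "{x, f x} = {w, g w}" by blast
    with x have "w = f x" "g w = x" by (auto simp: doubleton_eq_iff)
    moreover from this w(1) rooted_on_no_2cycle[OF f, of x] x have "f w \<noteq> g w" by auto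
    ultimately show ?thesis using w(1) by auto
  qed
  moreover have "?X \<noteq> {}" using neq v by blast
  ultimately show False using rooted_onD[OF f, of ?X] by auto
qed

text \<open>Greedy growth from the roots: a maximal rooted partial choice is total, since
  \<open>step\<close> applied to the unattached nodes yields one more node to attach. Here
  \<open>nx x e\<close> is the end of the arc \<open>e\<close> at \<open>x\<close>.\<close>

lemma exists_rooted_on:
  assumes "finite A"
    and step: "\<And>X. X \<subseteq> A \<Longrightarrow> X \<noteq> {} \<Longrightarrow> \<exists>x\<in>X. \<exists>e\<in>N x. nx x e \<notin> X"
  shows "\<exists>p \<in> Pi\<^sub>E A N. rooted_on A (\<lambda>x. nx x (p x))"
proof -
  \<comment> \<open>The last clause keeps the nodes of \<open>Y\<close> from pointing to nodes not
    yet attached, so a newly attached node has no predecessor and cannot close a cycle.\<close>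
  define P where "P Y \<longleftrightarrow> Y \<subseteq> A \<and> (\<exists>p \<in> Pi\<^sub>E Y N. rooted_on Y (\<lambda>x. nx x (p x)) \<and>
    (\<forall>x\<in>Y. nx x (p x) \<notin> A - Y))" for Y
  have "P {}" by (simp add: P_def rooted_on_def)
  moreover have "finite (Collect P)"
    by (rule finite_subset[of _ "Pow A"]) (auto simp: P_def assms(1))
  ultimately obtain Y where Y: "P Y" and max: "\<And>Z. P Z \<Longrightarrow> Y \<subseteq> Z \<Longrightarrow> Z = Y"
    using finite_has_maximal[of "Collect P"] by (metis empty_iff mem_Collect_eq)
  from Y obtain p where p: "Y \<subseteq> A" "p \<in> Pi\<^sub>E Y N" "rooted_on Y (\<lambda>x. nx x (p x))"
    "\<And>x. x \<in> Y \<Longrightarrow> nx x (p x) \<notin> A - Y" unfolding P_def by blast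
  have "Y = A"
  proof (rule ccontr)
    assume "Y \<noteq> A"
    then obtain x e where xe: "x \<in> A - Y" "e \<in> N x" "nx x e \<notin> A - Y"
      using step[of "A - Y"] p(1) by blast
    let ?p = "p(x := e)" and ?Y = "insert x Y"
    have "rooted_on ?Y (\<lambda>x. nx x (?p x))"
      unfolding rooted_on_def
    proof (intro allI impI)
      fix X assume X: "X \<subseteq> ?Y" "X \<noteq> {}"
      show "\<exists>z\<in>X. nx z (?p z) \<notin> X"
      proof (cases "X = {x}")
        case True
        then show ?thesis using xe by auto
      next
        case False
        then obtain z where z: "z \<in> X - {x}" "nx z (p z) \<notin> X - {x}"
          using rooted_onD[OF p(3), of "X - {x}"] X by blast
        moreover have "nx z (p z) \<noteq> x" using p(4)[of z] z X xe(1) by blast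
        ultimately show ?thesis by (intro bexI[of _ z]) auto
      qed
    qed
    moreover have "?p \<in> Pi\<^sub>E ?Y N" using p(2) xe by (auto simp: PiE_iff extensional_def)
    moreover have "\<forall>z\<in>?Y. nx z (?p z) \<notin> A - ?Y" using p(4) xe by auto
    ultimately have "P ?Y" unfolding P_def using p(1) xe(1) by blast
    then show False using max[of ?Y] xe by blast
  qed
  with p show ?thesis by auto
qed

section \<open>The matrix-tree theorem for rooted functions\<close>

lemma prod_sum_PiE:
  fixes g :: "'a \<Rightarrow> 'b \<Rightarrow> 'c :: comm_semiring_1"
  assumes "finite A" "\<And>x. x \<in> A \<Longrightarrow> finite (N x)"
  shows "(\<Prod>x\<in>A. \<Sum>d\<in>N x. g x d) = (\<Sum>q\<in>Pi\<^sub>E A N. \<Prod>x\<in>A. g x (q x))"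
  using assms
proof (induction A rule: finite_induct)
  case empty
  then show ?case by simp
next
  case (insert a A)
  have "(\<Sum>q\<in>Pi\<^sub>E (insert a A) N. \<Prod>x\<in>insert a A. g x (q x)) =
      (\<Sum>(d, q)\<in>N a \<times> Pi\<^sub>E A N. \<Prod>x\<in>insert a A. g x ((q(a := d)) x))"
    unfolding PiE_insert_eq
    by (subst sum.reindex[OF inj_combinator[OF insert.hyps(2)]]) (simp add: case_prod_beta)
  also have "\<dots> = (\<Sum>(d, q)\<in>N a \<times> Pi\<^sub>E A N. g a d * (\<Prod>x\<in>A. g x (q x)))"
  proof (intro sum.cong refl, clarify)
    fix d q
    have "(\<Prod>x\<in>A. g x ((q(a := d)) x)) = (\<Prod>x\<in>A. g x (q x))"
      using insert.hyps by (intro prod.cong) auto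
    then show "(\<Prod>x\<in>insert a A. g x ((q(a := d)) x)) = g a d * (\<Prod>x\<in>A. g x (q x))"
      using insert.hyps by simp
  qed
  also have "\<dots> = (\<Sum>d\<in>N a. g a d) * (\<Sum>q\<in>Pi\<^sub>E A N. \<Prod>x\<in>A. g x (q x))"
    by (simp add: sum_product sum.cartesian_product)
  finally show ?case using insert by simp
qed

text \<open>In the Leibniz formula a permutation with nonzero term moves each non-fixed
  \<open>e i\<close> to \<open>f (e i)\<close>, so the moved points form an invariant set; for
  rooted \<open>f\<close> only the identity remains. Otherwise the matrix has a kernel
  vector.\<close>

lemma det_functional_matrix:
  fixes e :: "nat \<Rightarrow> 'a" and f :: "'a \<Rightarrow> 'a"
  assumes e: "bij_betw e {0..<n} A"
  defines "M \<equiv> mat n n (\<lambda>(i, k). of_bool (i = k) - of_bool (f (e i) = e k) :: real)"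
  shows "det M = of_bool (rooted_on A f)"
proof -
  have M: "M \<in> carrier_mat n n" by (simp add: M_def)
  have inj: "e i = e k \<longleftrightarrow> i = k" if "i < n" "k < n" for i k
    using e that by (auto simp: bij_betw_def inj_on_def)
  have eA: "e i \<in> A" if "i < n" for i using e that by (auto simp: bij_betw_def)
  show ?thesis
  proof (cases "rooted_on A f")
    case True
    have "signof p * (\<Prod>i = 0..<n. M $$ (i, p i)) = 0"
      if p: "p permutes {0..<n}" "p \<noteq> id" for p
    proof -
      let ?X = "e ` {i. i < n \<and> p i \<noteq> i}"
      from p obtain i0 where "p i0 \<noteq> i0" by (auto simp: fun_eq_iff)
      then have "?X \<noteq> {}" using p(1) by (auto simp: permutes_def)
      moreover have "?X \<subseteq> A" using eA by auto
      ultimately obtain i where i: "i < n" "p i \<noteq> i" "f (e i) \<notin> ?X"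
        using rooted_onD[OF True, of ?X] by blast
      have pi: "p i < n" using permutes_in_image[OF p(1), of i] i(1) by auto
      have "p (p i) \<noteq> p i" using i(2) permutes_inj[OF p(1)] by (auto simp: inj_def)
      then have "f (e i) \<noteq> e (p i)" using i(3) pi by auto
      then have "M $$ (i, p i) = 0" using i pi by (simp add: M_def)
      then show ?thesis using i(1) by (auto intro: prod_zero)
    qed
    then have "det M = (\<Sum>p\<in>{id}. signof p * (\<Prod>i = 0..<n. M $$ (i, p i)))"
      unfolding det_def'[OF M]
      by (intro sum.mono_neutral_right) (auto simp: finite_permutations permutes_id)
    also have "\<dots> = 1"
      using rooted_on_neq[OF True] eA by (simp add: sign_id M_def)
    finally show ?thesis using True by simp
  next
    case False
    then obtain X where X: "X \<subseteq> A" "X \<noteq> {}" "\<And>x. x \<in> X \<Longrightarrow> f x \<in> X"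
      unfolding rooted_on_def by blast
    \<comment> \<open>The largest invariant set. For a kernel vector, \<open>f x \<in> Y\<close>
      must be equivalent to \<open>x \<in> Y\<close>; an arbitrary invariant \<open>X\<close> gives
      one implication only.\<close>
    define Y where "Y = {x. \<forall>k. (f ^^ k) x \<in> A}"
    have "(f ^^ k) x \<in> X" if "x \<in> X" for x k using that X(3) by (induction k) auto
    then have XY: "X \<subseteq> Y" unfolding Y_def using X(1) by blast
    have YA: "Y \<subseteq> A" unfolding Y_def by (metis (mono_tags, lifting) funpow_0 mem_Collect_eq subsetI)
    have Yf: "f x \<in> Y \<longleftrightarrow> x \<in> Y" if x: "x \<in> A" for x
    proof -
      have "(\<forall>k. (f ^^ k) x \<in> A) \<longleftrightarrow> (\<forall>k. (f ^^ Suc k) x \<in> A)"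
        using x by (metis funpow_0 not0_implies_Suc)
      then show ?thesis by (simp only: Y_def mem_Collect_eq funpow_Suc_right o_apply)
    qed
    let ?v = "vec n (\<lambda>i. of_bool (e i \<in> Y) :: real)"
    obtain x where "x \<in> X" using X(2) by blast
    then obtain i where i: "i < n" "e i \<in> Y" using e X(1) XY by (force simp: bij_betw_def)
    then have "?v $ i \<noteq> 0\<^sub>v n $ i" by simp
    then have v: "?v \<in> carrier_vec n" "?v \<noteq> 0\<^sub>v n" by (auto simp del: index_zero_vec index_vec)
    have "M *\<^sub>v ?v = 0\<^sub>v n"
    proof (rule eq_vecI)
      fix i assume "i < dim_vec (0\<^sub>v n :: real vec)"
      then have i: "i < n" by simp
      have *: "(\<Sum>k = 0..<n. of_bool (f (e i) = e k) * of_bool (e k \<in> Y)) = (of_bool (f (e i) \<in> Y) :: real)"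
      proof (cases "f (e i) \<in> A")
        case True
        then obtain k0 where k0: "k0 < n" "e k0 = f (e i)" using e by (force simp: bij_betw_def)
        have "(\<Sum>k = 0..<n. of_bool (f (e i) = e k) * of_bool (e k \<in> Y)) =
          (\<Sum>k = 0..<n. if k = k0 then of_bool (f (e i) \<in> Y) else (0 :: real))"
          using k0 inj by (intro sum.cong) (auto simp flip: k0(2))
        also have "\<dots> = of_bool (f (e i) \<in> Y)" using k0 by simp
        finally show ?thesis .
      next
        case False
        then have "\<And>k. k < n \<Longrightarrow> f (e i) \<noteq> e k" using eA by metis
        then show ?thesis using False YA by auto
      qed
      have "(M *\<^sub>v ?v) $ i = (\<Sum>k = 0..<n. (of_bool (i = k) - of_bool (f (e i) = e k)) * of_bool (e k \<in> Y))"
        using i by (simp add: M_def scalar_prod_def)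
      also have "\<dots> = (\<Sum>k = 0..<n. if i = k then of_bool (e i \<in> Y) else 0) - of_bool (f (e i) \<in> Y)"
        unfolding *[symmetric] sum_subtractf[symmetric]
        by (intro sum.cong) (auto simp: algebra_simps)
      also have "\<dots> = 0" using i Yf[OF eA[OF i]] by simp
      finally show "(M *\<^sub>v ?v) $ i = 0\<^sub>v n $ i" using i by simp
    qed (simp add: M_def)
    then have "det M = 0" using det_0_iff_vec_prod_zero[OF M] v by blast
    then show ?thesis using False by simp
  qed
qed

text \<open>Row \<open>x\<close> of the Laplacian is the sum, over the arcs at \<open>x\<close>, of
  rows of functional matrices. Multilinearity expands the determinant into a sum over all choices
  \<open>q\<close>, and each summand is 0 or 1 by \<open>det_functional_matrix\<close>. An arc
  leaving \<open>A\<close> contributes to the diagonal only.\<close>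

lemma card_rooted_on_det:
  fixes e :: "nat \<Rightarrow> 'a" and nx :: "'a \<Rightarrow> 'b \<Rightarrow> 'a"
  assumes e: "bij_betw e {0..<n} A" and N: "\<And>x. x \<in> A \<Longrightarrow> finite (N x)"
  shows "real (card {q \<in> Pi\<^sub>E A N. rooted_on A (\<lambda>x. nx x (q x))}) =
    det (mat n n (\<lambda>(i, k). \<Sum>d\<in>N (e i). of_bool (i = k) - of_bool (nx (e i) d = e k)))"
    (is "_ = det ?L")
proof -
  have fin: "finite A" using e bij_betw_finite by blast
  then have finP: "finite (Pi\<^sub>E A N)" using N by (rule finite_PiE)
  \<comment> \<open>Indices are expressed through nodes, so that the product over rows becomes a
    product over \<open>A\<close>, to which \<open>prod_sum_PiE\<close> applies.\<close>
  define e' where "e' = inv_into {0..<n} e"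
  have e': "e' (e i) = i" if "i < n" for i
    using e that by (simp add: e'_def bij_betw_def)
  define M where "M q = mat n n (\<lambda>(i, k). of_bool (i = k) - of_bool (nx (e i) (q (e i)) = e k) :: real)" for q
  have "det ?L = (\<Sum>p | p permutes {0..<n}. signof p * (\<Prod>i = 0..<n. ?L $$ (i, p i)))"
    by (rule det_def') simp
  also have "\<dots> = (\<Sum>p | p permutes {0..<n}. \<Sum>q\<in>Pi\<^sub>E A N. signof p * (\<Prod>i = 0..<n. M q $$ (i, p i)))"
  proof (rule sum.cong[OF refl])
    fix p assume "p \<in> {p. p permutes {0..<n}}"
    then have p: "\<And>i. i < n \<Longrightarrow> p i < n" using permutes_in_image by fastforce
    have "(\<Prod>i = 0..<n. ?L $$ (i, p i)) =
        (\<Prod>i = 0..<n. \<Sum>d\<in>N (e i). of_bool (e' (e i) = p (e' (e i))) - of_bool (nx (e i) d = e (p (e' (e i)))))"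
      using p e' by (intro prod.cong) auto
    also have "\<dots> = (\<Prod>x\<in>A. \<Sum>d\<in>N x. of_bool (e' x = p (e' x)) - of_bool (nx x d = e (p (e' x))))"
      by (rule prod.reindex_bij_betw[OF e])
    also have "\<dots> = (\<Sum>q\<in>Pi\<^sub>E A N. \<Prod>x\<in>A. of_bool (e' x = p (e' x)) - of_bool (nx x (q x) = e (p (e' x))))"
      by (rule prod_sum_PiE[OF fin N])
    also have "\<dots> = (\<Sum>q\<in>Pi\<^sub>E A N. \<Prod>i = 0..<n. of_bool (e' (e i) = p (e' (e i))) - of_bool (nx (e i) (q (e i)) = e (p (e' (e i)))))"
      by (intro sum.cong refl prod.reindex_bij_betw[OF e, symmetric])
    also have "\<dots> = (\<Sum>q\<in>Pi\<^sub>E A N. \<Prod>i = 0..<n. M q $$ (i, p i))"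
      using p e' by (intro sum.cong refl prod.cong) (auto simp: M_def)
    finally show "signof p * (\<Prod>i = 0..<n. ?L $$ (i, p i)) =
        (\<Sum>q\<in>Pi\<^sub>E A N. signof p * (\<Prod>i = 0..<n. M q $$ (i, p i)))"
      by (simp only: sum_distrib_left)
  qed
  also have "\<dots> = (\<Sum>q\<in>Pi\<^sub>E A N. det (M q))"
    by (subst sum.swap) (intro sum.cong refl det_def'[symmetric], simp add: M_def)
  also have "\<dots> = (\<Sum>q\<in>Pi\<^sub>E A N. of_bool (rooted_on A (\<lambda>x. nx x (q x))))"
    unfolding M_def by (intro sum.cong refl det_functional_matrix[OF e])
  also have "\<dots> = real (card {q \<in> Pi\<^sub>E A N. rooted_on A (\<lambda>x. nx x (q x))})"
    using finP by (simp add: sum.If_cases of_bool_def Int_def)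
  finally show ?thesis ..
qed

text \<open>The matrix \<open>P\<close> of eigenvectors satisfies \<open>L P = P D\<close> and has a
  diagonal Gram matrix without zero entries, hence is invertible. That \<open>A\<close> and
  \<open>T\<close> are indexed by the same \<open>n\<close> replaces any proof of
  completeness.\<close>

lemma det_eq_prod_eigenvalues:
  fixes e :: "nat \<Rightarrow> 'a" and e' :: "nat \<Rightarrow> 'b" and L :: "'a \<Rightarrow> 'a \<Rightarrow> real"
  assumes e: "bij_betw e {0..<n} A" and e': "bij_betw e' {0..<n} T"
    and eig: "\<And>x t. x \<in> A \<Longrightarrow> t \<in> T \<Longrightarrow> (\<Sum>y\<in>A. L x y * \<phi> t y) = \<mu> t * \<phi> t x"
    and orth: "\<And>s t. s \<in> T \<Longrightarrow> t \<in> T \<Longrightarrow> (\<Sum>x\<in>A. \<phi> s x * \<phi> t x) = of_bool (s = t) * c t"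
    and c: "\<And>t. t \<in> T \<Longrightarrow> c t \<noteq> 0"
  shows "det (mat n n (\<lambda>(i, k). L (e i) (e k))) = (\<Prod>t\<in>T. \<mu> t)"
proof -
  define P where "P = mat n n (\<lambda>(i, k). \<phi> (e' k) (e i))"
  define D where "D a = mat n n (\<lambda>(i, k). of_bool (i = k) * a (e' i))" for a :: "'b \<Rightarrow> real"
  let ?L = "mat n n (\<lambda>(i, k). L (e i) (e k))"
  have car: "P \<in> carrier_mat n n" "D a \<in> carrier_mat n n" "?L \<in> carrier_mat n n" for a
    by (auto simp: P_def D_def)
  have eA: "e i \<in> A" "e' i \<in> T" if "i < n" for i using e e' that by (auto simp: bij_betw_def)
  have inj: "e' i = e' k \<longleftrightarrow> i = k" if "i < n" "k < n" for i k
    using e' that by (auto simp: bij_betw_def inj_on_def)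
  have detD: "det (D a) = (\<Prod>t\<in>T. a t)" for a
  proof -
    have "det (D a) = prod_list (diag_mat (D a))"
      by (rule det_upper_triangular[OF _ car(2)]) (auto simp: D_def)
    also have "\<dots> = (\<Prod>i = 0..<n. a (e' i))"
      by (simp add: prod_list_diag_prod) (auto simp: D_def intro: prod.cong)
    also have "\<dots> = (\<Prod>t\<in>T. a t)" by (rule prod.reindex_bij_betw[OF e'])
    finally show ?thesis .
  qed
  have "?L * P = P * D \<mu>"
  proof (rule eq_matI)
    fix i k assume "i < dim_row (P * D \<mu>)" "k < dim_col (P * D \<mu>)"
    then have ik: "i < n" "k < n" by (auto simp: P_def D_def)
    have "(?L * P) $$ (i, k) = (\<Sum>l = 0..<n. L (e i) (e l) * \<phi> (e' k) (e l))"
      using ik by (simp add: P_def scalar_prod_def)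
    also have "\<dots> = (\<Sum>y\<in>A. L (e i) y * \<phi> (e' k) y)" by (rule sum.reindex_bij_betw[OF e])
    also have "\<dots> = \<mu> (e' k) * \<phi> (e' k) (e i)" by (intro eig eA ik)
    also have "\<dots> = (\<Sum>l = 0..<n. if l = k then \<mu> (e' k) * \<phi> (e' k) (e i) else 0)" using ik by simp
    also have "\<dots> = (\<Sum>l = 0..<n. \<phi> (e' l) (e i) * (of_bool (l = k) * \<mu> (e' l)))"
      by (intro sum.cong) auto
    also have "\<dots> = (P * D \<mu>) $$ (i, k)" using ik by (simp add: P_def D_def scalar_prod_def)
    finally show "(?L * P) $$ (i, k) = (P * D \<mu>) $$ (i, k)" .
  qed (auto simp: P_def D_def)
  then have 1: "det ?L * det P = det P * (\<Prod>t\<in>T. \<mu> t)"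
    using det_mult[OF car(3) car(1)] det_mult[OF car(1) car(2)] detD by metis
  have "transpose_mat P * P = D c"
  proof (rule eq_matI)
    fix i k assume "i < dim_row (D c)" "k < dim_col (D c)"
    then have ik: "i < n" "k < n" by (auto simp: D_def)
    have "(transpose_mat P * P) $$ (i, k) = (\<Sum>l = 0..<n. \<phi> (e' i) (e l) * \<phi> (e' k) (e l))"
      using ik by (simp add: P_def scalar_prod_def)
    also have "\<dots> = (\<Sum>x\<in>A. \<phi> (e' i) x * \<phi> (e' k) x)" by (rule sum.reindex_bij_betw[OF e])
    also have "\<dots> = of_bool (e' i = e' k) * c (e' k)" by (intro orth eA ik)
    also have "\<dots> = D c $$ (i, k)" using ik inj by (auto simp: D_def)
    finally show "(transpose_mat P * P) $$ (i, k) = D c $$ (i, k)" .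
  qed (auto simp: P_def D_def)
  then have "det (transpose_mat P) * det P = (\<Prod>t\<in>T. c t)"
    using det_mult[of "transpose_mat P" n P] car(1) detD by simp
  moreover have "(\<Prod>t\<in>T. c t) \<noteq> 0"
    using c bij_betw_finite[OF e'] by (simp add: prod_zero_iff)
  ultimately have "det P \<noteq> 0" by auto
  with 1 show ?thesis by simp
qed

section \<open>Temperley's correspondence on the doubled lattice\<close>

definition nbrs :: "int \<times> int \<Rightarrow> (int \<times> int) set" where
  "nbrs x = {(fst x + 1, snd x), (fst x - 1, snd x), (fst x, snd x + 1), (fst x, snd x - 1)}"

text \<open>The point reflection of \<open>x\<close> in \<open>e\<close>: if \<open>e\<close> is the
  midpoint of an edge at \<open>x\<close>, this is the other end.\<close>

definition opp :: "int \<times> int \<Rightarrow> int \<times> int \<Rightarrow> int \<times> int" where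
  "opp x e = (2 * fst e - fst x, 2 * snd e - snd x)"

text \<open>\<open>region False m\<close> is the vertex set of \<open>C\<^bsub>2m\<^esub>\<close>, and \<open>region True m\<close>, its right half, is a reflected
  copy of \<open>B\<^bsub>m\<^esub>\<close>.\<close>

definition region :: "bool \<Rightarrow> nat \<Rightarrow> (int \<times> int) set" where
  "region b m = {x. 0 \<le> snd x \<and> (b \<longrightarrow> 1 \<le> fst x) \<and> \<bar>fst x\<bar> \<le> 2 * int m - 1 - 2 * (snd x div 2)}"

text \<open>The odd nodes are the vertices of the primal graph, the even nodes its faces; both graphs
  have the remaining nodes as edges.\<close>

definition sublattice :: "bool \<Rightarrow> (int \<times> int) set" where
  "sublattice s = {x. odd (fst x) = s \<and> odd (snd x) = s}"

definition cls :: "bool \<Rightarrow> nat \<Rightarrow> bool \<Rightarrow> (int \<times> int) set" where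
  "cls b m s = region b m \<inter> sublattice s"

definition mids :: "bool \<Rightarrow> nat \<Rightarrow> (int \<times> int) set" where
  "mids b m = {x \<in> region b m. odd (fst x + snd x)}"

definition arcs :: "bool \<Rightarrow> nat \<Rightarrow> int \<times> int \<Rightarrow> (int \<times> int) set" where
  "arcs b m x = nbrs x \<inter> region b m"

text \<open>\<open>p x\<close> is the midpoint of the edge from \<open>x\<close> to its parent.
  Parents outside the class are the roots: for \<open>s = True\<close> they lie in row
  \<open>-1\<close>, for \<open>s = False\<close> beyond the staircase and, if \<open>b\<close>, on
  the vertical axis.\<close>

definition forests :: "bool \<Rightarrow> nat \<Rightarrow> bool \<Rightarrow> (int \<times> int \<Rightarrow> int \<times> int) set" where
  "forests b m s = {p \<in> Pi\<^sub>E (cls b m s) (arcs b m). rooted_on (cls b m s) (\<lambda>x. opp x (p x))}"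

text \<open>A perfect matching of the region with each edge oriented from its vertex or face node to
  its edge node.\<close>

definition dimers :: "bool \<Rightarrow> nat \<Rightarrow> (int \<times> int \<Rightarrow> int \<times> int) set" where
  "dimers b m = {g \<in> Pi\<^sub>E (cls b m False \<union> cls b m True) (arcs b m).
     bij_betw g (cls b m False \<union> cls b m True) (mids b m)}"

section \<open>Elementary geometry of the doubled lattice\<close>

lemma opp_opp [simp]: "opp (opp x e) e = x"
  by (simp add: opp_def)

lemma opp_inject [simp]: "opp x e = opp x e' \<longleftrightarrow> e = e'"
  by (auto simp: opp_def prod_eq_iff)

lemma nbrs_opp: "e \<in> nbrs x \<Longrightarrow> e \<in> nbrs (opp x e)"
  by (auto simp: nbrs_def opp_def prod_eq_iff)

lemma nbrs_sym: "e \<in> nbrs x \<longleftrightarrow> x \<in> nbrs e"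
  by (auto simp: nbrs_def prod_eq_iff)

lemma opp_neq: "e \<in> nbrs x \<Longrightarrow> opp x e \<noteq> x"
  by (auto simp: nbrs_def opp_def prod_eq_iff)

lemma opp_sublattice: "x \<in> sublattice s \<Longrightarrow> opp x e \<in> sublattice s"
  by (auto simp: sublattice_def opp_def)

lemma sublattice_disjoint: "x \<in> sublattice s \<Longrightarrow> x \<notin> sublattice (\<not> s)"
  by (auto simp: sublattice_def)

lemma nbrs_parity: "x \<in> sublattice s \<Longrightarrow> e \<in> nbrs x \<Longrightarrow> odd (fst e + snd e)"
  by (auto simp: sublattice_def nbrs_def)

lemma nbrs_same_sublattice:
  assumes "x \<in> sublattice s" "y \<in> sublattice s" "e \<in> nbrs x" "e \<in> nbrs y"
  shows "y = x \<or> y = opp x e"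
  using assms by (cases s) (auto simp: sublattice_def nbrs_def opp_def prod_eq_iff)

lemma finite_region [simp]: "finite (region b m)"
proof (rule finite_subset)
  show "region b m \<subseteq> {- 2 * int m..2 * int m} \<times> {0..2 * int m}"
    by (auto simp: region_def)
qed simp

lemma finite_cls [simp]: "finite (cls b m s)" and finite_mids [simp]: "finite (mids b m)"
  and finite_arcs [simp]: "finite (arcs b m x)"
  by (auto simp: cls_def mids_def arcs_def intro: finite_subset[OF _ finite_region[of b m]])

lemma cls_disjoint: "x \<in> cls b m s \<Longrightarrow> x \<notin> cls b m (\<not> s)"
  using sublattice_disjoint by (auto simp: cls_def)

lemma cls_union: "cls b m False \<union> cls b m True = cls b m s \<union> cls b m (\<not> s)"
  by (cases s) auto

lemma cls_subset: "cls b m s \<subseteq> cls b m False \<union> cls b m True"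
  by (cases s) auto

section \<open>Dimer configurations contain no cycles\<close>

text \<open>Along the cycles of the permutation, \<open>H\<close> is gained as often as it is
  lost.\<close>

lemma even_card_changes:
  fixes H :: "'a \<Rightarrow> bool"
  assumes "finite X" "f ` X = X"
  shows "even (card {x \<in> X. H (f x) \<noteq> H x})"
proof -
  have inj: "inj_on f X" using assms by (simp add: eq_card_imp_inj_on)
  have "f ` {x \<in> X. H (f x)} = {x \<in> X. H x}" using assms(2) by auto
  then have eq: "card {x \<in> X. H (f x)} = card {x \<in> X. H x}"
    by (metis (no_types, lifting) card_image inj inj_on_subset mem_Collect_eq subsetI)
  have "card {x \<in> X. H (f x)} = card {x \<in> X. H (f x) \<and> H x} + card {x \<in> X. H (f x) \<and> \<not> H x}"
    using assms(1) by (subst card_Un_disjoint[symmetric]) (auto intro!: arg_cong[of _ _ card])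
  moreover have "card {x \<in> X. H x} = card {x \<in> X. H (f x) \<and> H x} + card {x \<in> X. \<not> H (f x) \<and> H x}"
    using assms(1) by (subst card_Un_disjoint[symmetric]) (auto intro!: arg_cong[of _ _ card])
  moreover have "card {x \<in> X. H (f x) \<noteq> H x} =
      card {x \<in> X. H (f x) \<and> \<not> H x} + card {x \<in> X. \<not> H (f x) \<and> H x}"
    using assms(1) by (subst card_Un_disjoint[symmetric]) (auto intro!: arg_cong[of _ _ card])
  ultimately show ?thesis using eq by simp
qed

text \<open>A minimal nonempty invariant subset is permuted.\<close>

lemma closed_imp_permuted_subset:
  assumes "finite X" "X \<noteq> {}" "f ` X \<subseteq> X"
  obtains Y where "Y \<subseteq> X" "Y \<noteq> {}" "f ` Y = Y"
proof -
  let ?P = "{Y. Y \<subseteq> X \<and> Y \<noteq> {} \<and> f ` Y \<subseteq> Y}"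
  have "finite ?P" using assms(1) by (simp add: finite_subset[of _ "Pow X"])
  moreover have "X \<in> ?P" using assms by blast
  ultimately have "\<exists>Y\<in>?P. \<forall>Z\<in>?P. Z \<le> Y \<longrightarrow> Y = Z"
    by (intro finite_has_minimal) (simp, blast)
  then obtain Y where Y: "Y \<in> ?P" and min: "\<And>Z. Z \<in> ?P \<Longrightarrow> Z \<subseteq> Y \<Longrightarrow> Y = Z"
    by (elim bexE) simp
  have "f ` Y = Y" using Y by (intro min[symmetric]) auto
  then show thesis using Y by (intro that[of Y]) simp_all
qed

text \<open>A cycle of \<open>x \<mapsto> opp x (g x)\<close> through nodes of one sublattice encloses a nonempty finite set of nodes
  of the other sublattice. As the matching edges do not cross the cycle, this set is closed under the
  same map, and it lies strictly below the top of the cycle. So there is no cycle with a lowest top.\<close>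

lemma dimer_no_cycle:
  assumes g: "g \<in> Pi\<^sub>E (cls b m False \<union> cls b m True) (arcs b m)"
    and inj: "inj_on g (cls b m False \<union> cls b m True)"
    and X: "X \<subseteq> cls b m s" "X \<noteq> {}" "\<And>x. x \<in> X \<Longrightarrow> opp x (g x) \<in> X" "\<And>x. x \<in> X \<Longrightarrow> snd x \<le> int t"
  shows False
  using X
proof (induction t arbitrary: s X rule: less_induct)
  case (less t)
  let ?f = "\<lambda>x. opp x (g x)"
  have "finite X" by (rule finite_subset[OF less.prems(1) finite_cls])
  then obtain Y where Y: "Y \<subseteq> X" "Y \<noteq> {}" "?f ` Y = Y"
    using closed_imp_permuted_subset[of X ?f] less.prems(2,3) by (metis image_subsetI)
  have fY: "finite Y" by (rule finite_subset[OF Y(1) \<open>finite X\<close>])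
  have Ycls: "Y \<subseteq> cls b m s" using Y(1) less.prems(1) by blast
  have injY: "inj_on g Y" using inj Ycls cls_subset by (meson inj_on_subset subset_trans)
  have lat: "x \<in> sublattice s" and gn: "g x \<in> nbrs x" and gr: "g x \<in> region b m"
    and yf: "?f x \<in> Y" if "x \<in> Y" for x
    using that Ycls g cls_subset[of b m s] Y(3) by (auto simp: cls_def arcs_def PiE_iff)
  define Z where "Z = g ` Y"
  have fZ: "finite Z" using fY by (simp add: Z_def)
  \<comment> \<open>For \<open>x\<close> in the other sublattice only horizontal edges of the cycle
    can lie in its column. An odd number of them above \<open>x\<close> means that \<open>x\<close>
    is enclosed.\<close>
  define ray where "ray x = {e \<in> Z. fst e = fst x \<and> snd x < snd e}" for x
  have fr: "finite (ray x)" for x using fZ by (simp add: ray_def)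
  have Zpar: "odd (fst e + snd e)" if "e \<in> Z" for e
    using that nbrs_parity lat gn unfolding Z_def by blast
  \<comment> \<open>A closed curve crosses the boundary of a node set \<open>H\<close> an even
    number of times; \<open>Q\<close> describes the edges that do so.\<close>
  have changes: "even (card {e \<in> Z. Q e})" if "\<And>x. x \<in> Y \<Longrightarrow> Q (g x) \<longleftrightarrow> H (?f x) \<noteq> H x"
    for Q and H :: "int \<times> int \<Rightarrow> bool"
  proof -
    have "{e \<in> Z. Q e} = g ` {x \<in> Y. H (?f x) \<noteq> H x}" using that by (auto simp: Z_def)
    then have "card {e \<in> Z. Q e} = card {x \<in> Y. H (?f x) \<noteq> H x}"
      using injY by (metis (no_types, lifting) card_image inj_on_subset mem_Collect_eq subsetI)
    then show ?thesis using even_card_changes[OF fY Y(3), of H] by simp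
  qed
  have sing: "card {e \<in> Z. e = z} = of_bool (z \<in> Z)" for z
  proof -
    have "{e \<in> Z. e = z} = (if z \<in> Z then {z} else {})" by auto
    then show ?thesis by simp
  qed
  have cross_up: "odd (card (ray (i, j + 2))) \<noteq> odd (card (ray (i, j))) \<longleftrightarrow> (i, j + 1) \<in> Z"
    if ij: "(i, j) \<in> sublattice (\<not> s)" for i j
  proof -
    have "(i, j + 2) \<notin> Z" using Zpar[of "(i, j + 2)"] ij by (auto simp: sublattice_def)
    then have "e \<in> ray (i, j) \<longleftrightarrow> e \<in> ray (i, j + 2) \<union> {e \<in> Z. e = (i, j + 1)}" for e
      by (cases e; cases "snd e = j + 2") (auto simp: ray_def)
    then have "ray (i, j) = ray (i, j + 2) \<union> {e \<in> Z. e = (i, j + 1)}" by blast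
    moreover have "ray (i, j + 2) \<inter> {e \<in> Z. e = (i, j + 1)} = {}" by (auto simp: ray_def)
    ultimately have "card (ray (i, j)) = card (ray (i, j + 2)) + card {e \<in> Z. e = (i, j + 1)}"
      using fr fZ by (simp add: card_Un_disjoint)
    then show ?thesis unfolding sing by (cases "(i, j + 1) \<in> Z") simp_all
  qed
  have cross_right: "odd (card (ray (i + 2, j))) \<noteq> odd (card (ray (i, j))) \<longleftrightarrow> (i + 1, j) \<in> Z"
    if ij: "(i, j) \<in> sublattice (\<not> s)" for i j
  proof -
    \<comment> \<open>The part above height \<open>j\<close> of the column between the two rays. A
      cycle edge leaves it sideways through one of the rays or downwards at
      \<open>(i + 1, j)\<close>.\<close>
    let ?H = "\<lambda>v. fst v = i + 1 \<and> j < snd v"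
    let ?Q = "\<lambda>e. e \<in> ray (i, j) \<or> e \<in> ray (i + 2, j) \<or> e = (i + 1, j)"
    have "even (card {e \<in> Z. ?Q e})"
    proof (rule changes[of _ ?H])
      fix x assume x: "x \<in> Y"
      have Z: "g x \<in> Z" using x by (simp add: Z_def)
      obtain a c u v where eq: "x = (a, c)" "g x = (u, v)" by fastforce
      have "a \<noteq> i" "a \<noteq> i + 2" "c \<noteq> j" "c \<noteq> j + 2"
        "(u = a + 1 \<and> v = c) \<or> (u = a - 1 \<and> v = c) \<or> (u = a \<and> v = c + 1) \<or> (u = a \<and> v = c - 1)"
        using lat[OF x, unfolded eq(1)] gn[OF x, unfolded eq(2), unfolded eq(1)] ij
        by (auto simp: nbrs_def sublattice_def)
      then have "(u = i \<and> j < v \<or> u = i + 2 \<and> j < v \<or> u = i + 1 \<and> v = j) \<longleftrightarrow>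
          (2 * u - a = i + 1 \<and> j < 2 * v - c) \<noteq> (a = i + 1 \<and> j < c)"
        by (elim disjE) auto
      then show "?Q (g x) \<longleftrightarrow> ?H (?f x) \<noteq> ?H x"
        using Z unfolding eq(2) unfolding eq(1) by (auto simp: ray_def opp_def)
    qed
    moreover have "{e \<in> Z. ?Q e} = (ray (i, j) \<union> ray (i + 2, j)) \<union> {e \<in> Z. e = (i + 1, j)}"
      by (auto simp: ray_def)
    moreover have "card ((ray (i, j) \<union> ray (i + 2, j)) \<union> {e \<in> Z. e = (i + 1, j)}) =
        card (ray (i, j)) + card (ray (i + 2, j)) + card {e \<in> Z. e = (i + 1, j)}"
      using fr fZ by (subst card_Un_disjoint; (subst card_Un_disjoint)?) (auto simp: ray_def)
    ultimately show ?thesis unfolding sing by (cases "(i + 1, j) \<in> Z") simp_all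
  qed
  have cross: "odd (card (ray (opp x e))) \<noteq> odd (card (ray x)) \<longleftrightarrow> e \<in> Z"
    if x: "x \<in> sublattice (\<not> s)" and e: "e \<in> nbrs x" for x e
  proof -
    obtain i j where ij: "x = (i, j)" by force
    have "(i - 2, j) \<in> sublattice (\<not> s)" "(i, j - 2) \<in> sublattice (\<not> s)"
      using x by (auto simp: sublattice_def ij)
    then show ?thesis
      using cross_up[of i j] cross_up[of i "j - 2"] cross_right[of i j] cross_right[of "i - 2" j] e x
      by (auto simp: nbrs_def opp_def ij algebra_simps)
  qed
  define W where "W = {x \<in> sublattice (\<not> s). odd (card (ray x))}"
  have W_below: "\<exists>e\<in>Z. fst e = fst x \<and> snd x < snd e" if "x \<in> W" for x
    using that by (auto simp: W_def ray_def intro!: ccontr[of "\<exists>_\<in>_. _"] dest!: odd_card_imp_not_empty)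
  have "W \<noteq> {}"
  proof -
    obtain x where x: "x \<in> Y" using Y(2) by blast
    then have e: "g x \<in> Z" by (simp add: Z_def)
    \<comment> \<open>A node of the other sublattice on one side of the edge \<open>g x\<close>;
      \<open>opp w (g x)\<close> lies on the other side, and crossing the edge changes the
      parity.\<close>
    define w where "w = (if fst (g x) = fst x then (fst x + 1, snd (g x)) else (fst (g x), snd x + 1))"
    have "w \<in> sublattice (\<not> s)" "g x \<in> nbrs w"
      using lat[OF x] gn[OF x] by (auto simp: w_def sublattice_def nbrs_def)
    then show ?thesis using cross[of w "g x"] e opp_sublattice[of w "\<not> s"] unfolding W_def by blast
  qed
  have Wcls: "W \<subseteq> cls b m (\<not> s)"
  proof
    fix w assume w: "w \<in> W"
    obtain e where e: "e \<in> Z" "fst e = fst w" "snd w < snd e" using W_below[OF w] by blast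
    then have er: "e \<in> region b m" using gr by (auto simp: Z_def)
    have "0 \<le> snd w"
    proof (rule ccontr)
      assume neg: "\<not> 0 \<le> snd w"
      \<comment> \<open>From below the region the ray meets every cycle edge in its column, and the
        cycles cross that vertical line an even number of times.\<close>
      have "even (card {e \<in> Z. e \<in> ray w})"
      proof (rule changes[of _ "\<lambda>v. fst v < fst w"])
        fix x assume x: "x \<in> Y"
        have Z: "g x \<in> Z" "0 \<le> snd (g x)" using x gr[OF x] by (auto simp: Z_def region_def)
        obtain a c u v where eq: "x = (a, c)" "g x = (u, v)" by fastforce
        have "fst w \<noteq> a" "fst w \<noteq> a + 2"
          "(u = a + 1 \<and> v = c) \<or> (u = a - 1 \<and> v = c) \<or> (u = a \<and> v = c + 1) \<or> (u = a \<and> v = c - 1)"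
          using lat[OF x, unfolded eq(1)] gn[OF x, unfolded eq(2), unfolded eq(1)] w
          by (auto simp: nbrs_def sublattice_def W_def)
        then have "u = fst w \<longleftrightarrow> (2 * u - a < fst w) \<noteq> (a < fst w)"
          by (elim disjE) auto
        then show "g x \<in> ray w \<longleftrightarrow> (fst (?f x) < fst w) \<noteq> (fst x < fst w)"
          using neg Z unfolding eq(2) unfolding eq(1) by (auto simp: ray_def opp_def)
      qed
      moreover have "{e \<in> Z. e \<in> ray w} = ray w" by (auto simp: ray_def)
      ultimately show False using w by (simp add: W_def)
    qed
    \<comment> \<open>The staircase gets wider downwards, so \<open>w\<close> inherits the width
      bound of the edge \<open>e\<close> above it.\<close>
    moreover have "snd w div 2 \<le> snd e div 2" using e(3) by (intro zdiv_mono1) auto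
    ultimately have "w \<in> region b m" using er e(2) by (cases w; cases e) (auto simp: region_def)
    then show "w \<in> cls b m (\<not> s)" using w by (simp add: cls_def W_def)
  qed
  have Wclosed: "?f w \<in> W" if w: "w \<in> W" for w
  proof -
    have wc: "w \<in> cls b m (\<not> s)" using w Wcls by blast
    then have D: "w \<in> cls b m False \<union> cls b m True" using cls_subset by blast
    have "g w \<notin> Z"
    proof
      assume "g w \<in> Z"
      then obtain x where x: "x \<in> Y" "g w = g x" by (auto simp: Z_def)
      then have "w = x" using inj D Ycls cls_subset[of b m s] by (auto simp: inj_on_def)
      then show False using x(1) Ycls wc cls_disjoint by blast
    qed
    moreover have "g w \<in> nbrs w" using g D by (auto simp: arcs_def PiE_iff)
    ultimately show ?thesis using cross[of w "g w"] w opp_sublattice by (auto simp: W_def)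
  qed
  have Wtop: "snd w < int t" if w: "w \<in> W" for w
  proof -
    obtain x where x: "x \<in> Y" "snd w < snd (g x)" using W_below[OF w] by (auto simp: Z_def)
    have "snd x \<le> int t" "snd (?f x) \<le> int t" using less.prems(4) x(1) yf[OF x(1)] Y(1) by blast+
    then show ?thesis using x(2) by (simp add: opp_def)
  qed
  obtain w where w: "w \<in> W" using \<open>W \<noteq> {}\<close> by blast
  \<comment> \<open>Heights are nonnegative, so \<open>t\<close> is positive and
    \<open>t - 1\<close> is a strictly smaller natural number, as the induction requires.\<close>
  have "0 \<le> snd w" using w Wcls by (auto simp: cls_def region_def)
  then have "t - 1 < t" using Wtop[OF w] by simp
  then show False
    by (rule less.IH[OF _ Wcls \<open>W \<noteq> {}\<close> Wclosed]) (use Wtop in fastforce)+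
qed

lemma dimers_rooted:
  assumes "g \<in> dimers b m"
  shows "rooted_on (cls b m s) (\<lambda>x. opp x (g x))"
proof (rule ccontr)
  assume "\<not> ?thesis"
  then obtain X where X: "X \<subseteq> cls b m s" "X \<noteq> {}" "\<And>x. x \<in> X \<Longrightarrow> opp x (g x) \<in> X"
    unfolding rooted_on_def by blast
  have "snd x \<le> int (2 * m)" if "x \<in> X" for x
    using that X(1) by (auto simp: cls_def region_def)
  then show False
    using dimer_no_cycle[of g b m X s "2 * m"] X assms by (auto simp: dimers_def bij_betw_def)
qed

section \<open>Extending a forest on one sublattice to a dimer configuration\<close>

lemma opp_image_edges:
  assumes p: "\<And>x. x \<in> A \<Longrightarrow> p x \<in> nbrs x" "\<And>x. x \<in> A \<Longrightarrow> p' x \<in> nbrs x" and A: "A \<subseteq> sublattice s"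
    and im: "p ` A \<subseteq> p' ` A" and v: "v \<in> A"
  shows "\<exists>w\<in>A. {v, opp v (p v)} = {w, opp w (p' w)}"
proof -
  obtain w where w: "w \<in> A" "p v = p' w" using im v by blast
  then have "w = v \<or> w = opp v (p v)"
    using nbrs_same_sublattice[of v s w "p v"] p(1)[OF v] p(2)[OF w(1)] v A by auto
  then show ?thesis
  proof
    assume "w = v"
    then show ?thesis using w by auto
  next
    assume "w = opp v (p v)"
    moreover from this have "opp w (p' w) = v" by (metis opp_opp w(2))
    ultimately show ?thesis using w by (intro bexI[of _ w]) auto
  qed
qed

text \<open>Midpoints show the edges but not which end is the child; by
  \<open>rooted_on_same_edges\<close> the orientation is forced by rootedness.\<close>

lemma rooted_opp_eq:
  assumes p: "\<And>x. x \<in> A \<Longrightarrow> p x \<in> nbrs x" "\<And>x. x \<in> A \<Longrightarrow> p' x \<in> nbrs x" and A: "A \<subseteq> sublattice s"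
    and im: "p ` A \<subseteq> p' ` A" and v: "v \<in> A"
    and "rooted_on A (\<lambda>x. opp x (p x))" "rooted_on A (\<lambda>x. opp x (p' x))"
  shows "p v = p' v"
proof -
  have "opp v (p v) = opp v (p' v)"
    by (rule rooted_on_same_edges[OF assms(6,7) opp_image_edges[OF p A im] v])
  then show ?thesis by simp
qed

text \<open>Two nodes with the same midpoint would be each other's parent.\<close>

lemma rooted_opp_inj:
  assumes p: "\<And>x. x \<in> A \<Longrightarrow> p x \<in> nbrs x" and A: "A \<subseteq> sublattice s"
    and r: "rooted_on A (\<lambda>x. opp x (p x))"
  shows "inj_on p A"
proof (rule inj_onI, rule ccontr)
  fix x y assume xy: "x \<in> A" "y \<in> A" "p x = p y" "x \<noteq> y"
  then have "y = opp x (p x)"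
    using nbrs_same_sublattice[of x s y "p x"] p[OF xy(1)] p[OF xy(2)] A by auto
  moreover from this have "opp y (p y) = x" by (metis opp_opp xy(3))
  ultimately show False using rooted_on_no_2cycle[OF r xy(1)] xy(2) by metis
qed

text \<open>The bounds of the region see \<open>snd x\<close> only through
  \<open>snd x div 2\<close>, so exchanging the rows \<open>2 * j\<close> and
  \<open>2 * j + 1\<close> is an involution of the region that swaps the two colours. This count
  plays the part of Euler's formula.\<close>

lemma card_mids: "card (mids b m) = card (cls b m False) + card (cls b m True)"
proof -
  let ?D = "cls b m False \<union> cls b m True"
  define f :: "int \<times> int \<Rightarrow> int \<times> int"
    where "f x = (fst x, if even (snd x) then snd x + 1 else snd x - 1)" for x
  have r: "f x \<in> region b m \<longleftrightarrow> x \<in> region b m" for x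
  proof -
    have "(if even (snd x) then snd x + 1 else snd x - 1) div 2 = snd x div 2"
      "0 \<le> (if even (snd x) then snd x + 1 else snd x - 1) \<longleftrightarrow> 0 \<le> snd x"
      by presburger+
    then show ?thesis by (simp add: f_def region_def)
  qed
  have D: "x \<in> ?D \<longleftrightarrow> x \<in> region b m \<and> even (fst x + snd x)" for x
    by (auto simp: cls_def sublattice_def)
  have ff: "f (f x) = x" for x by (simp add: f_def prod_eq_iff)
  have fp: "odd (fst (f x) + snd (f x)) \<longleftrightarrow> even (fst x + snd x)" for x by (simp add: f_def)
  have "bij_betw f ?D (mids b m)"
  proof (rule bij_betw_byWitness[of _ f])
    show "f ` ?D \<subseteq> mids b m"
      using r fp by (simp only: D mids_def image_subset_iff mem_Collect_eq Ball_def) simp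
    have "even (fst (f x) + snd (f x)) \<longleftrightarrow> odd (fst x + snd x)" for x using fp by blast
    then show "f ` mids b m \<subseteq> ?D"
      using r by (simp only: D mids_def image_subset_iff mem_Collect_eq Ball_def) simp
  qed (simp_all add: ff)
  then have "card (mids b m) = card ?D" by (simp add: bij_betw_same_card)
  also have "\<dots> = card (cls b m False) + card (cls b m True)"
    using cls_disjoint[of _ b m False] by (intro card_Un_disjoint) auto
  finally show ?thesis .
qed

lemma arc_mids: "x \<in> cls b m s \<Longrightarrow> e \<in> arcs b m x \<Longrightarrow> e \<in> mids b m"
  using nbrs_parity[of x s e] by (simp add: cls_def arcs_def mids_def)

text \<open>The node \<open>e\<close> takes one coordinate from \<open>x\<close> and the other from
  \<open>y\<close>. In both cases its width bound follows from that of the even one of these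
  nodes.\<close>

lemma crossing_in_region:
  assumes "x \<in> cls b m s" "e \<in> nbrs x" "y \<in> cls b m (\<not> s)" "e \<in> nbrs y"
  shows "e \<in> region b m"
proof -
  obtain i j where x: "x = (i, j)" by force
  obtain k l where y: "y = (k, l)" by force
  obtain u v where e: "e = (u, v)" by force
  have 1: "odd i = s" "odd j = s" "odd k \<noteq> s" "odd l \<noteq> s" "0 \<le> j" "0 \<le> l"
    "b \<longrightarrow> 1 \<le> i" "b \<longrightarrow> 1 \<le> k"
    "\<bar>i\<bar> \<le> 2 * int m - 1 - 2 * (j div 2)" "\<bar>k\<bar> \<le> 2 * int m - 1 - 2 * (l div 2)"
    using assms by (auto simp: x y cls_def sublattice_def region_def)
  have near: "u = i + 1 \<and> v = j \<or> u = i - 1 \<and> v = j \<or> u = i \<and> v = j + 1 \<or> u = i \<and> v = j - 1"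
    "u = k + 1 \<and> v = l \<or> u = k - 1 \<and> v = l \<or> u = k \<and> v = l + 1 \<or> u = k \<and> v = l - 1"
    using assms(2,4) by (auto simp: nbrs_def x y e)
  have "i \<noteq> k" "j \<noteq> l" using 1 by auto
  then have uv: "u = i \<and> v = l \<or> u = k \<and> v = j" using near by auto
  have "v = j \<or> v = l" "u = i \<or> u = k" using uv by auto
  then have "0 \<le> v" "b \<longrightarrow> 1 \<le> u" using 1 by auto
  moreover have "\<bar>u\<bar> \<le> 2 * int m - 1 - 2 * (v div 2)"
  proof -
    \<comment> \<open>An even \<open>y\<close> cannot attain the odd right-hand side, so a unit step
      keeps it within the bound; from an even \<open>z\<close> a unit step does not raise
      \<open>z div 2\<close>.\<close>
    have bound: "\<bar>x\<bar> \<le> 2 * int m - 1 - 2 * (z div 2)" "\<bar>y\<bar> \<le> 2 * int m - 1 - 2 * (w div 2)"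
      if "\<bar>y\<bar> \<le> 2 * int m - 1 - 2 * (z div 2)" "even y" "even z"
        "x = y + 1 \<or> x = y - 1" "w = z + 1 \<or> w = z - 1" for x y z w :: int
    proof -
      from that obtain y' z' where yz: "y = 2 * y'" "z = 2 * z'" by (auto elim!: evenE)
      have "\<bar>y'\<bar> \<le> int m - z' - 1" using that(1) by (simp add: yz abs_mult)
      then show "\<bar>x\<bar> \<le> 2 * int m - 1 - 2 * (z div 2)" using that(4) by (simp add: yz) linarith
      have "w div 2 \<le> z div 2" using that(5) by (auto simp: yz)
      then show "\<bar>y\<bar> \<le> 2 * int m - 1 - 2 * (w div 2)" using that(1) by linarith
    qed
    have ij: "i = k + 1 \<or> i = k - 1" "j = l + 1 \<or> j = l - 1" "k = i + 1 \<or> k = i - 1" "l = j + 1 \<or> l = j - 1"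
      using near \<open>i \<noteq> k\<close> \<open>j \<noteq> l\<close> by auto
    show ?thesis
    proof (cases s)
      case True
      then show ?thesis using bound[of k l i j] 1 ij uv by auto
    next
      case False
      then show ?thesis using bound[of i j k l] 1 ij uv by auto
    qed
  qed
  ultimately show ?thesis by (simp add: region_def e)
qed

text \<open>Every odd node has a downward arc and every even node a rightward arc, so a lowest or a
  rightmost node of \<open>X\<close>, respectively, has an arc leaving \<open>X\<close>.\<close>

lemma exists_boundary_edge:
  assumes X: "X \<subseteq> cls b m s" "X \<noteq> {}"
  shows "\<exists>x\<in>X. \<exists>e\<in>arcs b m x. opp x e \<notin> X"
proof -
  have fin: "finite X" by (rule finite_subset[OF X(1) finite_cls])
  show ?thesis
  proof (cases s)
    case True
    have "arg_min_on snd X \<in> X" by (rule arg_min_if_finite(1)[OF fin X(2)])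
    moreover define x where "x = arg_min_on snd X"
    moreover have "\<not> (\<exists>y\<in>X. snd y < snd x)"
      unfolding x_def by (rule arg_min_if_finite(2)[OF fin X(2)])
    ultimately have x: "x \<in> X" "opp x (fst x, snd x - 1) \<notin> X" by (auto simp: opp_def)
    have "odd (snd x)" "0 \<le> snd x" "x \<in> region b m"
      using x(1) X(1) True by (auto simp: cls_def sublattice_def region_def)
    then have "(fst x, snd x - 1) \<in> arcs b m x"
      unfolding arcs_def nbrs_def region_def by (auto elim!: oddE)
    then show ?thesis using x by blast
  next
    case False
    have "arg_min_on (\<lambda>x. - fst x) X \<in> X" by (rule arg_min_if_finite(1)[OF fin X(2)])
    moreover define x where "x = arg_min_on (\<lambda>x. - fst x) X"
    moreover have "\<not> (\<exists>y\<in>X. - fst y < - fst x)"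
      unfolding x_def by (rule arg_min_if_finite(2)[OF fin X(2)])
    ultimately have x: "x \<in> X" "opp x (fst x + 1, snd x) \<notin> X" by (auto simp: opp_def)
    have "even (fst x)" "x \<in> region b m"
      using x(1) X(1) False by (auto simp: cls_def sublattice_def)
    moreover have "\<bar>fst x + 1\<bar> \<le> 2 * int m - 1 - 2 * (snd x div 2)"
    proof -
      from \<open>even (fst x)\<close> obtain y where y: "fst x = 2 * y" by (rule evenE)
      have "\<bar>2 * y\<bar> \<le> 2 * int m - 1 - 2 * (snd x div 2)"
        using \<open>x \<in> region b m\<close> by (simp add: region_def y)
      then have "\<bar>y\<bar> \<le> int m - 1 - snd x div 2" by (simp add: abs_mult)
      then show ?thesis unfolding y by linarith
    qed
    ultimately have "(fst x + 1, snd x) \<in> arcs b m x"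
      unfolding arcs_def nbrs_def region_def by auto
    then show ?thesis using x by blast
  qed
qed

text \<open>Around a node of the other sublattice the boundary of \<open>X\<close> has an even number of edges.\<close>

lemma second_boundary_edge:
  assumes f: "f \<in> sublattice (\<not> s)" and X: "X \<subseteq> sublattice s"
    and e: "e \<in> nbrs f" "x \<in> X" "e \<in> nbrs x" "opp x e \<notin> X"
  shows "\<exists>e'\<in>nbrs f. \<exists>x'\<in>X. e' \<noteq> e \<and> e' \<in> nbrs x' \<and> opp x' e' \<notin> X"
proof (rule ccontr)
  assume no: "\<not> ?thesis"
  obtain i j where ij: "f = (i, j)" by force
  obtain k l where kl: "x = (k, l)" by force
  have par: "odd i \<noteq> s" "odd j \<noteq> s" "odd k = s" "odd l = s"
    using f X e(2) by (auto simp: ij kl sublattice_def)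
  let ?a = "(i + 1, j + 1) \<in> X" and ?b = "(i - 1, j + 1) \<in> X"
    and ?c = "(i - 1, j - 1) \<in> X" and ?d = "(i + 1, j - 1) \<in> X"
  have T: False if "(u, v) \<in> X" "(u', v') \<notin> X" "u + u' = 2 * p" "v + v' = 2 * q"
    "(p, q) \<in> nbrs (u, v)" "(p, q) \<in> nbrs f" "(p, q) \<noteq> e" for u v u' v' p q
  proof -
    have "opp (u, v) (p, q) = (u', v')" using that by (simp add: opp_def)
    then show False using no that by metis
  qed
  have "e = (i, j + 1) \<and> ?a \<noteq> ?b \<or> e = (i - 1, j) \<and> ?b \<noteq> ?c \<or> e = (i, j - 1) \<and> ?c \<noteq> ?d \<or> e = (i + 1, j) \<and> ?d \<noteq> ?a"
  proof -
    have "e = (i, j + 1) \<or> e = (i - 1, j) \<or> e = (i, j - 1) \<or> e = (i + 1, j)"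
      using e(1) by (auto simp: nbrs_def ij)
    then show ?thesis
      using e(2-4) par by (elim disjE) (auto simp: nbrs_def kl opp_def add.commute)
  qed
  moreover have t1: "?a = ?b" if "e \<noteq> (i, j + 1)"
    using T[of "i + 1" "j + 1" "i - 1" "j + 1" i "j + 1"] T[of "i - 1" "j + 1" "i + 1" "j + 1" i "j + 1"]
      that by (auto simp: nbrs_def ij)
  moreover have t2: "?b = ?c" if "e \<noteq> (i - 1, j)"
    using T[of "i - 1" "j + 1" "i - 1" "j - 1" "i - 1" j] T[of "i - 1" "j - 1" "i - 1" "j + 1" "i - 1" j]
      that by (auto simp: nbrs_def ij)
  moreover have t3: "?c = ?d" if "e \<noteq> (i, j - 1)"
    using T[of "i + 1" "j - 1" "i - 1" "j - 1" i "j - 1"] T[of "i - 1" "j - 1" "i + 1" "j - 1" i "j - 1"]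
      that by (auto simp: nbrs_def ij)
  moreover have t4: "?d = ?a" if "e \<noteq> (i + 1, j)"
    using T[of "i + 1" "j + 1" "i + 1" "j - 1" "i + 1" j] T[of "i + 1" "j - 1" "i + 1" "j + 1" "i + 1" j]
      that by (auto simp: nbrs_def ij)
  ultimately show False by (elim disjE conjE) simp_all
qed

text \<open>The boundary of a set of nodes would be a cycle of the other forest. If every boundary
  arc of \<open>X\<close> is taken by \<open>q\<close>, let \<open>Y\<close> be the nodes that take
  them: around each \<open>f\<close> in \<open>Y\<close> there is a second boundary edge, taken by
  another node, whose parent is then \<open>f\<close>. So \<open>Y\<close> is contained in its own
  image, against rootedness.\<close>

lemma free_boundary_edge:
  assumes q: "q \<in> forests b m s" and X: "X \<subseteq> cls b m (\<not> s)" "X \<noteq> {}"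
  shows "\<exists>x\<in>X. \<exists>e\<in>arcs b m x - q ` cls b m s. opp x e \<notin> X"
proof (rule ccontr)
  assume no: "\<not> ?thesis"
  let ?D = "\<lambda>e. \<exists>x\<in>X. e \<in> arcs b m x \<and> opp x e \<notin> X"
  define Y where "Y = {f \<in> cls b m s. ?D (q f)}"
  have qn: "q f \<in> nbrs f" if "f \<in> cls b m s" for f
    using that q by (auto simp: forests_def PiE_iff arcs_def)
  obtain x e where xe: "x \<in> X" "e \<in> arcs b m x" "opp x e \<notin> X"
    using exists_boundary_edge[OF X] by blast
  with no obtain f where "f \<in> cls b m s" "e = q f" by blast
  then have "f \<in> Y" unfolding Y_def using xe by blast
  moreover have "Y \<subseteq> (\<lambda>f. opp f (q f)) ` Y"
  proof
    fix f assume "f \<in> Y"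
    then obtain x where f: "f \<in> cls b m s" and x: "x \<in> X" "q f \<in> arcs b m x" "opp x (q f) \<notin> X"
      unfolding Y_def by blast
    obtain e' x' where e': "e' \<in> nbrs f" "e' \<noteq> q f" "x' \<in> X" "e' \<in> nbrs x'" "opp x' e' \<notin> X"
      using second_boundary_edge[of f "\<not> s" X "q f" x] f x X(1) qn[OF f]
      by (fastforce simp: cls_def arcs_def)
    have "e' \<in> region b m"
      using crossing_in_region[of x' b m "\<not> s" e' f] e' X(1) f by auto
    then have D: "e' \<in> arcs b m x'" using e' by (simp add: arcs_def)
    then obtain f' where f': "f' \<in> cls b m s" "e' = q f'" using no e' by blast
    have "f' = opp f e'"
      using nbrs_same_sublattice[of f s f' e'] f f' e' qn[OF f'(1)] by (auto simp: cls_def)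
    then have "f = opp f' (q f')" using f'(2) by (metis opp_opp)
    moreover have "f' \<in> Y" unfolding Y_def using f' D e' by blast
    ultimately show "f \<in> (\<lambda>f. opp f (q f)) ` Y" by blast
  qed
  moreover have "Y \<subseteq> cls b m s" by (auto simp: Y_def)
  ultimately show False
    using rooted_on_no_surj[of "cls b m s" "\<lambda>f. opp f (q f)" Y] q finite_subset[of Y "cls b m s"]
    by (auto simp: forests_def)
qed

text \<open>The bijection is restriction to one sublattice. It is injective because the other half
  uses exactly the edge nodes left over, and these determine its forest. For surjectivity, a forest
  on the other sublattice is grown through the free edge nodes. As \<open>s\<close> is arbitrary,
  primal and dual forests are equinumerous.\<close>

theorem card_dimers_eq_card_forests: "card (dimers b m) = card (forests b m s)"
proof -
  let ?A = "cls b m s" and ?A' = "cls b m (\<not> s)" and ?D = "cls b m False \<union> cls b m True"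
  have D: "?D = ?A \<union> ?A'" by (rule cls_union)
  have disj: "?A \<inter> ?A' = {}" using cls_disjoint by blast
  have lat: "cls b m t \<subseteq> sublattice t" for t by (auto simp: cls_def)
  have "bij_betw (\<lambda>g. restrict g ?A) (dimers b m) (forests b m s)"
    unfolding bij_betw_def
  proof (intro conjI inj_onI equalityI subsetI)
    fix g g' assume gg: "g \<in> dimers b m" "g' \<in> dimers b m" "restrict g ?A = restrict g' ?A"
    then have same: "\<And>x. x \<in> ?A \<Longrightarrow> g x = g' x" by (metis restrict_apply')
    have n: "\<And>x. x \<in> ?D \<Longrightarrow> g x \<in> nbrs x" "\<And>x. x \<in> ?D \<Longrightarrow> g' x \<in> nbrs x"
      using gg by (auto simp: dimers_def PiE_iff arcs_def)
    have im: "h ` ?A' = mids b m - h ` ?A" if "h \<in> dimers b m" for h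
    proof -
      have "bij_betw h (?A \<union> ?A') (mids b m)" using that D by (simp add: dimers_def)
      then show ?thesis using disj by (force simp: bij_betw_def inj_on_def)
    qed
    have "g ` ?A' \<subseteq> g' ` ?A'" using im[OF gg(1)] im[OF gg(2)] same by auto
    then have "g v = g' v" if "v \<in> ?A'" for v
      using rooted_opp_eq[of ?A' g g' "\<not> s" v] n D lat that dimers_rooted[OF gg(1)] dimers_rooted[OF gg(2)]
      by blast
    then have "g x = g' x" if "x \<in> ?D" for x using that same D by blast
    then show "g = g'"
      using gg(1,2) by (intro PiE_ext[of g ?D "arcs b m" g']) (simp_all add: dimers_def)
  next
    fix p assume "p \<in> (\<lambda>g. restrict g ?A) ` dimers b m"
    then obtain g where g: "g \<in> dimers b m" "p = restrict g ?A" by blast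
    have "rooted_on ?A (\<lambda>x. opp x (p x))"
      using dimers_rooted[OF g(1), of s] rooted_on_cong[of ?A "\<lambda>x. opp x (p x)" "\<lambda>x. opp x (g x)"] g(2)
      by simp
    then show "p \<in> forests b m s"
      using g D by (auto simp: forests_def dimers_def PiE_iff)
  next
    fix q assume q: "q \<in> forests b m s"
    let ?N = "\<lambda>x. arcs b m x - q ` ?A"
    obtain p where p: "p \<in> Pi\<^sub>E ?A' ?N" "rooted_on ?A' (\<lambda>x. opp x (p x))"
      using exists_rooted_on[of ?A' ?N opp] free_boundary_edge[OF q] by auto
    have qn: "q \<in> Pi\<^sub>E ?A (arcs b m)" "rooted_on ?A (\<lambda>x. opp x (q x))"
      using q by (auto simp: forests_def)
    have injq: "inj_on q ?A"
      using qn by (intro rooted_opp_inj[OF _ lat]) (auto simp: arcs_def PiE_iff)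
    have injp: "inj_on p ?A'"
      using p by (intro rooted_opp_inj[OF _ lat]) (auto simp: arcs_def PiE_iff)
    define g where "g x = (if x \<in> ?A then q x else p x)" for x
    have gA: "g ` ?A = q ` ?A" "g ` ?A' = p ` ?A'" using disj by (auto simp: g_def)
    have "g \<in> Pi\<^sub>E ?D (arcs b m)"
      unfolding D using qn p disj by (auto simp: g_def PiE_iff extensional_def)
    moreover have inj: "inj_on g ?D"
    proof -
      have "inj_on g ?A" using injq by (simp add: inj_on_def g_def)
      moreover have "g x = p x" if "x \<in> ?A'" for x using that disj by (auto simp: g_def)
      then have "inj_on g ?A'" using injp by (simp add: inj_on_def)
      moreover have "q ` ?A \<inter> p ` ?A' = {}" using p(1) by (auto simp: PiE_iff)
      then have "q ` (?A - ?A') \<inter> p ` (?A' - ?A) = {}" by blast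
      moreover have "g ` (?A - ?A') = q ` (?A - ?A')" "g ` (?A' - ?A) = p ` (?A' - ?A)"
        by (auto simp: g_def)
      ultimately show ?thesis unfolding D inj_on_Un by simp
    qed
    \<comment> \<open>Injectivity and \<open>card_mids\<close> leave no edge node unmatched.\<close>
    moreover have "g ` ?D = mids b m"
    proof (rule card_subset_eq[OF finite_mids])
      show "g ` ?D \<subseteq> mids b m"
        using \<open>g \<in> Pi\<^sub>E ?D (arcs b m)\<close> arc_mids by (fastforce simp: PiE_iff)
      have "card (g ` ?D) = card ?D" by (rule card_image[OF inj])
      also have "\<dots> = card (cls b m False) + card (cls b m True)"
        using cls_disjoint[of _ b m False] by (intro card_Un_disjoint) auto
      finally show "card (g ` ?D) = card (mids b m)" by (simp add: card_mids)
    qed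
    ultimately have "g \<in> dimers b m" by (simp add: dimers_def bij_betw_def)
    moreover have "restrict g ?A = q"
      using qn(1) by (auto simp: g_def fun_eq_iff PiE_iff extensional_def)
    ultimately show "q \<in> (\<lambda>g. restrict g ?A) ` dimers b m" by blast
  qed
  then show ?thesis by (rule bij_betw_same_card)
qed

section \<open>Perfect matchings\<close>

lemma grid_adjacent_iff_nbrs:
  "\<bar>fst p - fst q\<bar> + \<bar>snd p - snd q\<bar> = 1 \<longleftrightarrow> q \<in> nbrs p" for p q :: "int \<times> int"
  by (cases p; cases q) (auto simp: nbrs_def)

lemma ex1_image:
  assumes "inj g"
  shows "(\<exists>!y. y \<in> g ` N) \<longleftrightarrow> (\<exists>!x. x \<in> N)"
proof
  assume "\<exists>!y. y \<in> g ` N"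
  then obtain x where x: "x \<in> N" "\<And>y. y \<in> g ` N \<Longrightarrow> y = g x" by blast
  then show "\<exists>!x. x \<in> N" using injD[OF assms] by (intro ex1I[of _ x]) auto
qed auto

lemma perfect_matchings_map_graph:
  assumes f: "inj f"
  shows "perfect_matchings (map_graph f G) = image (image f) ` perfect_matchings G"
proof -
  have mem: "f v \<in> f ` e \<longleftrightarrow> v \<in> e" for v e using f by (auto simp: inj_def)
  have inj_img: "f ` e = f ` e' \<longleftrightarrow> e = e'" for e e' using f by (rule inj_image_eq_iff)
  have ex1: "(\<exists>!e. e \<in> image f ` M \<and> f v \<in> e) \<longleftrightarrow> (\<exists>!e. e \<in> M \<and> v \<in> e)" for M v
  proof -
    have "(\<exists>!e. e \<in> image f ` M \<and> f v \<in> e) \<longleftrightarrow> (\<exists>!e. e \<in> image f ` {e \<in> M. v \<in> e})"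
    proof (intro arg_cong[of _ _ Ex1] ext)
      fix e
      have "e \<in> image f ` M \<and> f v \<in> e \<longleftrightarrow> (\<exists>x\<in>M. e = f ` x \<and> f v \<in> f ` x)" by blast
      also have "\<dots> \<longleftrightarrow> (\<exists>x\<in>M. e = f ` x \<and> v \<in> x)" by (simp only: mem)
      also have "\<dots> \<longleftrightarrow> e \<in> image f ` {e \<in> M. v \<in> e}" by blast
      finally show "e \<in> image f ` M \<and> f v \<in> e \<longleftrightarrow> e \<in> image f ` {e \<in> M. v \<in> e}" .
    qed
    also have "\<dots> \<longleftrightarrow> (\<exists>!e. e \<in> {e \<in> M. v \<in> e})"
      by (rule ex1_image) (simp add: inj_def inj_img)
    finally show ?thesis by simp
  qed
  show ?thesis
  proof (intro equalityI subsetI)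
    fix M assume M: "M \<in> perfect_matchings (map_graph f G)"
    then have "M \<subseteq> image f ` edges G" by (simp add: perfect_matchings_def map_graph_def)
    then obtain M' where M': "M' \<subseteq> edges G" "M = image f ` M'" by (meson subset_imageE)
    then show "M \<in> image (image f) ` perfect_matchings G"
      using M ex1 by (auto simp: perfect_matchings_def map_graph_def)
  next
    fix M assume "M \<in> image (image f) ` perfect_matchings G"
    then obtain M' where M': "M' \<in> perfect_matchings G" "M = image f ` M'" by blast
    then have "\<forall>v\<in>verts G. \<exists>!e. e \<in> M \<and> f v \<in> e"
      by (simp only: ex1) (simp add: perfect_matchings_def)
    moreover have "M \<subseteq> image f ` edges G" using M' by (auto simp: perfect_matchings_def)
    ultimately show "M \<in> perfect_matchings (map_graph f G)"
      by (simp add: perfect_matchings_def map_graph_def)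
  qed
qed

lemma num_perfect_matchings_map_graph:
  assumes f: "inj f"
  shows "num_perfect_matchings (map_graph f G) = num_perfect_matchings G"
proof -
  have 1: "inj (image f)" by (rule injI) (simp add: inj_image_eq_iff[OF f])
  have "inj (image (image f))" by (rule injI) (simp add: inj_image_eq_iff[OF 1])
  then show ?thesis
    unfolding num_perfect_matchings_def perfect_matchings_map_graph[OF f]
    by (rule card_image[OF inj_on_subset[OF _ subset_UNIV]])
qed

lemma map_graph_grid_graph:
  assumes "\<And>p q. p \<in> S \<Longrightarrow> q \<in> S \<Longrightarrow>
    \<bar>fst (f p) - fst (f q)\<bar> + \<bar>snd (f p) - snd (f q)\<bar> = \<bar>fst p - fst q\<bar> + \<bar>snd p - snd q\<bar>"
  shows "map_graph f (grid_graph S) = grid_graph (f ` S)"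
proof -
  have "(\<lambda>e. f ` e) ` {{p, q} | p q. p \<in> S \<and> q \<in> S \<and> \<bar>fst p - fst q\<bar> + \<bar>snd p - snd q\<bar> = 1} =
    {{p, q} | p q. p \<in> f ` S \<and> q \<in> f ` S \<and> \<bar>fst p - fst q\<bar> + \<bar>snd p - snd q\<bar> = 1}"
    (is "?L = ?R")
  proof (intro equalityI subsetI)
    fix e assume "e \<in> ?L"
    then obtain p q where "e = f ` {p, q}" "p \<in> S" "q \<in> S" "\<bar>fst p - fst q\<bar> + \<bar>snd p - snd q\<bar> = 1"
      by blast
    then have "e = {f p, f q}" "f p \<in> f ` S" "f q \<in> f ` S"
      "\<bar>fst (f p) - fst (f q)\<bar> + \<bar>snd (f p) - snd (f q)\<bar> = 1" using assms by auto
    then show "e \<in> ?R" by blast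
  next
    fix e assume "e \<in> ?R"
    then obtain p q where pq: "e = {f p, f q}" "p \<in> S" "q \<in> S"
      "\<bar>fst (f p) - fst (f q)\<bar> + \<bar>snd (f p) - snd (f q)\<bar> = 1" by blast
    then have "\<bar>fst p - fst q\<bar> + \<bar>snd p - snd q\<bar> = 1" "e = f ` {p, q}" using assms by auto
    then show "e \<in> ?L" using pq(2,3) by blast
  qed
  then show ?thesis by (simp add: map_graph_def grid_graph_def)
qed

lemma C_eq: "C (2 * m) = grid_graph (region False m)"
proof -
  have "\<lfloor>real_of_int j / 2\<rfloor> = j div 2" for j
    using floor_divide_of_int_eq[of j 2, where ?'a = real] by simp
  then show ?thesis unfolding C_def
    by (intro arg_cong[of _ _ grid_graph]) (auto simp: region_def)
qed

lemma num_perfect_matchings_B: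
  "num_perfect_matchings (B m) = num_perfect_matchings (grid_graph (region True m))"
proof -
  \<comment> \<open>Turns the region upside down: the top row of \<open>B m\<close> becomes row 0,
    and column 0 moves to column 1, next to the vertical axis.\<close>
  define f :: "int \<times> int \<Rightarrow> int \<times> int" where "f p = (fst p + 1, 2 * int m - 1 - snd p)" for p
  let ?S = "{(i, j). 0 \<le> i \<and> i \<le> 2 * int m - 1 \<and> 2 * \<lceil>real_of_int i / 2\<rceil> \<le> j \<and> j \<le> 2 * int m - 1}"
  have ceil: "\<lceil>real_of_int i / 2\<rceil> = - (- i div 2)" for i
    using ceiling_divide_eq_div[of i 2, where ?'a = real] by simp
  have iff: "f (i, j) \<in> region True m \<longleftrightarrow> (i, j) \<in> ?S" for i j
  proof -
    obtain k where j: "j = 2 * k \<or> j = 2 * k + 1" by (metis evenE oddE)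
    obtain l where i: "i = 2 * l \<or> i = 2 * l + 1" by (metis evenE oddE)
    have "(2 * int m - 1 - j) div 2 = int m - 1 - k" using j by presburger
    moreover have "- (- i div 2) = (if i = 2 * l then l else l + 1)" using i by auto
    ultimately have "(0 \<le> 2 * int m - 1 - j \<and> 1 \<le> i + 1 \<and> \<bar>i + 1\<bar> \<le> 2 * int m - 1 - 2 * ((2 * int m - 1 - j) div 2)) \<longleftrightarrow>
      (0 \<le> i \<and> i \<le> 2 * int m - 1 \<and> 2 * - (- i div 2) \<le> j \<and> j \<le> 2 * int m - 1)"
      using i j by (auto, presburger)
    then show ?thesis by (simp add: ceil f_def region_def)
  qed
  have "f ` ?S = region True m"
  proof (intro equalityI subsetI)
    fix p assume p: "p \<in> region True m"
    have eq: "p = f (fst p - 1, 2 * int m - 1 - snd p)" by (simp add: f_def)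
    have "f (fst p - 1, 2 * int m - 1 - snd p) \<in> region True m" using p by (simp only: eq[symmetric])
    then show "p \<in> f ` ?S" unfolding iff by (rule image_eqI[where f = f, OF eq])
  qed (use iff in auto)
  then have "map_graph f (B m) = grid_graph (region True m)"
    unfolding B_def by (subst map_graph_grid_graph) (auto simp: f_def)
  moreover have "inj f" by (auto simp: inj_def f_def)
  ultimately show ?thesis using num_perfect_matchings_map_graph by metis
qed

text \<open>The nodes of even and of odd coordinate sum are the two colour classes of the grid, so a
  perfect matching amounts to a bijection from the first to the second along edges.\<close>

lemma num_perfect_matchings_region:
  "num_perfect_matchings (grid_graph (region b m)) = card (dimers b m)"
proof -
  let ?R = "region b m" and ?D = "cls b m False \<union> cls b m True" and ?G = "grid_graph (region b m)"
  let ?\<Phi> = "\<lambda>g. (\<lambda>x. {x, g x}) ` ?D"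
  have D: "x \<in> ?D \<longleftrightarrow> x \<in> ?R \<and> even (fst x + snd x)" for x
    by (auto simp: cls_def sublattice_def)
  have mids: "x \<in> mids b m \<longleftrightarrow> x \<in> ?R \<and> odd (fst x + snd x)" for x by (simp add: mids_def)
  have par: "odd (fst y + snd y) \<longleftrightarrow> even (fst x + snd x)" if "y \<in> nbrs x" for x y
    using that by (auto simp: nbrs_def)
  have E: "edges ?G = {{p, q} | p q. p \<in> ?R \<and> q \<in> ?R \<and> q \<in> nbrs p}"
    by (simp add: grid_graph_def grid_adjacent_iff_nbrs)
  have V: "verts ?G = ?R" by (simp add: grid_graph_def)
  have "bij_betw ?\<Phi> (dimers b m) (perfect_matchings ?G)"
    unfolding bij_betw_def
  proof (intro conjI inj_onI equalityI subsetI)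
    fix g g' assume g: "g \<in> dimers b m" "g' \<in> dimers b m" "?\<Phi> g = ?\<Phi> g'"
    have "g x = g' x" if x: "x \<in> ?D" for x
    proof -
      have "{x, g x} \<in> ?\<Phi> g'" using x unfolding g(3)[symmetric] by (rule imageI)
      then obtain y where y: "y \<in> ?D" "{x, g x} = {y, g' y}" by blast
      have "g' y \<in> mids b m" using g(2) y(1) by (auto simp: dimers_def bij_betw_def)
      then have "x \<noteq> g' y" using x by (auto simp: D mids simp del: Un_iff)
      then show ?thesis using y(2) by (auto simp: doubleton_eq_iff)
    qed
    then show "g = g'"
      using g(1,2) by (intro PiE_ext[of g ?D "arcs b m" g']) (simp_all add: dimers_def)
  next
    fix M assume "M \<in> ?\<Phi> ` dimers b m"
    then obtain g where g: "g \<in> dimers b m" and M: "M = ?\<Phi> g" by blast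
    have gn: "g x \<in> nbrs x" "g x \<in> ?R" if "x \<in> ?D" for x
      using g that by (auto simp: dimers_def PiE_iff arcs_def)
    have bij: "bij_betw g ?D (mids b m)" using g by (simp add: dimers_def)
    have "{x, g x} \<in> edges ?G" if "x \<in> ?D" for x
      using gn[OF that] D[of x] that unfolding E by blast
    then have "M \<subseteq> edges ?G" unfolding M by (rule image_subsetI)
    moreover have "\<exists>!e. e \<in> M \<and> v \<in> e" if v: "v \<in> ?R" for v
    proof -
      have ne: "x \<noteq> g y" if "x \<in> ?D" "y \<in> ?D" for x y
        using that bij_betwE[OF bij] by (metis D mids)
      obtain x where x: "x \<in> ?D" "v = x \<or> v = g x"
      proof (cases "v \<in> ?D")
        case False
        then have "v \<in> g ` ?D" using v bij D[of v] mids[of v] by (simp add: bij_betw_def)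
        then show thesis using that by blast
      qed (use that in blast)
      show ?thesis
      proof (rule ex1I[of _ "{x, g x}"])
        show "{x, g x} \<in> M \<and> v \<in> {x, g x}" unfolding M using x by blast
      next
        fix e assume e: "e \<in> M \<and> v \<in> e"
        then obtain y where y: "y \<in> ?D" "e = {y, g y}" unfolding M by blast
        have "y = x"
          using x y e ne[OF x(1) y(1)] ne[OF y(1) x(1)] bij by (auto simp: bij_betw_def inj_on_def)
        then show "e = {x, g x}" using y(2) by simp
      qed
    qed
    ultimately show "M \<in> perfect_matchings ?G" by (simp add: perfect_matchings_def V)
  next
    fix M assume M: "M \<in> perfect_matchings ?G"
    have ex: "\<exists>!e. e \<in> M \<and> v \<in> e" if "v \<in> ?R" for v using M that by (simp add: perfect_matchings_def V)
    have ME: "M \<subseteq> edges ?G" using M by (simp add: perfect_matchings_def)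
    have "\<exists>y. {x, y} \<in> M \<and> y \<in> nbrs x \<inter> ?R" if x: "x \<in> ?R" for x
    proof -
      obtain e where e: "e \<in> M" "x \<in> e" using ex[OF x] by blast
      then obtain p q where "e = {p, q}" "p \<in> ?R" "q \<in> ?R" "q \<in> nbrs p" using ME E by blast
      moreover from this have "p \<in> nbrs q" using nbrs_sym by blast
      ultimately have "x = p \<and> {x, q} \<in> M \<and> q \<in> nbrs x \<inter> ?R \<or> x = q \<and> {x, p} \<in> M \<and> p \<in> nbrs x \<inter> ?R"
        using e by (auto simp: insert_commute)
      then show ?thesis by blast
    qed
    then obtain mate where mate: "\<And>x. x \<in> ?R \<Longrightarrow> {x, mate x} \<in> M"
      "\<And>x. x \<in> ?R \<Longrightarrow> mate x \<in> nbrs x" "\<And>x. x \<in> ?R \<Longrightarrow> mate x \<in> ?R"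
      by (metis IntD1 IntD2)
    have mate_unique: "y = mate x" if "x \<in> ?R" "{x, y} \<in> M" for x y
    proof -
      have "{x, y} = {x, mate x}" using ex[OF that(1)] that(2) mate(1)[OF that(1)] by (metis insertI1)
      then show ?thesis by (auto simp: doubleton_eq_iff)
    qed
    have mm: "mate (mate x) = x" if "x \<in> ?R" for x
      using mate_unique[of "mate x" x] mate[OF that] by (simp add: insert_commute)
    have bij: "bij_betw mate ?D (mids b m)"
    proof (rule bij_betw_byWitness[of _ mate])
      show "mate ` ?D \<subseteq> mids b m"
        using mate par by (simp only: D mids image_subset_iff Ball_def) blast
      show "mate ` mids b m \<subseteq> ?D"
        using mate par by (simp only: D mids image_subset_iff Ball_def) blast
    qed (auto simp: mm D mids simp del: Un_iff)
    let ?g = "restrict mate ?D"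
    have "?g \<in> dimers b m"
      unfolding dimers_def using bij mate D bij_betw_cong[of ?D ?g mate "mids b m"]
      by (auto simp: arcs_def PiE_iff simp del: Un_iff)
    moreover have "?\<Phi> ?g = M"
    proof (intro equalityI subsetI)
      fix e assume "e \<in> ?\<Phi> ?g"
      then obtain x where "x \<in> ?D" "e = {x, mate x}" by auto
      then show "e \<in> M" using mate(1) D by blast
    next
      fix e assume e: "e \<in> M"
      then obtain p q where pq: "e = {p, q}" "p \<in> ?R" "q \<in> ?R" "q \<in> nbrs p" using ME E by blast
      have "q = mate p" using mate_unique[OF pq(2)] pq(1) e by simp
      then have 1: "e = {p, mate p}" using pq(1) by simp
      have "p = mate q" using mate_unique[OF pq(3)] pq(1) e by (simp add: insert_commute)
      then have 2: "e = {q, mate q}" using pq(1) by (simp add: insert_commute)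
      have "x \<in> ?D \<Longrightarrow> {x, ?g x} = {x, mate x}" for x by (simp only: restrict_apply')
      then have "p \<in> ?D \<Longrightarrow> e = {p, ?g p}" "q \<in> ?D \<Longrightarrow> e = {q, ?g q}"
        using 1 2 by metis+
      moreover have "p \<in> ?D \<or> q \<in> ?D" using par[OF pq(4)] pq(2,3) D by blast
      ultimately show "e \<in> ?\<Phi> ?g" by blast
    qed
    ultimately show "M \<in> ?\<Phi> ` dimers b m" by blast
  qed
  then show ?thesis unfolding num_perfect_matchings_def by (simp add: bij_betw_same_card)
qed

section \<open>Trees\<close>

lemma adj_sym: "(u, w) \<in> adj G \<longleftrightarrow> (w, u) \<in> adj G"
  by (auto simp: adj_def insert_commute)

lemma adj_mono: "edges H \<subseteq> edges G \<Longrightarrow> adj H \<subseteq> adj G"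
  by (auto simp: adj_def)

lemma sym_adj_restrict: "sym (adj G \<inter> S \<times> S)"
  by (auto simp: sym_def adj_def insert_commute)

lemma successively_nth: "successively P xs \<Longrightarrow> Suc i < length xs \<Longrightarrow> P (xs ! i) (xs ! Suc i)"
proof (induction P xs arbitrary: i rule: successively.induct)
  case (3 P x y xs)
  then show ?case by (cases i) auto
qed auto

lemma successively_rtrancl:
  "successively (\<lambda>x y. (x, y) \<in> R) xs \<Longrightarrow> xs \<noteq> [] \<Longrightarrow> (hd xs, last xs) \<in> R\<^sup>*"
proof (induction xs)
  case (Cons x xs)
  then show ?case by (cases xs) (auto intro: converse_rtrancl_into_rtrancl)
qed simp

lemma successively_leaves:
  "successively R xs \<Longrightarrow> xs \<noteq> [] \<Longrightarrow> P (hd xs) \<Longrightarrow> \<not> P (last xs) \<Longrightarrow>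
    \<exists>x\<in>set xs. \<exists>y\<in>set xs. R x y \<and> P x \<and> \<not> P y"
proof (induction xs)
  case (Cons x xs)
  then obtain y ys where xs: "xs = y # ys" by (cases xs) auto
  show ?case
  proof (cases "P y")
    case True
    then have "\<exists>x\<in>set xs. \<exists>y\<in>set xs. R x y \<and> P x \<and> \<not> P y"
      using Cons by (intro Cons.IH) (auto simp: xs)
    then show ?thesis by auto
  next
    case False
    then show ?thesis using Cons.prems by (auto simp: xs)
  qed
qed simp

lemma rtrancl_leaves:
  assumes "(u, w) \<in> R\<^sup>*" "u \<in> X" "w \<notin> X"
  obtains x y where "(x, y) \<in> R" "x \<in> X" "y \<notin> X"
  using assms by (induction rule: converse_rtrancl_induct) auto

lemma rtrancl_imp_distinct_path:
  assumes "(u, w) \<in> R\<^sup>*"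
  shows "\<exists>xs. xs \<noteq> [] \<and> hd xs = u \<and> last xs = w \<and> distinct xs \<and> successively (\<lambda>x y. (x, y) \<in> R) xs"
  using assms
proof (induction rule: converse_rtrancl_induct)
  case base
  show ?case by (rule exI[of _ "[w]"]) simp
next
  case (step y z)
  then obtain xs where xs: "xs \<noteq> []" "hd xs = z" "last xs = w" "distinct xs"
    "successively (\<lambda>x y. (x, y) \<in> R) xs" by blast
  show ?case
  proof (cases "y \<in> set xs")
    case True
    then obtain as bs where "xs = as @ y # bs" by (meson split_list)
    then show ?thesis
      using xs by (intro exI[of _ "y # bs"]) (auto simp: successively_append_iff)
  next
    case False
    then show ?thesis
      using xs step(1) by (intro exI[of _ "y # xs"]) (auto simp: successively_Cons)
  qed
qed

lemma is_cycleI: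
  assumes "distinct xs" "3 \<le> length xs" "successively (\<lambda>x y. (x, y) \<in> adj G) xs" "(last xs, hd xs) \<in> adj G"
  shows "is_cycle G xs"
  unfolding is_cycle_def
proof (intro conjI allI impI assms(1,2))
  fix i assume i: "i < length xs"
  show "(xs ! i, xs ! (Suc i mod length xs)) \<in> adj G"
  proof (cases "Suc i = length xs")
    case True
    moreover have "xs \<noteq> []" using i by auto
    moreover from this True have "xs ! i = last xs" by (simp add: last_conv_nth flip: True)
    ultimately show ?thesis using assms(4) by (simp add: hd_conv_nth)
  next
    case False
    then show ?thesis using successively_nth[OF assms(3), of i] i by simp
  qed
qed

text \<open>If the paths part after \<open>u\<close>, their remainders avoid \<open>u\<close> and
  end in the same vertex; hence the two successors of \<open>u\<close> are joined by a path avoiding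
  \<open>u\<close>, which closes up to a cycle through \<open>u\<close>.\<close>

lemma acyclic_unique_path:
  assumes "\<nexists>c. is_cycle G c"
    and "distinct xs" "successively (\<lambda>x y. (x, y) \<in> adj G) xs" "xs \<noteq> []"
    and "distinct ys" "successively (\<lambda>x y. (x, y) \<in> adj G) ys" "ys \<noteq> []"
    and "hd xs = hd ys" "last xs = last ys"
  shows "xs = ys"
  using assms(2-)
proof (induction xs arbitrary: ys)
  case (Cons u xs)
  obtain ys' where ys: "ys = u # ys'" using Cons.prems by (cases ys) auto
  show ?case
  proof (cases "xs = [] \<or> ys' = []")
    case True
    then show ?thesis using Cons.prems unfolding ys by (auto split: if_splits)
  next
    case False
    then have ne: "xs \<noteq> []" "ys' \<noteq> []" by auto
    have p: "(u, hd xs) \<in> adj G" "(u, hd ys') \<in> adj G" "last xs = last ys'" "u \<notin> set xs" "u \<notin> set ys'"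
      "distinct xs" "distinct ys'" "successively (\<lambda>x y. (x, y) \<in> adj G) xs"
      "successively (\<lambda>x y. (x, y) \<in> adj G) ys'"
      using Cons.prems ne unfolding ys by (auto simp: successively_Cons)
    have "hd xs = hd ys'"
    proof (rule ccontr)
      assume neq: "hd xs \<noteq> hd ys'"
      let ?R = "adj G \<inter> (- {u}) \<times> (- {u})"
      have R: "(hd zs, last zs) \<in> ?R\<^sup>*"
        if "zs \<noteq> []" "u \<notin> set zs" "successively (\<lambda>x y. (x, y) \<in> adj G) zs" for zs
        using that by (intro successively_rtrancl) (auto intro: successively_mono)
      have "(last ys', hd ys') \<in> ?R\<^sup>*"
        by (rule symD[OF sym_rtrancl[OF sym_adj_restrict] R[OF ne(2) p(5,9)]])
      then have "(hd xs, hd ys') \<in> ?R\<^sup>*"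
        using R[OF ne(1) p(4,8)] unfolding p(3) by (rule rtrancl_trans[rotated])
      then obtain zs where zs: "zs \<noteq> []" "hd zs = hd xs" "last zs = hd ys'" "distinct zs"
        "successively (\<lambda>x y. (x, y) \<in> ?R) zs" using rtrancl_imp_distinct_path by metis
      obtain z1 z2 zs' where z: "zs = z1 # z2 # zs'"
        using zs(1-3) neq by (cases zs; cases "tl zs") auto
      have "u \<notin> set zs"
      proof
        assume "u \<in> set zs"
        then obtain i where i: "i < length zs" "zs ! i = u" by (auto simp: in_set_conv_nth)
        show False
        proof (cases i)
          case 0
          then show False using i zs(2) ne(1) p(4) z by (metis hd_conv_nth hd_in_set zs(1))
        next
          case (Suc k)
          then show False using successively_nth[OF zs(5), of k] i by auto
        qed
      qed
      then have "is_cycle G (u # zs)"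
        using zs p(1,2) z by (intro is_cycleI)
          (auto simp: successively_Cons adj_sym intro: successively_mono split: if_splits)
      then show False using assms(1) by blast
    qed
    then have "xs = ys'"
      using Cons.IH[of ys'] ne p by simp
    then show ?thesis using ys by simp
  qed
qed simp

text \<open>A path of \<open>T'\<close> between the ends of an edge of \<open>T\<close> closes up
  with it to a cycle of \<open>T\<close>, unless the path is that edge itself.\<close>

lemma connected_subgraph_of_acyclic:
  assumes "\<nexists>c. is_cycle T c" "edges T' \<subseteq> edges T"
    and "\<And>e. e \<in> edges T \<Longrightarrow> \<exists>u w. e = {u, w} \<and> u \<noteq> w \<and> (u, w) \<in> (adj T')\<^sup>*"
  shows "edges T' = edges T"
proof (rule equalityI[OF assms(2)], rule subsetI)
  fix e assume e: "e \<in> edges T"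
  then obtain u w where uw: "e = {u, w}" "u \<noteq> w" "(u, w) \<in> (adj T')\<^sup>*" using assms(3) by blast
  then obtain xs where xs: "xs \<noteq> []" "hd xs = u" "last xs = w" "distinct xs"
    "successively (\<lambda>x y. (x, y) \<in> adj T') xs" using rtrancl_imp_distinct_path by metis
  have "\<not> 3 \<le> length xs"
  proof
    assume "3 \<le> length xs"
    moreover have "successively (\<lambda>x y. (x, y) \<in> adj T) xs"
      by (rule successively_mono[OF xs(5)]) (use adj_mono[OF assms(2)] in auto)
    moreover have "(last xs, hd xs) \<in> adj T" using xs uw e by (auto simp: adj_def insert_commute)
    ultimately show False using is_cycleI[OF xs(4)] assms(1) by blast
  qed
  then obtain y where "xs = [u, y]"
    using xs(1-3) uw(2) by (cases xs; cases "tl xs"; cases "tl (tl xs)") auto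
  then show "e \<in> edges T'" using xs(3,5) uw(1) by (auto simp: adj_def)
qed

text \<open>Connected, since the vertices not joined to \<open>r\<close> would form an invariant
  set. On a cycle every vertex would have a child, so the cycle would be contained in its own
  image.\<close>

lemma parent_function_tree:
  assumes r: "r \<in> V" and fin: "finite V" and f: "f ` (V - {r}) \<subseteq> V" "rooted_on (V - {r}) f"
  defines "T \<equiv> \<lparr>verts = V, edges = (\<lambda>v. {v, f v}) ` (V - {r})\<rparr>"
  shows "is_tree T"
proof -
  have step: "(v, f v) \<in> adj T" if "v \<in> V - {r}" for v
    using that rooted_on_neq[OF f(2), of v] by (auto simp: adj_def T_def)
  have to_root: "(v, r) \<in> (adj T)\<^sup>*" if v: "v \<in> V" for v
  proof (rule ccontr)
    assume nv: "(v, r) \<notin> (adj T)\<^sup>*"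
    let ?X = "{v \<in> V. (v, r) \<notin> (adj T)\<^sup>*}"
    have X: "?X \<subseteq> V - {r}" "?X \<noteq> {}" using v nv by auto
    obtain x where x: "x \<in> ?X" "f x \<notin> ?X" using rooted_onD[OF f(2) X] by blast
    then have "(f x, r) \<in> (adj T)\<^sup>*" using X(1) f(1) by blast
    then show False using x(1) step[of x] X(1) by (auto intro: converse_rtrancl_into_rtrancl)
  qed
  have "sym (adj T)" using sym_adj_restrict[of T UNIV] by simp
  then have from_root: "(r, v) \<in> (adj T)\<^sup>*" if "v \<in> V" for v
    using to_root[OF that] by (metis sym_rtrancl symD)
  have "graph_connected T"
    unfolding graph_connected_def using r to_root from_root
    by (auto simp: T_def intro: rtrancl_trans)
  moreover have "\<not> is_cycle T c" for c
  proof
    assume c: "is_cycle T c"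
    define X where "X = set c"
    have edge: "v = f u \<and> u \<in> V - {r} \<or> u = f v \<and> v \<in> V - {r}" if "(u, v) \<in> adj T" for u v
      using that by (auto simp: adj_def T_def doubleton_eq_iff)
    have X: "X \<subseteq> V" "X \<noteq> {}"
    proof -
      show "X \<noteq> {}" using c by (auto simp: is_cycle_def X_def)
      show "X \<subseteq> V"
      proof
        fix x assume "x \<in> X"
        then obtain i where i: "i < length c" "x = c ! i" by (auto simp: X_def in_set_conv_nth)
        then have "(x, c ! (Suc i mod length c)) \<in> adj T" using c by (simp add: is_cycle_def)
        then show "x \<in> V" using edge f(1) by blast
      qed
    qed
    \<comment> \<open>Of the two neighbours on the cycle at most one is the parent
      \<open>f x\<close>; the other one must have \<open>x\<close> as its parent.\<close>
    have child: "\<exists>y\<in>X - {r}. f y = x" if x: "x \<in> X" for x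
    proof -
      obtain i where i: "i < length c" "x = c ! i" using x by (auto simp: X_def in_set_conv_nth)
      let ?n = "length c"
      have n: "3 \<le> ?n" and d: "distinct c" using c by (auto simp: is_cycle_def)
      obtain k where k: "k < ?n" "Suc k mod ?n = i" "Suc i mod ?n \<noteq> k"
      proof (cases i)
        case 0
        moreover have "Suc (?n - 1) = ?n" "Suc 0 mod ?n = Suc 0" using n by auto
        ultimately show thesis using n by (intro that[of "?n - 1"]) simp_all
      next
        case (Suc i')
        then show thesis using n i(1) by (intro that[of i']) (auto simp: mod_Suc)
      qed
      have j: "Suc i mod ?n < ?n" by (rule mod_less_divisor) (use n in linarith)
      have adj: "(c ! k, x) \<in> adj T" "(x, c ! (Suc i mod ?n)) \<in> adj T"
        using c k i by (auto simp: is_cycle_def)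
      have "c ! k \<noteq> c ! (Suc i mod ?n)" using nth_eq_iff_index_eq[OF d k(1) j] k(3) by metis
      then consider "f (c ! k) = x" "c ! k \<in> V - {r}" | "f (c ! (Suc i mod ?n)) = x" "c ! (Suc i mod ?n) \<in> V - {r}"
        using edge[OF adj(1)] edge[OF adj(2)] by metis
      then show ?thesis
      proof cases
        case 1
        then show ?thesis using k(1) by (intro bexI[of _ "c ! k"]) (auto simp: X_def)
      next
        case 2
        then show ?thesis using j by (intro bexI[of _ "c ! (Suc i mod ?n)"]) (auto simp: X_def)
      qed
    qed
    have fX: "finite X" using X(1) fin finite_subset by auto
    \<comment> \<open>The root owns no edge, so a cycle through \<open>r\<close> would have too few
      children for its vertices.\<close>
    have "X \<subseteq> f ` (X - {r})" using child by blast
    then have "card X \<le> card (X - {r})" using fX by (meson finite_Diff surj_card_le)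
    then have "r \<notin> X" using fX X(2) by (metis card_Diff1_less linorder_not_le)
    then have "X \<subseteq> V - {r}" "X \<subseteq> f ` X" using X(1) child by auto
    then show False using rooted_on_no_surj[OF f(2)] fX X(2) by blast
  qed
  ultimately show ?thesis unfolding is_tree_def by blast
qed

section \<open>Invariant spanning trees of a graph with a reflection\<close>

text \<open>The fixed vertices of the reflection \<open>h\<close> form the induced path \<open>ax 0, \<dots>, ax K\<close>, and the remaining
  vertices fall into two halves \<open>U\<close> and \<open>h ` U\<close> without edges between them.\<close>

locale reflected_graph =
  fixes G :: "'a ugraph" and h :: "'a \<Rightarrow> 'a" and ax :: "nat \<Rightarrow> 'a" and K :: nat and U :: "'a set"
  assumes finite_U: "finite U"
    and verts_G: "verts G = ax ` {..K} \<union> U \<union> h ` U"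
    and invol: "h (h x) = x"
    and fixed: "i \<le> K \<Longrightarrow> h (ax i) = ax i"
    and ax_notin_U: "i \<le> K \<Longrightarrow> ax i \<notin> U"
    and halves_disjoint: "x \<in> U \<Longrightarrow> h x \<notin> U"
    and inj_ax: "inj_on ax {..K}"
    and edge_form: "e \<in> edges G \<Longrightarrow> \<exists>u w. e = {u, w} \<and> u \<noteq> w \<and> u \<in> verts G \<and> w \<in> verts G"
    and edge_h: "e \<in> edges G \<Longrightarrow> h ` e \<in> edges G"
    and edge_U: "u \<in> U \<Longrightarrow> {u, w} \<in> edges G \<Longrightarrow> w \<in> U \<union> ax ` {..K}"
    and ax_edge: "i < K \<Longrightarrow> {ax i, ax (Suc i)} \<in> edges G"
    and ax_edge_only: "i \<le> K \<Longrightarrow> j \<le> K \<Longrightarrow> {ax i, ax j} \<in> edges G \<Longrightarrow> i = Suc j \<or> j = Suc i"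
begin

definition nbhd :: "'a \<Rightarrow> 'a set" where
  "nbhd u = {w. {u, w} \<in> edges G}"

definition parents :: "('a \<Rightarrow> 'a) set" where
  "parents = {f \<in> Pi\<^sub>E U nbhd. rooted_on U f}"

definition half :: "('a \<Rightarrow> 'a) \<Rightarrow> 'a set set" where
  "half f = (\<lambda>u. {u, f u}) ` U"

definition axis :: "'a set set" where
  "axis = (\<lambda>i. {ax i, ax (Suc i)}) ` {..<K}"

definition tree :: "('a \<Rightarrow> 'a) \<Rightarrow> 'a ugraph" where
  "tree f = \<lparr>verts = verts G, edges = axis \<union> half f \<union> image h ` half f\<rparr>"

section \<open>The invariant tree of a parent function\<close>

lemma h_ax_neq: "x \<in> U \<Longrightarrow> i \<le> K \<Longrightarrow> h x \<noteq> ax i"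
  using fixed invol ax_notin_U by metis

lemma h_eq_iff: "h x = h y \<longleftrightarrow> x = y"
  using invol by metis

lemma axis_sub: "axis \<subseteq> edges G"
  using ax_edge by (auto simp: axis_def)

lemma parent_in: "f \<in> parents \<Longrightarrow> u \<in> U \<Longrightarrow> {u, f u} \<in> edges G"
  by (auto simp: parents_def PiE_iff nbhd_def)

lemma parent_range: "f \<in> parents \<Longrightarrow> u \<in> U \<Longrightarrow> f u \<in> U \<union> ax ` {..K}"
  using parent_in edge_U by blast

lemma half_sub: "f \<in> parents \<Longrightarrow> half f \<subseteq> edges G"
  using parent_in by (auto simp: half_def)

lemma tree_sub: "f \<in> parents \<Longrightarrow> edges (tree f) \<subseteq> edges G"
  using half_sub[of f] axis_sub edge_h by (auto simp: tree_def)

lemma h_image_axis: "image h ` axis = axis"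
proof -
  have "h ` {ax i, ax (Suc i)} = {ax i, ax (Suc i)}" if "i < K" for i
    using that fixed by simp
  then show ?thesis by (force simp: axis_def image_iff)
qed

lemma h_image_image: "image h ` (image h ` S) = S"
  by (simp add: image_image invol)

lemma verts_h: "h ` verts G = verts G"
proof -
  have "h ` ax ` {..K} = ax ` {..K}" using fixed by (force simp: image_iff)
  then show ?thesis by (simp add: verts_G image_Un image_image invol Un_ac)
qed

lemma map_graph_tree: "map_graph h (tree f) = tree f"
  unfolding map_graph_def tree_def
  by (simp add: verts_h image_Un h_image_axis h_image_image Un_ac)

lemma tree_is_tree:
  assumes f: "f \<in> parents"
  shows "is_tree (tree f)"
proof -
  \<comment> \<open>The whole tree as one parent function with root \<open>ax K\<close>:
    \<open>f\<close> on \<open>U\<close>, its mirror image on the other half, and the successor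
    along the axis.\<close>
  define F where "F x = (if x \<in> U then f x else if h x \<in> U then h (f (h x))
    else ax (Suc (inv_into {..K} ax x)))" for x
  have F_ax: "F (ax i) = ax (Suc i)" if "i \<le> K" for i
  proof -
    have "h (ax i) \<notin> U" "ax i \<notin> U" using that fixed ax_notin_U by auto
    then show ?thesis using that inj_ax by (simp add: F_def)
  qed
  have F_U: "F u = f u" and F_h: "F (h u) = h (f u)" if "u \<in> U" for u
    using that halves_disjoint by (auto simp: F_def invol)
  let ?A = "verts G - {ax K}"
  have A: "?A = ax ` {..<K} \<union> U \<union> h ` U"
  proof -
    have "ax ` {..K} - {ax K} = ax ` {..<K}"
      using inj_ax by (auto simp: inj_on_def nat_less_le)
    moreover have "ax K \<notin> U" "ax K \<notin> h ` U" using ax_notin_U h_ax_neq by fastforce+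
    ultimately show ?thesis unfolding verts_G by blast
  qed
  have edges_F: "(\<lambda>v. {v, F v}) ` ?A = edges (tree f)"
  proof -
    have "(\<lambda>v. {v, F v}) ` ax ` {..<K} = axis"
      using F_ax by (force simp: axis_def image_iff)
    moreover have "(\<lambda>v. {v, F v}) ` U = half f" using F_U by (auto simp: half_def)
    moreover have "(\<lambda>v. {v, F v}) ` h ` U = image h ` half f"
      unfolding half_def image_image by (rule image_cong[OF refl]) (simp add: F_h)
    ultimately show ?thesis unfolding A by (simp add: image_Un tree_def)
  qed
  have rooted: "rooted_on ?A F"
    unfolding rooted_on_def
  proof (intro allI impI)
    fix X assume X: "X \<subseteq> ?A" "X \<noteq> {}"
    have fr: "rooted_on U f" using f by (simp add: parents_def)
    show "\<exists>x\<in>X. F x \<notin> X"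
    proof (rule ccontr)
      assume "\<not> ?thesis"
      then have closed: "F x \<in> X" if "x \<in> X" for x using that by blast
      show False
      proof (cases "\<exists>i. i < K \<and> ax i \<in> X")
        case True
        let ?I = "{i. i < K \<and> ax i \<in> X}"
        have "finite ?I" "?I \<noteq> {}" using True by auto
        then have M: "Max ?I \<in> ?I" by (rule Max_in)
        then have "ax (Suc (Max ?I)) \<in> X" using closed[of "ax (Max ?I)"] F_ax[of "Max ?I"] by auto
        then have "Suc (Max ?I) \<noteq> K" using X(1) by auto
        then have "Suc (Max ?I) \<in> ?I" using M \<open>ax (Suc (Max ?I)) \<in> X\<close> by auto
        then show False using Max_ge[OF \<open>finite ?I\<close>] by fastforce
      next
        case False
        have range: "f u \<in> U" if u: "u \<in> U" "f u \<in> X \<or> h (f u) \<in> X" for u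
        proof (rule ccontr)
          assume "f u \<notin> U"
          then obtain i where i: "i \<le> K" "f u = ax i" using parent_range[OF f u(1)] by auto
          then have "ax i \<in> X" using u(2) fixed by auto
          then show False using False i(1) X(1) by (cases "i = K") auto
        qed
        show False
        proof (cases "X \<inter> U = {}")
          case False
          then obtain x where "x \<in> X \<inter> U" "f x \<notin> X \<inter> U" using rooted_onD[OF fr, of "X \<inter> U"] by blast
          then show False using closed[of x] F_U range by auto
        next
          case True
          let ?Y = "{u \<in> U. h u \<in> X}"
          have "?Y \<noteq> {}" using X True False unfolding A by blast
          then obtain x where x: "x \<in> U" "h x \<in> X" "f x \<notin> ?Y" using rooted_onD[OF fr, of ?Y] by blast
          have "h (f x) \<in> X" using closed[OF x(2)] F_h[OF x(1)] by simp
          then show False using x range[OF x(1)] by simp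
        qed
      qed
    qed
  qed
  have fin: "finite (verts G)" by (simp add: verts_G finite_U)
  have axV: "ax i \<in> verts G" if "i \<le> K" for i using that by (simp add: verts_G)
  have "F ` ?A \<subseteq> verts G"
  proof
    fix y assume "y \<in> F ` ?A"
    then obtain x where x: "x \<in> ?A" "y = F x" by blast
    have "{x, F x} \<in> edges G" using edges_F tree_sub[OF f] x(1) by blast
    then show "y \<in> verts G" using edge_form[of "{x, F x}"] x(2) by (auto simp: doubleton_eq_iff)
  qed
  from parent_function_tree[OF axV[OF order_refl] fin this rooted]
  show ?thesis unfolding edges_F by (simp add: tree_def)
qed

lemma tree_spanning: "f \<in> parents \<Longrightarrow> tree f \<in> spanning_trees G"
  using tree_is_tree tree_sub by (simp add: spanning_trees_def) (simp add: tree_def)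

text \<open>Recovers the upper half from the tree, which makes \<open>tree\<close>
  injective.\<close>

lemma half_edges_eq:
  assumes "f \<in> parents"
  shows "half f = {e \<in> edges (tree f). e \<inter> U \<noteq> {}}"
proof -
  have "e \<inter> U = {}" if "e \<in> axis" for e
    using that ax_notin_U by (auto simp: axis_def)
  moreover have "h ` e \<inter> U = {}" if e: "e \<in> half f" for e
  proof -
    obtain u where u: "u \<in> U" "e = {u, f u}" using e by (auto simp: half_def)
    have "h (f u) \<notin> U"
      using parent_range[OF assms u(1)] halves_disjoint fixed ax_notin_U by auto
    then show ?thesis using u halves_disjoint by auto
  qed
  moreover have "e \<inter> U \<noteq> {}" if "e \<in> half f" for e using that by (auto simp: half_def)
  ultimately show ?thesis unfolding tree_def by fastforce
qed

lemma parents_eqI: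
  assumes "f \<in> parents" "g \<in> parents" "half f = half g"
  shows "f = g"
proof (rule PiE_ext[of f U nbhd g])
  show "f \<in> Pi\<^sub>E U nbhd" "g \<in> Pi\<^sub>E U nbhd" using assms by (auto simp: parents_def)
  fix v assume v: "v \<in> U"
  show "f v = g v"
  proof (rule rooted_on_same_edges[OF _ _ _ v])
    fix v assume "v \<in> U"
    then have "{v, f v} \<in> half g" using assms(3) by (auto simp: half_def)
    then show "\<exists>w\<in>U. {v, f v} = {w, g w}" by (auto simp: half_def)
  qed (use assms in \<open>auto simp: parents_def\<close>)
qed

lemma inj_tree: "inj_on tree parents"
  by (rule inj_onI) (metis half_edges_eq parents_eqI)

text \<open>The tree path between two consecutive axis vertices is fixed by \<open>h\<close>, hence runs inside the axis.\<close>

lemma axis_in_tree: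
  assumes T: "T \<in> spanning_trees G" "map_graph h T = T"
  shows "axis \<subseteq> edges T"
proof
  fix e assume "e \<in> axis"
  then obtain i where i: "i < K" "e = {ax i, ax (Suc i)}" by (auto simp: axis_def)
  have V: "verts T = verts G" and E: "edges T \<subseteq> edges G" and tree: "is_tree T"
    using T(1) by (auto simp: spanning_trees_def)
  have acyc: "\<nexists>c. is_cycle T c" using tree by (simp add: is_tree_def)
  have "(ax i, ax (Suc i)) \<in> (adj T)\<^sup>*"
    using tree i V by (auto simp: is_tree_def graph_connected_def verts_G)
  then obtain xs where xs: "xs \<noteq> []" "hd xs = ax i" "last xs = ax (Suc i)" "distinct xs"
    "successively (\<lambda>x y. (x, y) \<in> adj T) xs" using rtrancl_imp_distinct_path by metis
  have Eh: "h ` e \<in> edges T" if "e \<in> edges T" for e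
  proof -
    have "edges T = image h ` edges T" using arg_cong[OF T(2), of edges] by (simp add: map_graph_def)
    then show ?thesis using that by blast
  qed
  have adj_h: "(h x, h y) \<in> adj T" if "(x, y) \<in> adj T" for x y
    using that Eh[of "{x, y}"] h_eq_iff by (auto simp: adj_def)
  have "map h xs = xs"
  proof (rule acyclic_unique_path[OF acyc])
    show "distinct (map h xs)" using xs(4) h_eq_iff by (simp add: distinct_map inj_on_def)
    show "successively (\<lambda>x y. (x, y) \<in> adj T) (map h xs)"
      unfolding successively_map by (rule successively_mono[OF xs(5)]) (rule adj_h)
    show "hd (map h xs) = hd xs" "last (map h xs) = last xs"
      using xs(1-3) i fixed by (simp_all add: hd_map last_map)
  qed (use xs in auto)
  then have hx: "h x = x" if "x \<in> set xs" for x using that by (metis map_idI map_eq_conv map_ident)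
  \<comment> \<open>The path must step out of the first \<open>i + 1\<close> axis vertices. As it
    stays on the axis, and axis edges join consecutive vertices only, that step is the edge from
    \<open>ax i\<close> to \<open>ax (Suc i)\<close>.\<close>
  obtain x y where xy: "x \<in> set xs" "y \<in> set xs" "(x, y) \<in> adj T" "x \<in> ax ` {..i}" "y \<notin> ax ` {..i}"
  proof -
    have "ax (Suc i) \<notin> ax ` {..i}" using inj_ax i(1) by (force simp: inj_on_def)
    then have "\<exists>x\<in>set xs. \<exists>y\<in>set xs. (x, y) \<in> adj T \<and> x \<in> ax ` {..i} \<and> y \<notin> ax ` {..i}"
      using successively_leaves[OF xs(5,1), of "\<lambda>x. x \<in> ax ` {..i}"] xs(2,3) by auto
    then show thesis using that by blast
  qed
  have exy: "{x, y} \<in> edges T" using xy(3) by (simp add: adj_def)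
  then have "y \<in> verts G" using E edge_form[of "{x, y}"] by (auto simp: doubleton_eq_iff)
  moreover have yU: "y \<notin> U" using hx[OF xy(2)] halves_disjoint by metis
  moreover have "y \<notin> h ` U"
    using hx[OF xy(2)] invol yU by (metis imageE)
  ultimately obtain l where l: "l \<le> K" "y = ax l" by (auto simp: verts_G)
  obtain k where k: "k \<le> i" "x = ax k" using xy(4) by auto
  have "i < l" using xy(5) l by (metis atMost_iff imageI not_le)
  moreover have "k = Suc l \<or> l = Suc k"
    using ax_edge_only[of k l] exy E k l i by auto
  ultimately have "k = i" "l = Suc i" using k(1) by auto
  then show "e \<in> edges T" using exy k l i by simp
qed

text \<open>Connectedness of \<open>T\<close> supplies an edge of \<open>T\<close> out of every
  nonempty subset of \<open>U\<close>, so some parent function uses edges of \<open>T\<close> only.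
  Its tree is a connected spanning subgraph of the acyclic \<open>T\<close>, hence all of
  it.\<close>

lemma invariant_tree_is_tree:
  assumes T: "T \<in> spanning_trees G" "map_graph h T = T"
  shows "T \<in> tree ` parents"
proof -
  have V: "verts T = verts G" and E: "edges T \<subseteq> edges G" and T_tree: "is_tree T"
    using T(1) by (auto simp: spanning_trees_def)
  have Eh: "h ` e \<in> edges T" if "e \<in> edges T" for e
  proof -
    have "edges T = image h ` edges T" using arg_cong[OF T(2), of edges] by (simp add: map_graph_def)
    then show ?thesis using that by blast
  qed
  let ?N = "\<lambda>u. {w. {u, w} \<in> edges T}"
  have "\<exists>f\<in>Pi\<^sub>E U ?N. rooted_on U (\<lambda>x. f x)"
  proof (rule exists_rooted_on[OF finite_U, of ?N "\<lambda>x e. e"])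
    fix X assume X: "X \<subseteq> U" "X \<noteq> {}"
    then obtain x where x: "x \<in> X" by blast
    have "(x, ax 0) \<in> (adj T)\<^sup>*"
      using T_tree V x X(1) by (auto simp: is_tree_def graph_connected_def verts_G)
    moreover have "ax 0 \<notin> X" using X(1) ax_notin_U[of 0] by auto
    ultimately obtain y z where "(y, z) \<in> adj T" "y \<in> X" "z \<notin> X"
      using rtrancl_leaves[OF _ x] by metis
    then show "\<exists>x\<in>X. \<exists>e\<in>?N x. e \<notin> X" by (auto simp: adj_def)
  qed
  then obtain f where f: "f \<in> Pi\<^sub>E U ?N" "rooted_on U f" by blast
  have fp: "f \<in> parents" using f E by (auto simp: parents_def nbhd_def PiE_iff)
  have "half f \<subseteq> edges T" using f(1) by (auto simp: half_def PiE_iff)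
  moreover from this have "image h ` half f \<subseteq> edges T" using Eh by blast
  ultimately have sub: "edges (tree f) \<subseteq> edges T" using axis_in_tree[OF T] by (simp add: tree_def)
  have conn: "graph_connected (tree f)" using tree_is_tree[OF fp] by (simp add: is_tree_def)
  have "edges (tree f) = edges T"
  proof (rule connected_subgraph_of_acyclic[OF _ sub])
    show "\<nexists>c. is_cycle T c" using T_tree by (simp add: is_tree_def)
    fix e assume "e \<in> edges T"
    then obtain u w where uw: "e = {u, w}" "u \<noteq> w" "u \<in> verts G" "w \<in> verts G"
      using E edge_form by blast
    then have "(u, w) \<in> (adj (tree f))\<^sup>*" using conn by (simp add: graph_connected_def tree_def)
    then show "\<exists>u w. e = {u, w} \<and> u \<noteq> w \<and> (u, w) \<in> (adj (tree f))\<^sup>*" using uw by blast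
  qed
  then have "tree f = T" using V by (simp add: tree_def)
  then show ?thesis using fp by blast
qed

theorem invariant_trees: "{T \<in> spanning_trees G. map_graph h T = T} = tree ` parents"
  using invariant_tree_is_tree tree_spanning map_graph_tree by auto

theorem card_invariant_trees: "card {T \<in> spanning_trees G. map_graph h T = T} = card parents"
  unfolding invariant_trees by (rule card_image[OF inj_tree])

text \<open>On parent functions \<open>v\<close> acts by conjugation: the image of
  \<open>tree f\<close> is the tree of the conjugate, and \<open>tree\<close> is injective.\<close>

lemma map_graph_tree_eq_iff:
  assumes f: "f \<in> parents" and v: "\<And>x. v (v x) = x" "v ` U = U" "v ` verts G = verts G"
    "image v ` axis = axis" "\<And>x. v (h x) = h (v x)" "\<And>e. e \<in> edges G \<Longrightarrow> v ` e \<in> edges G"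
  shows "map_graph v (tree f) = tree f \<longleftrightarrow> (\<forall>u\<in>U. f (v u) = v (f u))"
proof -
  define g where "g = restrict (\<lambda>u. v (f (v u))) U"
  have vU: "v u \<in> U" if "u \<in> U" for u using that v(2) by blast
  have vinj: "inj v" using v(1) by (metis injI)
  have gp: "g \<in> parents"
  proof -
    have "v ` {v u, f (v u)} \<in> edges G" if "u \<in> U" for u using v(6) parent_in[OF f vU[OF that]] by blast
    then have "g \<in> Pi\<^sub>E U nbhd" by (simp add: g_def nbhd_def v(1))
    moreover have "rooted_on (v ` U) g"
      using f vU by (intro rooted_on_image[of U f]) (auto simp: parents_def g_def v(1) intro: inj_on_subset[OF vinj])
    ultimately show ?thesis by (simp add: parents_def v(2))
  qed
  have "image v ` half f = half g"
  proof -
    have "image v ` half f = (\<lambda>u. {v u, v (f u)}) ` U" by (simp add: half_def image_image)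
    also have "\<dots> = (\<lambda>u. {v u, v (f u)}) ` v ` U" by (simp only: v(2))
    also have "\<dots> = half g" by (simp add: half_def g_def image_image v(1))
    finally show ?thesis .
  qed
  moreover have "image v ` image h ` S = image h ` image v ` S" for S
    by (simp add: image_image v(5))
  ultimately have "map_graph v (tree f) = tree g"
    by (simp add: map_graph_def tree_def v image_Un)
  then have "map_graph v (tree f) = tree f \<longleftrightarrow> g = f"
    using inj_tree f gp by (auto simp: inj_on_def)
  also have "\<dots> \<longleftrightarrow> (\<forall>u\<in>U. g u = f u)"
    using f gp by (auto simp: parents_def intro!: PiE_ext[of g U nbhd f])
  also have "\<dots> \<longleftrightarrow> (\<forall>u\<in>U. f (v u) = v (f u))"
  proof (intro ball_cong refl)
    fix u assume "u \<in> U"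
    then show "g u = f u \<longleftrightarrow> f (v u) = v (f u)" by (simp add: g_def) (metis v(1))
  qed
  finally show ?thesis .
qed

end

section \<open>The mixed Aztec diamond\<close>

text \<open>The odd nodes of the doubled lattice, and the row below them, as vertices of the drawing.\<close>

definition pt :: "int \<times> int \<Rightarrow> real \<times> real" where
  "pt x = (of_int (fst x) / 2, (of_int (snd x) + 1) / 2)"

text \<open>Row \<open>-1\<close> is the horizontal axis, whence the shift; the bound is twice
  \<open>n - 1/2\<close> for \<open>n = m + 1\<close>.\<close>

definition diamond :: "nat \<Rightarrow> (int \<times> int) set" where
  "diamond m = {x \<in> sublattice True. \<bar>fst x\<bar> + \<bar>snd x + 1\<bar> \<le> 2 * int m + 1}"

definition axis_node :: "nat \<Rightarrow> nat \<Rightarrow> int \<times> int" where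
  "axis_node m k = (2 * int k - 2 * int m - 1, - 1)"

definition mirror :: "int \<times> int \<Rightarrow> int \<times> int" where
  "mirror x = (- fst x, snd x)"

lemma pt_inject [simp]: "pt x = pt y \<longleftrightarrow> x = y"
  by (auto simp: pt_def prod_eq_iff)

definition unpt :: "real \<times> real \<Rightarrow> int \<times> int" where
  "unpt u = (\<lfloor>2 * fst u\<rfloor>, \<lfloor>2 * snd u\<rfloor> - 1)"

lemma unpt_pt [simp]: "unpt (pt x) = x"
proof -
  have "2 * fst (pt x) = of_int (fst x)" "2 * snd (pt x) = of_int (snd x + 1)" by (simp_all add: pt_def)
  then show ?thesis unfolding unpt_def by (simp only: floor_of_int) simp
qed

lemma hrefl_pt: "hrefl (pt x) = pt (fst x, - 2 - snd x)"
  by (simp add: hrefl_def pt_def field_simps)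

lemma vrefl_pt: "vrefl (pt x) = pt (mirror x)"
  by (simp add: vrefl_def pt_def mirror_def)

lemma verts_MD: "verts (MD (Suc m)) = pt ` diamond m"
proof (intro equalityI subsetI)
  fix p assume "p \<in> verts (MD (Suc m))"
  then obtain x y where p: "p = (x, y)" "x - 1 / 2 \<in> \<int>" "y \<in> \<int>" "\<bar>x\<bar> + \<bar>y\<bar> \<le> real (Suc m) - 1 / 2"
    by (auto simp: MD_def grid_graph_def)
  then obtain k l where kl: "x - 1 / 2 = of_int k" "y = of_int l" by (auto elim!: Ints_cases)
  then have x: "x = of_int (2 * k + 1) / 2" by simp
  have pe: "p = pt (2 * k + 1, 2 * l - 1)" by (simp add: p(1) x kl(2) pt_def)
  have "\<bar>2 * k + 1\<bar> + \<bar>2 * l - 1 + 1\<bar> \<le> 2 * int m + 1"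
  proof -
    have "real_of_int (\<bar>2 * k + 1\<bar> + \<bar>2 * l\<bar>) = 2 * (\<bar>x\<bar> + \<bar>y\<bar>)" by (simp add: x kl(2))
    also have "\<dots> \<le> 2 * real m + 1" using p(4) by simp
    finally have "real_of_int (\<bar>2 * k + 1\<bar> + \<bar>2 * l\<bar>) \<le> real_of_int (2 * int m + 1)" by simp
    then show ?thesis by simp
  qed
  then have "(2 * k + 1, 2 * l - 1) \<in> diamond m" by (simp add: diamond_def sublattice_def)
  then show "p \<in> pt ` diamond m" unfolding pe by (rule imageI)
next
  fix p assume "p \<in> pt ` diamond m"
  then obtain x where x: "x \<in> sublattice True" "\<bar>fst x\<bar> + \<bar>snd x + 1\<bar> \<le> 2 * int m + 1" "p = pt x"
    by (auto simp: diamond_def)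
  then obtain k l where kl: "fst x = 2 * k + 1" "snd x = 2 * l + 1" by (auto simp: sublattice_def elim!: oddE)
  have "real_of_int (\<bar>fst x\<bar> + \<bar>snd x + 1\<bar>) \<le> real_of_int (2 * int m + 1)" using x(2) by (simp only: of_int_le_iff)
  then have "\<bar>fst p\<bar> + \<bar>snd p\<bar> \<le> real (Suc m) - 1 / 2" by (simp add: x(3) pt_def)
  moreover have "fst p - 1 / 2 = of_int k" "snd p = of_int (l + 1)" by (simp_all add: x(3) pt_def kl add_divide_distrib)
  then have "fst p - 1 / 2 \<in> \<int>" "snd p \<in> \<int>" by (metis Ints_of_int)+
  ultimately show "p \<in> verts (MD (Suc m))" by (simp add: MD_def grid_graph_def case_prod_beta)
qed

lemma pt_dist: "\<bar>fst (pt x) - fst (pt y)\<bar> + \<bar>snd (pt x) - snd (pt y)\<bar> = 1 \<longleftrightarrow>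
    \<bar>fst x - fst y\<bar> + \<bar>snd x - snd y\<bar> = 2"
proof -
  have eq: "\<bar>fst (pt x) - fst (pt y)\<bar> + \<bar>snd (pt x) - snd (pt y)\<bar> =
      real_of_int (\<bar>fst x - fst y\<bar> + \<bar>snd x - snd y\<bar>) / 2"
    by (simp add: pt_def flip: diff_divide_distrib)
  have "real_of_int z / 2 = 1 \<longleftrightarrow> z = 2" for z by auto
  then show ?thesis unfolding eq .
qed

lemma sublattice_dist:
  assumes "x \<in> sublattice s" "y \<in> sublattice s"
  shows "\<bar>fst x - fst y\<bar> + \<bar>snd x - snd y\<bar> = 2 \<longleftrightarrow> (\<exists>d\<in>nbrs x. y = opp x d)"
proof
  assume 2: "\<bar>fst x - fst y\<bar> + \<bar>snd x - snd y\<bar> = 2"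
  have "even (fst y - fst x)" "even (snd y - snd x)" using assms by (auto simp: sublattice_def)
  then obtain u v where "fst y - fst x = 2 * u" "snd y - snd x = 2 * v" by (metis evenE)
  then have uv: "fst y = fst x + 2 * u" "snd y = snd x + 2 * v" by simp_all
  then have "\<bar>u\<bar> + \<bar>v\<bar> = 1" using 2 by simp
  then have "u = 1 \<and> v = 0 \<or> u = - 1 \<and> v = 0 \<or> u = 0 \<and> v = 1 \<or> u = 0 \<and> v = - 1" by linarith
  then have "(fst x + u, snd x + v) \<in> nbrs x" by (auto simp: nbrs_def)
  moreover have "y = opp x (fst x + u, snd x + v)" using uv by (simp add: opp_def prod_eq_iff)
  ultimately show "\<exists>d\<in>nbrs x. y = opp x d" by blast
qed (auto simp: nbrs_def opp_def)

lemma edges_MD: "e \<in> edges (MD (Suc m)) \<longleftrightarrow>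
    (\<exists>x\<in>diamond m. \<exists>y\<in>diamond m. e = {pt x, pt y} \<and> (\<exists>d\<in>nbrs x. y = opp x d))"
proof -
  have V: "{(x, y). x - 1/2 \<in> \<int> \<and> y \<in> \<int> \<and> \<bar>x\<bar> + \<bar>y\<bar> \<le> real (Suc m) - 1/2} = pt ` diamond m"
    using verts_MD[of m] by (simp add: MD_def grid_graph_def)
  have lat: "x \<in> sublattice True" if "x \<in> diamond m" for x using that by (simp add: diamond_def)
  have "e \<in> edges (MD (Suc m)) \<longleftrightarrow>
      (\<exists>x\<in>diamond m. \<exists>y\<in>diamond m. e = {pt x, pt y} \<and> \<bar>fst (pt x) - fst (pt y)\<bar> + \<bar>snd (pt x) - snd (pt y)\<bar> = 1)"
    unfolding MD_def grid_graph_def V ugraph.select_convs by blast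
  moreover have "\<bar>fst x - fst y\<bar> + \<bar>snd x - snd y\<bar> = 2 \<longleftrightarrow> (\<exists>d\<in>nbrs x. y = opp x d)"
    if "x \<in> diamond m" "y \<in> diamond m" for x y
    by (rule sublattice_dist[OF lat[OF that(1)] lat[OF that(2)]])
  ultimately show ?thesis unfolding pt_dist by (simp cong: bex_cong)
qed

lemma pt_edge_iff: "{pt x, pt y} \<in> edges (MD (Suc m)) \<longleftrightarrow> x \<in> diamond m \<and> y \<in> diamond m \<and> (\<exists>d\<in>nbrs x. y = opp x d)"
proof
  assume "{pt x, pt y} \<in> edges (MD (Suc m))"
  then obtain x' y' d where xy: "x' \<in> diamond m" "y' \<in> diamond m" "{pt x, pt y} = {pt x', pt y'}" "d \<in> nbrs x'" "y' = opp x' d"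
    unfolding edges_MD by blast
  have "x' = opp y' d" "d \<in> nbrs y'" using xy(4,5) nbrs_opp by auto
  moreover have "x = x' \<and> y = y' \<or> x = y' \<and> y = x'" using xy(3) by (auto simp: doubleton_eq_iff)
  ultimately show "x \<in> diamond m \<and> y \<in> diamond m \<and> (\<exists>d\<in>nbrs x. y = opp x d)" using xy by metis
next
  assume "x \<in> diamond m \<and> y \<in> diamond m \<and> (\<exists>d\<in>nbrs x. y = opp x d)"
  then show "{pt x, pt y} \<in> edges (MD (Suc m))" unfolding edges_MD by blast
qed

lemma upper_half: "cls False m True = {x \<in> diamond m. 0 \<le> snd x}"
proof -
  have "\<bar>fst x\<bar> \<le> 2 * int m - 1 - 2 * (snd x div 2) \<longleftrightarrow> \<bar>fst x\<bar> + \<bar>snd x + 1\<bar> \<le> 2 * int m + 1"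
    if "odd (snd x)" "0 \<le> snd x" for x :: "int \<times> int"
  proof -
    from that(1) obtain j where "snd x = 2 * j + 1" by (rule oddE)
    then show ?thesis using that(2) by auto
  qed
  then show ?thesis by (auto simp: cls_def diamond_def region_def sublattice_def)
qed

lemma axis_nodes: "axis_node m ` {..2 * m + 1} = {x \<in> diamond m. snd x = - 1}"
proof (intro equalityI subsetI)
  fix x assume "x \<in> {x \<in> diamond m. snd x = - 1}"
  then have x: "odd (fst x)" "\<bar>fst x\<bar> \<le> 2 * int m + 1" "snd x = - 1" by (auto simp: diamond_def sublattice_def)
  from x(1) obtain k where k: "fst x = 2 * k + 1" by (rule oddE)
  have "x = axis_node m (nat (k + int m + 1))" "nat (k + int m + 1) \<le> 2 * m + 1"
    using x k by (auto simp: axis_node_def prod_eq_iff)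
  then show "x \<in> axis_node m ` {..2 * m + 1}" by blast
qed (auto simp: axis_node_def diamond_def sublattice_def)

lemma diamond_split:
  "diamond m = axis_node m ` {..2 * m + 1} \<union> cls False m True \<union> (\<lambda>x. (fst x, - 2 - snd x)) ` cls False m True"
proof -
  have "x \<in> (\<lambda>x. (fst x, - 2 - snd x)) ` cls False m True" if "x \<in> diamond m" "snd x < - 1" for x
  proof (rule image_eqI)
    show "x = (\<lambda>x. (fst x, - 2 - snd x)) (fst x, - 2 - snd x)" by simp
    show "(fst x, - 2 - snd x) \<in> cls False m True"
      using that unfolding upper_half by (auto simp: diamond_def sublattice_def)
  qed
  moreover have "x \<in> diamond m" if "x \<in> (\<lambda>x. (fst x, - 2 - snd x)) ` cls False m True" for x
    using that unfolding upper_half by (auto simp: diamond_def sublattice_def)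
  moreover have "snd x < - 1 \<or> snd x = - 1 \<or> 0 \<le> snd x" for x :: "int \<times> int" by linarith
  ultimately show ?thesis unfolding axis_nodes upper_half by blast
qed

lemma MD_reflected: "reflected_graph (MD (Suc m)) hrefl (\<lambda>k. pt (axis_node m k)) (2 * m + 1) (pt ` cls False m True)"
proof
  have hh: "hrefl (hrefl x) = x" for x by (simp add: hrefl_def case_prod_beta)
  show "hrefl (hrefl x) = x" for x by (rule hh)
  show "finite (pt ` cls False m True)" by simp
  show "verts (MD (Suc m)) = (\<lambda>k. pt (axis_node m k)) ` {..2 * m + 1} \<union> pt ` cls False m True \<union> hrefl ` pt ` cls False m True"
    unfolding verts_MD image_image hrefl_pt by (subst diamond_split) (simp add: image_Un image_image)
  show "hrefl (pt (axis_node m i)) = pt (axis_node m i)" for i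
    by (simp add: hrefl_pt axis_node_def)
  show "pt (axis_node m i) \<notin> pt ` cls False m True" for i
    by (auto simp: axis_node_def cls_def region_def)
  show "hrefl u \<notin> pt ` cls False m True" if "u \<in> pt ` cls False m True" for u
    using that by (auto simp: hrefl_pt cls_def region_def)
  show "inj_on (\<lambda>k. pt (axis_node m k)) {..2 * m + 1}"
    by (auto simp: inj_on_def axis_node_def)
  show "\<exists>u w. e = {u, w} \<and> u \<noteq> w \<and> u \<in> verts (MD (Suc m)) \<and> w \<in> verts (MD (Suc m))"
    if "e \<in> edges (MD (Suc m))" for e
  proof -
    obtain x y d where xy: "x \<in> diamond m" "y \<in> diamond m" "e = {pt x, pt y}" "d \<in> nbrs x" "y = opp x d"
      using \<open>e \<in> edges (MD (Suc m))\<close> unfolding edges_MD by blast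
    have "pt x \<noteq> pt y" using opp_neq[OF xy(4)] xy(5) by (metis pt_inject)
    then show ?thesis using xy unfolding verts_MD by blast
  qed
  show "hrefl ` e \<in> edges (MD (Suc m))" if "e \<in> edges (MD (Suc m))" for e
  proof -
    obtain x y d where xy: "x \<in> diamond m" "y \<in> diamond m" "e = {pt x, pt y}" "d \<in> nbrs x" "y = opp x d"
      using \<open>e \<in> edges (MD (Suc m))\<close> unfolding edges_MD by blast
    let ?r = "\<lambda>x :: int \<times> int. (fst x, - 2 - snd x)"
    have "?r x \<in> diamond m" "?r y \<in> diamond m" using xy(1,2) by (auto simp: diamond_def sublattice_def)
    moreover have "?r d \<in> nbrs (?r x)" "?r y = opp (?r x) (?r d)"
      using xy(4,5) by (auto simp: nbrs_def opp_def)
    moreover have "hrefl ` e = {pt (?r x), pt (?r y)}" by (simp add: xy(3) hrefl_pt)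
    ultimately show ?thesis unfolding edges_MD by blast
  qed
  show "w \<in> pt ` cls False m True \<union> (\<lambda>k. pt (axis_node m k)) ` {..2 * m + 1}"
    if u: "u \<in> pt ` cls False m True" and e: "{u, w} \<in> edges (MD (Suc m))" for u w
  proof -
    obtain x where x: "x \<in> cls False m True" "u = pt x" using u by blast
    have "w \<in> verts (MD (Suc m))"
      using e unfolding edges_MD verts_MD by (auto simp: doubleton_eq_iff)
    then obtain y where y: "y \<in> diamond m" "w = pt y" unfolding verts_MD by blast
    then obtain d where d: "d \<in> nbrs x" "y = opp x d" using e x(2) pt_edge_iff by blast
    have "0 \<le> snd x" "odd (snd x)" using x(1) by (auto simp: cls_def region_def sublattice_def)
    then have "0 \<le> snd y \<or> snd y = - 1" using d by (auto simp: nbrs_def opp_def elim!: oddE)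
    then have "y \<in> cls False m True \<union> axis_node m ` {..2 * m + 1}"
      unfolding upper_half axis_nodes using y(1) by blast
    then show ?thesis using y(2) by blast
  qed
  show "{pt (axis_node m i), pt (axis_node m (Suc i))} \<in> edges (MD (Suc m))" if "i < 2 * m + 1" for i
  proof -
    have "axis_node m i \<in> diamond m" "axis_node m (Suc i) \<in> diamond m" using axis_nodes[of m] that by auto
    moreover have "(fst (axis_node m i) + 1, - 1) \<in> nbrs (axis_node m i)"
      "axis_node m (Suc i) = opp (axis_node m i) (fst (axis_node m i) + 1, - 1)"
      by (auto simp: axis_node_def nbrs_def opp_def)
    ultimately show ?thesis unfolding edges_MD by blast
  qed
  show "i = Suc j \<or> j = Suc i" if "{pt (axis_node m i), pt (axis_node m j)} \<in> edges (MD (Suc m))" for i j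
    using that unfolding pt_edge_iff by (auto simp: axis_node_def nbrs_def opp_def)
qed

section \<open>Parent functions of the diamond as forests on the odd nodes\<close>

text \<open>Identifies the arcs of the region at \<open>x\<close> with the edges of the diamond
  there. In the horizontal case the even coordinate of \<open>d\<close> and the odd coordinate of
  \<open>opp x d\<close> face the same odd bound; by parity, and since \<open>x\<close> satisfies
  it, the two conditions agree.\<close>

lemma arc_iff_diamond:
  assumes x: "x \<in> cls False m True" and d: "d \<in> nbrs x"
  shows "d \<in> arcs False m x \<longleftrightarrow> opp x d \<in> diamond m"
proof -
  have "odd (fst x)" "odd (snd x)" "0 \<le> snd x" using x by (auto simp: cls_def region_def sublattice_def)
  then obtain i j where ij: "x = (2 * i + 1, 2 * j + 1)" "0 \<le> j"
    by (cases x) (auto elim!: oddE)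
  have b: "\<bar>2 * i + 1\<bar> \<le> 2 * int m - 1 - 2 * j" using x by (simp add: ij cls_def region_def)
  have opp_lat: "opp x d \<in> sublattice True" using x opp_sublattice by (auto simp: cls_def)
  have "d = (2 * i + 2, 2 * j + 1) \<or> d = (2 * i, 2 * j + 1) \<or> d = (2 * i + 1, 2 * j + 2) \<or> d = (2 * i + 1, 2 * j)"
    using d by (auto simp: nbrs_def ij)
  then show ?thesis
  proof (elim disjE)
    assume e: "d = (2 * i + 2, 2 * j + 1)"
    have "d \<in> arcs False m x \<longleftrightarrow> \<bar>2 * i + 2\<bar> \<le> 2 * int m - 1 - 2 * j"
      using d ij(2) by (simp add: arcs_def region_def e)
    moreover have "opp x d \<in> diamond m \<longleftrightarrow> \<bar>2 * i + 3\<bar> \<le> 2 * int m - 1 - 2 * j"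
      using opp_lat ij(2) by (auto simp: diamond_def opp_def e ij(1))
    ultimately show ?thesis using b unfolding abs_le_iff by presburger
  next
    assume e: "d = (2 * i, 2 * j + 1)"
    have "d \<in> arcs False m x \<longleftrightarrow> \<bar>2 * i\<bar> \<le> 2 * int m - 1 - 2 * j"
      using d ij(2) by (simp add: arcs_def region_def e)
    moreover have "opp x d \<in> diamond m \<longleftrightarrow> \<bar>2 * i - 1\<bar> \<le> 2 * int m - 1 - 2 * j"
      using opp_lat ij(2) by (auto simp: diamond_def opp_def e ij(1))
    ultimately show ?thesis using b unfolding abs_le_iff by presburger
  next
    assume e: "d = (2 * i + 1, 2 * j + 2)"
    have "d \<in> arcs False m x \<longleftrightarrow> \<bar>2 * i + 1\<bar> \<le> 2 * int m - 3 - 2 * j"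
      using d ij(2) by (auto simp: arcs_def region_def e)
    moreover have "opp x d \<in> diamond m \<longleftrightarrow> \<bar>2 * i + 1\<bar> \<le> 2 * int m - 3 - 2 * j"
      using opp_lat ij(2) by (auto simp: diamond_def opp_def e ij(1))
    ultimately show ?thesis by blast
  next
    assume e: "d = (2 * i + 1, 2 * j)"
    have "d \<in> arcs False m x"
      using d ij(2) b by (simp add: arcs_def region_def e)
    moreover have "opp x d \<in> diamond m"
      using opp_lat ij(2) b by (auto simp: diamond_def opp_def e ij(1))
    ultimately show ?thesis by blast
  qed
qed

context
  fixes m :: nat
begin

interpretation R: reflected_graph "MD (Suc m)" hrefl "\<lambda>k. pt (axis_node m k)" "2 * m + 1" "pt ` cls False m True"
  by (rule MD_reflected)

definition parent_map :: "(int \<times> int \<Rightarrow> int \<times> int) \<Rightarrow> real \<times> real \<Rightarrow> real \<times> real" where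
  "parent_map p = restrict (\<lambda>u. pt (opp (unpt u) (p (unpt u)))) (pt ` cls False m True)"

lemma parent_map_pt: "x \<in> cls False m True \<Longrightarrow> parent_map p (pt x) = pt (opp x (p x))"
  by (simp add: parent_map_def)

lemma bij_parent_map: "bij_betw parent_map (forests False m True) R.parents"
  unfolding bij_betw_def
proof (intro conjI equalityI subsetI inj_onI)
  fix p p' assume p: "p \<in> forests False m True" "p' \<in> forests False m True" "parent_map p = parent_map p'"
  have "p x = p' x" if "x \<in> cls False m True" for x
    using fun_cong[OF p(3), of "pt x"] that by (simp add: parent_map_pt)
  then show "p = p'"
    using p(1,2) by (intro PiE_ext[of p "cls False m True" "arcs False m" p']) (simp_all add: forests_def)
next
  fix f assume "f \<in> parent_map ` forests False m True"
  then obtain p where p: "p \<in> forests False m True" "f = parent_map p" by blast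
  have pa: "p x \<in> arcs False m x" "p x \<in> nbrs x" if "x \<in> cls False m True" for x
    using p(1) that by (auto simp: forests_def PiE_iff arcs_def)
  have "f \<in> Pi\<^sub>E (pt ` cls False m True) R.nbhd"
  proof (rule PiE_I)
    fix u assume "u \<in> pt ` cls False m True"
    then obtain x where x: "x \<in> cls False m True" "u = pt x" by blast
    have "opp x (p x) \<in> diamond m" using arc_iff_diamond[OF x(1)] pa[OF x(1)] by blast
    moreover have "x \<in> diamond m" using x(1) unfolding upper_half by blast
    ultimately show "f u \<in> R.nbhd u"
      unfolding R.nbhd_def x(2) p(2) parent_map_pt[OF x(1)] mem_Collect_eq pt_edge_iff
      using pa[OF x(1)] by blast
  qed (simp add: p(2) parent_map_def)
  moreover have "rooted_on (pt ` cls False m True) f"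
    using p(1) unfolding p(2)
    by (intro rooted_on_image[of _ "\<lambda>x. opp x (p x)"]) (auto simp: forests_def inj_on_def parent_map_pt)
  ultimately show "f \<in> R.parents" by (simp add: R.parents_def)
next
  fix f assume f: "f \<in> R.parents"
  have "\<exists>d. d \<in> arcs False m x \<and> f (pt x) = pt (opp x d)" if x: "x \<in> cls False m True" for x
  proof -
    have e: "{pt x, f (pt x)} \<in> edges (MD (Suc m))" using R.parent_in[OF f] x by blast
    then have "f (pt x) \<in> verts (MD (Suc m))" unfolding edges_MD verts_MD by (auto simp: doubleton_eq_iff)
    then obtain y where y: "y \<in> diamond m" "f (pt x) = pt y" unfolding verts_MD by blast
    then obtain d where d: "d \<in> nbrs x" "y = opp x d" using e pt_edge_iff by auto
    then show ?thesis using y arc_iff_diamond[OF x d(1)] by blast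
  qed
  then obtain p0 where p0: "\<And>x. x \<in> cls False m True \<Longrightarrow> p0 x \<in> arcs False m x"
    "\<And>x. x \<in> cls False m True \<Longrightarrow> f (pt x) = pt (opp x (p0 x))" by metis
  define p where "p = restrict p0 (cls False m True)"
  have "rooted_on (unpt ` pt ` cls False m True) (\<lambda>x. opp x (p x))"
  proof (rule rooted_on_image[of _ f])
    show "rooted_on (pt ` cls False m True) f" using f by (simp add: R.parents_def)
    show "inj_on unpt (pt ` cls False m True \<union> f ` pt ` cls False m True)"
      by (rule inj_on_subset[of _ "range pt"]) (auto simp: p0(2) inj_on_def)
    fix u assume "u \<in> pt ` cls False m True"
    then show "opp (unpt u) (p (unpt u)) = unpt (f u)"
      using p0(2) by (auto simp: p_def)
  qed
  then have "rooted_on (cls False m True) (\<lambda>x. opp x (p x))" by (simp add: image_image)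
  then have "p \<in> forests False m True" using p0(1) by (simp add: forests_def p_def)
  moreover have "parent_map p = f"
  proof (rule PiE_ext[of _ "pt ` cls False m True" "\<lambda>_. UNIV"])
    show "parent_map p \<in> pt ` cls False m True \<rightarrow>\<^sub>E UNIV" by (simp add: parent_map_def)
    show "f \<in> pt ` cls False m True \<rightarrow>\<^sub>E UNIV" using f by (auto simp: R.parents_def PiE_iff)
    fix u assume "u \<in> pt ` cls False m True"
    then show "parent_map p u = f u" using p0(2) by (auto simp: parent_map_pt p_def)
  qed
  ultimately show "f \<in> parent_map ` forests False m True" by blast
qed

lemma map_graph_id: "map_graph id T = T"
  by (simp add: map_graph_def)

theorem num_h_invariant_trees:
  "num_inv_spanning_trees (sym_generated {hrefl}) (MD (Suc m)) = card (forests False m True)"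
  unfolding num_inv_spanning_trees_def sym_generated_h
  using R.card_invariant_trees bij_betw_same_card[OF bij_parent_map] by (simp add: map_graph_id)

section \<open>Trees invariant under both reflections\<close>

definition mirror_forests :: "(int \<times> int \<Rightarrow> int \<times> int) set" where
  "mirror_forests = {p \<in> forests False m True. \<forall>x\<in>cls False m True. p (mirror x) = mirror (p x)}"

lemma mirror_mirror [simp]: "mirror (mirror x) = x"
  by (simp add: mirror_def)

lemma mirror_cls: "mirror x \<in> cls False m True \<longleftrightarrow> x \<in> cls False m True"
  by (simp add: mirror_def cls_def region_def sublattice_def)

lemma mirror_opp: "mirror (opp x d) = opp (mirror x) (mirror d)"
  by (simp add: mirror_def opp_def)

lemma mirror_arcs: "mirror d \<in> arcs False m (mirror x) \<longleftrightarrow> d \<in> arcs False m x"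
  by (auto simp: mirror_def arcs_def nbrs_def region_def prod_eq_iff)

lemma mirror_diamond: "mirror x \<in> diamond m \<longleftrightarrow> x \<in> diamond m"
  by (simp add: mirror_def diamond_def sublattice_def)

theorem num_hv_invariant_trees:
  "num_inv_spanning_trees (sym_generated {hrefl, vrefl}) (MD (Suc m)) = card mirror_forests"
proof -
  let ?U = "pt ` cls False m True" and ?S = "{f \<in> R.parents. \<forall>u\<in>pt ` cls False m True. f (vrefl u) = vrefl (f u)}"
  have vv: "vrefl (vrefl x) = x" and vh: "vrefl (hrefl x) = hrefl (vrefl x)" for x
    by (simp_all add: vrefl_def hrefl_def case_prod_beta)
  have vpt: "vrefl ` pt ` A = pt ` A" if "\<And>x. mirror x \<in> A \<longleftrightarrow> x \<in> A" for A
  proof -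
    have "mirror ` A = A" using that by (metis (no_types, lifting) image_iff mirror_mirror subsetI subset_antisym)
    then have "pt ` mirror ` A = pt ` A" by simp
    then show ?thesis by (simp add: image_image vrefl_pt)
  qed
  have vax: "vrefl (pt (axis_node m i)) = pt (axis_node m (2 * m + 1 - i))" if "i \<le> 2 * m + 1" for i
    using that by (simp add: vrefl_pt mirror_def axis_node_def of_nat_diff)
  have axis_le: "image vrefl ` R.axis \<subseteq> R.axis"
  proof
    fix e assume "e \<in> image vrefl ` R.axis"
    then obtain i where i: "i < 2 * m + 1" "e = vrefl ` {pt (axis_node m i), pt (axis_node m (Suc i))}"
      unfolding R.axis_def by blast
    let ?k = "2 * m - i"
    have "2 * m + 1 - i = Suc ?k" "2 * m + 1 - Suc i = ?k" using i(1) by auto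
    then have "e = {pt (axis_node m ?k), pt (axis_node m (Suc ?k))}"
      using i vax[of i] vax[of "Suc i"] by (simp add: insert_commute)
    moreover have "?k \<in> {..<2 * m + 1}" by simp
    ultimately show "e \<in> R.axis" unfolding R.axis_def by blast
  qed
  have vvi: "image vrefl ` image vrefl ` E = E" for E by (simp add: image_image vv)
  have axis: "image vrefl ` R.axis = R.axis"
    using axis_le image_mono[OF axis_le, of "image vrefl"] unfolding vvi by (rule equalityI)
  have edge: "vrefl ` e \<in> edges (MD (Suc m))" if e: "e \<in> edges (MD (Suc m))" for e
  proof -
    obtain x y d where xy: "x \<in> diamond m" "y \<in> diamond m" "e = {pt x, pt y}" "d \<in> nbrs x" "y = opp x d"
      using e unfolding edges_MD by blast
    have "mirror d \<in> nbrs (mirror x)" using xy(4) by (auto simp: nbrs_def mirror_def)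
    moreover have "vrefl ` e = {pt (mirror x), pt (mirror y)}" by (simp add: xy(3) vrefl_pt)
    ultimately show ?thesis unfolding edges_MD using xy mirror_opp mirror_diamond by metis
  qed
  have iff: "map_graph vrefl (R.tree f) = R.tree f \<longleftrightarrow> (\<forall>u\<in>?U. f (vrefl u) = vrefl (f u))"
    if "f \<in> R.parents" for f
    by (rule R.map_graph_tree_eq_iff[OF that vv vpt[OF mirror_cls] _ axis vh edge])
      (simp_all add: verts_MD vpt mirror_diamond)
  have comp: "map_graph (hrefl \<circ> vrefl) T = map_graph hrefl (map_graph vrefl T)" for T
    by (simp add: map_graph_def image_comp comp_def image_image)
  have "{T \<in> spanning_trees (MD (Suc m)). \<forall>g\<in>{id, hrefl, vrefl, hrefl \<circ> vrefl}. map_graph g T = T} =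
    {T \<in> {T \<in> spanning_trees (MD (Suc m)). map_graph hrefl T = T}. map_graph vrefl T = T}"
    by (auto simp: map_graph_id comp)
  also have "\<dots> = R.tree ` ?S" unfolding R.invariant_trees using iff by auto
  finally have "num_inv_spanning_trees (sym_generated {hrefl, vrefl}) (MD (Suc m)) = card (R.tree ` ?S)"
    by (simp only: num_inv_spanning_trees_def sym_generated_hv)
  also have "\<dots> = card ?S"
    by (intro card_image inj_on_subset[OF R.inj_tree]) auto
  also have "?S = parent_map ` mirror_forests"
  proof -
    have 1: "(\<forall>x\<in>cls False m True. p (mirror x) = mirror (p x)) \<longleftrightarrow>
        (\<forall>u\<in>?U. parent_map p (vrefl u) = vrefl (parent_map p u))" for p
      by (simp add: vrefl_pt parent_map_pt mirror_cls mirror_opp)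
    show ?thesis
      unfolding mirror_forests_def 1 bij_betw_imp_surj_on[OF bij_parent_map, symmetric] by blast
  qed
  also have "card \<dots> = card mirror_forests"
    by (intro card_image inj_on_subset[OF bij_betw_imp_inj_on[OF bij_parent_map]])
      (auto simp: mirror_forests_def)
  finally show ?thesis .
qed

text \<open>An arc crossing the vertical axis would form a 2-cycle with its mirror image.\<close>

theorem card_mirror_forests: "card mirror_forests = card (forests True m True)"
proof -
  let ?A = "cls False m True" and ?P = "cls True m True"
  have P: "x \<in> ?P \<longleftrightarrow> x \<in> ?A \<and> 1 \<le> fst x" for x by (auto simp: cls_def region_def)
  have arcsP: "d \<in> arcs True m x \<longleftrightarrow> d \<in> arcs False m x \<and> 1 \<le> fst d" for d x
    by (auto simp: arcs_def region_def)
  have A_cases: "x \<in> ?P \<or> mirror x \<in> ?P" if "x \<in> ?A" for x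
  proof -
    have "odd (fst x)" using that by (simp add: cls_def sublattice_def)
    then have "fst x \<noteq> 0" by auto
    then show ?thesis using that mirror_cls P by (auto simp: mirror_def)
  qed
  have excl: "mirror x \<notin> ?P" if "x \<in> ?P" for x using that by (auto simp: P mirror_def)
  have "bij_betw (\<lambda>p. restrict p ?P) mirror_forests (forests True m True)"
    unfolding bij_betw_def
  proof (intro conjI equalityI subsetI inj_onI)
    fix p p' assume p: "p \<in> mirror_forests" "p' \<in> mirror_forests" "restrict p ?P = restrict p' ?P"
    have eqP: "p x = p' x" if "x \<in> ?P" for x using p(3) that by (metis restrict_apply')
    have "p x = p' x" if x: "x \<in> ?A" for x
    proof (cases "x \<in> ?P")
      case False
      then have "p (mirror x) = p' (mirror x)" using A_cases[OF x] eqP by blast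
      then have "mirror (p x) = mirror (p' x)" using p(1,2) x by (simp add: mirror_forests_def)
      then show ?thesis by (metis mirror_mirror)
    qed (rule eqP)
    then show "p = p'"
      using p(1,2) by (intro PiE_ext[of p ?A "arcs False m" p']) (simp_all add: mirror_forests_def forests_def)
  next
    fix q assume "q \<in> (\<lambda>p. restrict p ?P) ` mirror_forests"
    then obtain p where p: "p \<in> mirror_forests" "q = restrict p ?P" by blast
    have pA: "p \<in> Pi\<^sub>E ?A (arcs False m)" and r: "rooted_on ?A (\<lambda>x. opp x (p x))"
      and sym: "\<And>x. x \<in> ?A \<Longrightarrow> p (mirror x) = mirror (p x)"
      using p(1) by (auto simp: mirror_forests_def forests_def)
    have "p x \<in> arcs True m x" if x: "x \<in> ?P" for x
    proof (rule ccontr)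
      assume "p x \<notin> arcs True m x"
      have xA: "x \<in> ?A" "1 \<le> fst x" using x by (auto simp: P)
      then have pa: "p x \<in> arcs False m x" using pA by blast
      then have "fst (p x) < 1" using \<open>p x \<notin> arcs True m x\<close> arcsP by auto
      then have "p x = (0, snd x)" "fst x = 1" using pa xA(2) by (auto simp: arcs_def nbrs_def)
      then have "opp x (p x) = mirror x" "opp (mirror x) (mirror (p x)) = x"
        by (auto simp: opp_def mirror_def prod_eq_iff)
      then show False using rooted_on_no_2cycle[OF r xA(1)] sym[OF xA(1)] mirror_cls xA(1) by simp
    qed
    moreover have "rooted_on ?P (\<lambda>x. opp x (q x))"
      unfolding rooted_on_def
    proof (intro allI impI)
      fix X assume X: "X \<subseteq> ?P" "X \<noteq> {}"
      then obtain x where "x \<in> X" "opp x (p x) \<notin> X" using rooted_onD[OF r, of X] P by blast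
      then show "\<exists>x\<in>X. opp x (q x) \<notin> X" using X(1) p(2) by (metis restrict_apply' subsetD)
    qed
    ultimately show "q \<in> forests True m True" by (simp add: forests_def p(2))
  next
    fix q assume q: "q \<in> forests True m True"
    have qa: "q x \<in> arcs True m x" if "x \<in> ?P" for x using q that by (auto simp: forests_def PiE_iff)
    have qr: "rooted_on ?P (\<lambda>x. opp x (q x))" using q by (simp add: forests_def)
    \<comment> \<open>By parity, an arc whose edge node is right of the vertical axis never ends
      left of it, so the two halves do not interact.\<close>
    have pos: "opp x (q x) \<in> ?P" if x: "x \<in> ?P" and A: "opp x (q x) \<in> ?A" for x
    proof -
      have "odd (fst x)" "1 \<le> fst x" using x by (auto simp: cls_def region_def sublattice_def)
      moreover have "1 \<le> fst (q x)" "q x \<in> nbrs x" using qa[OF x] by (auto simp: arcs_def region_def)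
      ultimately have "1 \<le> fst (opp x (q x))" by (auto simp: nbrs_def opp_def elim!: oddE, presburger)
      then show ?thesis using A P by blast
    qed
    define p where "p = restrict (\<lambda>x. if x \<in> ?P then q x else mirror (q (mirror x))) ?A"
    have pP: "p x = q x" if "x \<in> ?P" for x using that P by (simp add: p_def)
    have pM: "p x = mirror (q (mirror x))" if "mirror x \<in> ?P" for x
      using that excl[OF that] P mirror_cls by (simp add: p_def)
    have "p \<in> Pi\<^sub>E ?A (arcs False m)"
    proof (rule PiE_I)
      fix x assume "x \<in> ?A"
      then consider "x \<in> ?P" | "mirror x \<in> ?P" using A_cases by blast
      then show "p x \<in> arcs False m x"
      proof cases
        case 1
        then show ?thesis using qa arcsP pP by simp
      next
        case 2
        then have "q (mirror x) \<in> arcs False m (mirror x)" using qa arcsP by blast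
        then show ?thesis using mirror_arcs[of "q (mirror x)" "mirror x"] pM[OF 2] by simp
      qed
    qed (simp add: p_def)
    moreover have "p (mirror x) = mirror (p x)" if "x \<in> ?A" for x
      using A_cases[OF that] pP pM by (metis mirror_mirror)
    moreover have "rooted_on ?A (\<lambda>x. opp x (p x))"
      unfolding rooted_on_def
    proof (intro allI impI)
      fix X assume X: "X \<subseteq> ?A" "X \<noteq> {}"
      show "\<exists>x\<in>X. opp x (p x) \<notin> X"
      proof (cases "X \<inter> ?P = {}")
        case False
        then obtain x where "x \<in> X \<inter> ?P" "opp x (q x) \<notin> X \<inter> ?P"
          using rooted_onD[OF qr, of "X \<inter> ?P"] by blast
        then show ?thesis using pos[of x] X(1) pP by (intro bexI[of _ x]) auto
      next
        case True
        let ?Y = "{x \<in> ?P. mirror x \<in> X}"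
        have "?Y \<noteq> {}"
        proof -
          obtain x where "x \<in> X" using X(2) by blast
          then have "mirror x \<in> ?Y" using True A_cases[of x] X(1) by auto
          then show ?thesis by blast
        qed
        then obtain x where x: "x \<in> ?P" "mirror x \<in> X" "opp x (q x) \<notin> ?Y"
          using rooted_onD[OF qr, of ?Y] by blast
        have "opp (mirror x) (p (mirror x)) = mirror (opp x (q x))"
          using pM[of "mirror x"] x(1) by (simp add: mirror_opp)
        moreover have "mirror (opp x (q x)) \<notin> X"
        proof
          assume a: "mirror (opp x (q x)) \<in> X"
          then have "opp x (q x) \<in> ?A" using X(1) mirror_cls by blast
          then show False using pos[OF x(1)] a x(3) by simp
        qed
        ultimately show ?thesis using x(2) by (intro bexI[of _ "mirror x"]) simp_all
      qed
    qed
    ultimately have "p \<in> mirror_forests" by (simp add: mirror_forests_def forests_def)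
    moreover have "restrict p ?P = q"
    proof (rule PiE_ext[of _ ?P "\<lambda>_. UNIV"])
      show "q \<in> ?P \<rightarrow>\<^sub>E UNIV" using q by (auto simp: forests_def PiE_iff)
    qed (simp_all add: pP)
    ultimately show "q \<in> (\<lambda>p. restrict p ?P) ` mirror_forests" by blast
  qed
  then show ?thesis by (rule bij_betw_same_card)
qed

end

section \<open>Discrete sine functions\<close>

text \<open>For \<open>0 < k < M\<close> these are the eigenfunctions of the path
  \<open>0, ..., M\<close> with value zero at both ends.\<close>

definition sn :: "nat \<Rightarrow> nat \<Rightarrow> int \<Rightarrow> real" where
  "sn M k a = sin (real k * pi / real M * of_int a)"

lemma sn_0 [simp]: "sn M k 0 = 0"
  by (simp add: sn_def)

lemma sn_reflect:
  assumes "M > 0"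
  shows "sn M k (int M - a) = (- 1) ^ (k + 1) * sn M k a"
proof -
  have eq: "real k * pi / real M * of_int (int M - a) = real k * pi - real k * pi / real M * of_int a"
    using assms by (simp add: field_simps)
  show ?thesis unfolding sn_def eq sin_diff by (simp add: cos_npi)
qed

lemma sn_top [simp]: "sn M k (int M) = 0"
  by (cases "M = 0") (simp_all add: sn_def)

lemma sn_complement:
  assumes "k \<le> M" "M > 0"
  shows "sn M (M - k) (int a) = (- 1) ^ (a + 1) * sn M k (int a)"
proof -
  have eq: "real (M - k) * pi / real M * of_int (int a) = real a * pi - real k * pi / real M * real a"
    using assms by (simp add: field_simps of_nat_diff)
  show ?thesis unfolding sn_def eq sin_diff by (simp add: cos_npi)
qed

lemma sn_Suc_add_pred: "sn M k (a + 1) + sn M k (a - 1) = 2 * cos (real k * pi / real M) * sn M k a"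
proof -
  have "real k * pi / real M * of_int (a + 1) = real k * pi / real M * of_int a + real k * pi / real M"
    "real k * pi / real M * of_int (a - 1) = real k * pi / real M * of_int a - real k * pi / real M"
    by (simp_all add: algebra_simps add_divide_distrib diff_divide_distrib)
  then show ?thesis unfolding sn_def by (simp add: sin_add sin_diff)
qed

text \<open>Multiplied by \<open>2 * sin (x / 2)\<close>, where \<open>x = p * pi / M\<close>, the
  sum telescopes; at the upper limit the angle \<open>p * pi\<close> brings in the parity of
  \<open>p\<close>.\<close>

lemma sum_cos_arith:
  assumes "0 < p" "p < 2 * M"
  shows "(\<Sum>a<M. cos (real p * pi / real M * real a)) = of_bool (odd p)"
proof -
  let ?x = "real p * pi / real M"
  have M: "real M > 0" using assms by simp
  have "0 < ?x / 2" using assms M by simp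
  moreover have "?x / 2 < pi"
  proof -
    have "real p < 2 * real M" using assms(2) by linarith
    then show ?thesis using M by (simp add: field_simps)
  qed
  ultimately have s: "sin (?x / 2) \<noteq> 0" using sin_gt_zero by fastforce
  have tel: "2 * sin (?x / 2) * (\<Sum>a<n. cos (?x * real a)) = sin (?x * (real n - 1 / 2)) + sin (?x / 2)" for n
  proof (induction n)
    case (Suc n)
    have "2 * sin (?x / 2) * cos (?x * real n) = sin (?x * (real (Suc n) - 1 / 2)) - sin (?x * (real n - 1 / 2))"
    proof -
      have e: "?x * (real (Suc n) - 1 / 2) = ?x * real n + ?x / 2" "?x * (real n - 1 / 2) = ?x * real n - ?x / 2"
        by (simp_all add: algebra_simps)
      show ?thesis unfolding e sin_add sin_diff by simp
    qed
    with Suc show ?case by (simp add: algebra_simps)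
  qed (simp add: algebra_simps)
  have e: "?x * (real M - 1 / 2) = real p * pi - ?x / 2" using M by (simp add: field_simps)
  have "2 * sin (?x / 2) * (\<Sum>a<M. cos (?x * real a)) = 2 * sin (?x / 2) * of_bool (odd p)"
    unfolding tel e sin_diff by (cases "even p") (simp_all add: cos_npi)
  then show ?thesis using s by simp
qed

lemma sn_orthogonal:
  assumes "0 < k" "k < M" "0 < l" "l < M"
  shows "(\<Sum>a<M. sn M k (int a) * sn M l (int a)) = of_bool (k = l) * real M / 2"
proof -
  let ?c = "\<lambda>p. \<Sum>a<M. cos (real p * pi / real M * real a)"
  define d where "d = (if k \<le> l then l - k else k - l)"
  have "sn M k (int a) * sn M l (int a) =
    (cos (real d * pi / real M * real a) - cos (real (k + l) * pi / real M * real a)) / 2" for a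
  proof -
    let ?u = "real k * pi / real M * real a" and ?v = "real l * pi / real M * real a"
    have "cos (real d * pi / real M * real a) = cos (?u - ?v)"
    proof (cases "k \<le> l")
      case True
      then have "real d * pi / real M * real a = - (?u - ?v)"
        by (simp add: d_def of_nat_diff algebra_simps diff_divide_distrib)
      then show ?thesis by (simp only: cos_minus)
    qed (simp add: d_def of_nat_diff algebra_simps diff_divide_distrib)
    moreover have "real (k + l) * pi / real M * real a = ?u + ?v"
      by (simp add: algebra_simps add_divide_distrib)
    ultimately show ?thesis by (simp add: sn_def cos_add cos_diff)
  qed
  then have "(\<Sum>a<M. sn M k (int a) * sn M l (int a)) = (?c d - ?c (k + l)) / 2"
    by (simp only: sum_divide_distrib[symmetric] sum_subtractf)
  moreover have "?c (k + l) = of_bool (odd (k + l))" using assms by (intro sum_cos_arith) auto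
  moreover have "?c d = (if k = l then real M else of_bool (odd (k + l)))"
  proof (cases "k = l")
    case False
    then have "?c d = of_bool (odd d)" using assms by (intro sum_cos_arith) (auto simp: d_def)
    moreover have "odd d \<longleftrightarrow> odd (k + l)" by (auto simp: d_def)
    ultimately show ?thesis using False by simp
  qed (simp add: d_def)
  ultimately show ?thesis by (cases "k = l") auto
qed

text \<open>Alternating signs turn mode \<open>k\<close> into mode \<open>M - k\<close>, up to a
  sign, by \<open>sn_complement\<close>.\<close>

lemma sn_alternating_orthogonal:
  assumes "0 < k" "k < M" "0 < l" "l < M"
  shows "(\<Sum>a<M. (- 1) ^ a * (sn M k (int a) * sn M l (int a))) = - of_bool (k + l = M) * real M / 2"
proof -
  have "(- 1) ^ a * (sn M k (int a) * sn M l (int a)) = - (sn M (M - k) (int a) * sn M l (int a))" for a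
    using sn_complement[of k M a] assms by (cases "even a") auto
  then have "(\<Sum>a<M. (- 1) ^ a * (sn M k (int a) * sn M l (int a))) =
      - (\<Sum>a<M. sn M (M - k) (int a) * sn M l (int a))"
    by (simp add: sum_negf)
  also have "\<dots> = - of_bool (M - k = l) * real M / 2"
    using assms by (subst sn_orthogonal) auto
  also have "(M - k = l) = (k + l = M)" using assms by auto
  finally show ?thesis .
qed

section \<open>Spectrum of the dual Laplacian\<close>

text \<open>Invariant under transposition of the board, which is the reflection in the horizontal
  axis; this produces the free boundary condition there.\<close>

definition sym_sn :: "nat \<Rightarrow> nat \<times> nat \<Rightarrow> int \<times> int \<Rightarrow> real" where
  "sym_sn M t p = sn M (fst t) (fst p) * sn M (snd t) (snd p) + sn M (snd t) (fst p) * sn M (fst t) (snd p)"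

text \<open>Back from the doubled lattice to coordinates along the rows and columns of the chessboard.\<close>

definition board :: "nat \<Rightarrow> int \<times> int \<Rightarrow> int \<times> int" where
  "board m x = (int m + (fst x - snd x) div 2, int m + 1 + (fst x + snd x) div 2)"

lemma face_iff:
  "(2 * i, 2 * j) \<in> cls b m False \<longleftrightarrow> 0 \<le> j \<and> (b \<longrightarrow> 1 \<le> i) \<and> \<bar>i\<bar> \<le> int m - 1 - j"
proof -
  have "\<bar>2 * i\<bar> \<le> 2 * int m - 1 - 2 * j \<longleftrightarrow> \<bar>i\<bar> \<le> int m - 1 - j"
    "1 \<le> 2 * i \<longleftrightarrow> 1 \<le> i" by linarith+
  then show ?thesis by (simp add: cls_def sublattice_def region_def)
qed

lemma face_cases:
  assumes "x \<in> cls b m False"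
  obtains i j where "x = (2 * i, 2 * j)" "0 \<le> j" "b \<Longrightarrow> 1 \<le> i" "\<bar>i\<bar> \<le> int m - 1 - j"
proof -
  have "even (fst x)" "even (snd x)" using assms by (auto simp: cls_def sublattice_def)
  then obtain i j where "fst x = 2 * i" "snd x = 2 * j" by (metis evenE)
  then have x: "x = (2 * i, 2 * j)" by (simp add: prod_eq_iff)
  show thesis using that[OF x] assms unfolding x face_iff by blast
qed

lemma board_even: "board m (2 * i, 2 * j) = (int m + i - j, int m + 1 + i + j)"
proof -
  have "(2 * i - 2 * j) div 2 = i - j" "(2 * i + 2 * j) div 2 = i + j"
    by presburger+
  then show ?thesis by (simp add: board_def)
qed

text \<open>Let \<open>M = 2 * m + 1\<close>. On squares with odd \<open>a + b\<close> the pair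
  \<open>(M - k, M - l)\<close> gives the negative of the function of \<open>(k, l)\<close>, and
  pairs with \<open>k + l = M\<close> give zero, so the pairs with \<open>k + l < M\<close> remain.
  Odd \<open>k + l\<close> selects the functions antisymmetric in the vertical axis.\<close>

definition modes :: "bool \<Rightarrow> nat \<Rightarrow> (nat \<times> nat) set" where
  "modes b m = {(k, l). 1 \<le> k \<and> k \<le> l \<and> k + l \<le> 2 * m \<and> (b \<longrightarrow> odd (k + l))}"

section \<open>Symmetrized products of sines on the board\<close>

lemma sym_sn_swap: "sym_sn M t (b, a) = sym_sn M t (a, b)"
  unfolding sym_sn_def fst_conv snd_conv by (simp only: mult.commute add.commute)

lemma sym_sn_edge: "sym_sn M t (0, b) = 0" "sym_sn M t (a, int M) = 0"
  by (simp_all add: sym_sn_def)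

text \<open>Lattice steps are diagonal steps on the board, so the neighbour sum factors into
  one-dimensional recurrences, and the eigenvalue contains a product of cosines.\<close>

lemma sym_sn_eigen:
  "sym_sn M t (a + 1, b + 1) + sym_sn M t (a - 1, b - 1) + sym_sn M t (a + 1, b - 1) + sym_sn M t (a - 1, b + 1) =
    4 * cos (real (fst t) * pi / real M) * cos (real (snd t) * pi / real M) * sym_sn M t (a, b)"
proof -
  obtain k l where t: "t = (k, l)" by force
  have "sym_sn M t (a + 1, b + 1) + sym_sn M t (a - 1, b - 1) + sym_sn M t (a + 1, b - 1) + sym_sn M t (a - 1, b + 1) =
    (sn M k (a + 1) + sn M k (a - 1)) * (sn M l (b + 1) + sn M l (b - 1)) +
    (sn M l (a + 1) + sn M l (a - 1)) * (sn M k (b + 1) + sn M k (b - 1))"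
    by (simp add: sym_sn_def t algebra_simps)
  then show ?thesis unfolding sn_Suc_add_pred by (simp add: t sym_sn_def algebra_simps)
qed

text \<open>Reflection in the antidiagonal of the board, which is the vertical axis of the
  drawing.\<close>

lemma sym_sn_reflect:
  assumes "M > 0"
  shows "sym_sn M t (int M - b, int M - a) = (- 1) ^ (fst t + snd t) * sym_sn M t (a, b)"
proof -
  have alg: "(p * x) * (q * y) + (q * z) * (p * w) = (p * q) * (w * z + y * x)" for p q w x y z :: real
    by (simp add: algebra_simps)
  show ?thesis
    unfolding sym_sn_def fst_conv snd_conv sn_reflect[OF assms] alg by (simp add: power_add)
qed

text \<open>The faces are the interior white squares on one side of the diagonal. By symmetry, twice
  their sum is a sum over a full square, where sums of products factor.\<close>

lemma sum_symmetric_board: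
  fixes f :: "int \<times> int \<Rightarrow> real"
  assumes "\<And>a b. f (b, a) = f (a, b)"
  shows "2 * (\<Sum>x\<in>cls False m False. f (board m x)) =
    (\<Sum>a<2*m+1. \<Sum>b<2*m+1. of_bool (a \<noteq> 0 \<and> b \<noteq> 0 \<and> odd (a + b)) * f (int a, int b))"
proof -
  let ?S = "{(a, b). a < b \<and> b \<le> 2 * int m \<and> 1 \<le> a \<and> odd (a + b)}"
  let ?S' = "{(a, b). b < a \<and> a \<le> 2 * int m \<and> 1 \<le> b \<and> odd (a + b)}"
  have fin: "finite ?S" "finite ?S'"
    by (rule finite_subset[of _ "{0..2 * int m} \<times> {0..2 * int m}"]; auto)+
  have "bij_betw (board m) (cls False m False) ?S"
  proof (rule bij_betw_byWitness[of _ "\<lambda>p. (fst p + snd p - 2 * int m - 1, snd p - fst p - 1)"])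
    show "\<forall>x\<in>cls False m False. (fst (board m x) + snd (board m x) - 2 * int m - 1,
        snd (board m x) - fst (board m x) - 1) = x"
    proof
      fix x assume "x \<in> cls False m False"
      then show "(fst (board m x) + snd (board m x) - 2 * int m - 1, snd (board m x) - fst (board m x) - 1) = x"
        by (rule face_cases) (simp add: board_even)
    qed
    have odd_pair: "\<exists>i j. a + b - 2 * int m - 1 = 2 * i \<and> b - a - 1 = 2 * j \<and> a = int m + i - j \<and> b = int m + 1 + i + j"
      if "odd (a + b)" for a b :: int
    proof -
      from that obtain c where "a + b = 2 * c + 1" by (rule oddE)
      then show ?thesis by (intro exI[of _ "c - int m"] exI[of _ "c - a"]) auto
    qed
    show "\<forall>p\<in>?S. board m (fst p + snd p - 2 * int m - 1, snd p - fst p - 1) = p"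
    proof
      fix p assume "p \<in> ?S"
      then have "odd (fst p + snd p)" by auto
      then show "board m (fst p + snd p - 2 * int m - 1, snd p - fst p - 1) = p"
        using odd_pair[of "fst p" "snd p"] board_even[of m] by (metis prod.collapse)
    qed
    show "board m ` cls False m False \<subseteq> ?S"
    proof
      fix p assume "p \<in> board m ` cls False m False"
      then obtain x where x: "x \<in> cls False m False" "p = board m x" by blast
      from x(1) show "p \<in> ?S"
        by (rule face_cases) (simp add: x(2) board_even, linarith?)
    qed
    show "(\<lambda>p. (fst p + snd p - 2 * int m - 1, snd p - fst p - 1)) ` ?S \<subseteq> cls False m False"
    proof
      fix x assume "x \<in> (\<lambda>p. (fst p + snd p - 2 * int m - 1, snd p - fst p - 1)) ` ?S"
      then obtain p where p: "p \<in> ?S" "x = (fst p + snd p - 2 * int m - 1, snd p - fst p - 1)" by blast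
      obtain a b where "p = (a, b)" by force
      with p have ab: "a < b" "b \<le> 2 * int m" "1 \<le> a" "odd (a + b)"
        "x = (a + b - 2 * int m - 1, b - a - 1)" by simp_all
      from odd_pair[OF ab(4)] obtain i j where ij: "a + b - 2 * int m - 1 = 2 * i" "b - a - 1 = 2 * j"
        "a = int m + i - j" "b = int m + 1 + i + j" by blast
      have "0 \<le> j" "\<bar>i\<bar> \<le> int m - 1 - j" using ab(1-3) ij(3,4) by linarith+
      then show "x \<in> cls False m False" unfolding ab(5) ij(1,2) face_iff by simp
    qed
  qed
  then have 1: "(\<Sum>x\<in>cls False m False. f (board m x)) = sum f ?S"
    by (rule sum.reindex_bij_betw)
  have "bij_betw (\<lambda>(a, b). (b, a)) ?S' ?S"
    by (rule bij_betw_byWitness[of _ "\<lambda>(a, b). (b, a)"]) auto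
  then have "(\<Sum>p\<in>?S'. f ((\<lambda>(a, b). (b, a)) p)) = sum f ?S" by (rule sum.reindex_bij_betw)
  moreover have "f ((\<lambda>(a, b). (b, a)) p) = f p" for p using assms by (cases p) simp
  ultimately have 2: "sum f ?S' = sum f ?S" by simp
  let ?R = "{(a, b). a \<in> {..<2*m+1} \<and> b \<in> {..<2*m+1} \<and> (a \<noteq> 0 \<and> b \<noteq> 0 \<and> odd (a + b))}"
  have "(\<Sum>a<2*m+1. \<Sum>b<2*m+1. of_bool (a \<noteq> 0 \<and> b \<noteq> 0 \<and> odd (a + b)) * f (int a, int b)) =
      (\<Sum>p\<in>{..<2*m+1} \<times> {..<2*m+1}. if fst p \<noteq> 0 \<and> snd p \<noteq> 0 \<and> odd (fst p + snd p) then f (int (fst p), int (snd p)) else 0)"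
    unfolding sum.cartesian_product by (intro sum.cong) auto
  also have "\<dots> = (\<Sum>p\<in>?R. f (int (fst p), int (snd p)))"
    by (subst sum.inter_filter[symmetric]) (auto intro!: sum.cong)
  also have "\<dots> = sum f (?S \<union> ?S')"
  proof (rule sum.reindex_bij_betw[of "\<lambda>p. (int (fst p), int (snd p))" ?R "?S \<union> ?S'" f])
    show "bij_betw (\<lambda>p. (int (fst p), int (snd p))) ?R (?S \<union> ?S')"
    proof (rule bij_betw_byWitness[of _ "\<lambda>p. (nat (fst p), nat (snd p))"])
      show "(\<lambda>p. (int (fst p), int (snd p))) ` ?R \<subseteq> ?S \<union> ?S'"
        by (clarsimp, presburger)
      show "(\<lambda>p. (nat (fst p), nat (snd p))) ` (?S \<union> ?S') \<subseteq> ?R"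
      proof (rule image_subsetI)
        fix p :: "int \<times> int" assume "p \<in> ?S \<union> ?S'"
        then have p: "1 \<le> fst p" "1 \<le> snd p" "fst p \<le> 2 * int m" "snd p \<le> 2 * int m" "odd (fst p + snd p)"
          by auto
        then have "odd (nat (fst p) + nat (snd p))" by (simp add: even_nat_iff flip: nat_add_distrib)
        then show "(nat (fst p), nat (snd p)) \<in> ?R" using p by auto
      qed
    qed auto
  qed
  also have "\<dots> = sum f ?S + sum f ?S'" using fin by (intro sum.union_disjoint) auto
  finally show ?thesis using 1 2 by simp
qed

lemma sym_sn_orthogonal:
  assumes s: "s \<in> modes False m" and t: "t \<in> modes False m"
  defines "M \<equiv> 2 * m + 1"
  shows "(\<Sum>x\<in>cls False m False. sym_sn M s (board m x) * sym_sn M t (board m x)) =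
    of_bool (s = t) * (of_bool (fst t = snd t) + 1) * (real M)\<^sup>2 / 8"
proof -
  obtain k l where kl: "s = (k, l)" by force
  obtain k' l' where kl': "t = (k', l')" by force
  have b: "0 < k" "k < M" "0 < l" "l < M" "k \<le> l" "k + l < M"
    "0 < k'" "k' < M" "0 < l'" "l' < M" "k' \<le> l'" "k' + l' < M"
    using s t by (auto simp: modes_def kl kl' M_def)
  define S where "S p q = (\<Sum>a<M. sn M p (int a) * sn M q (int a))" for p q
  define A where "A p q = (\<Sum>a<M. (- 1) ^ a * (sn M p (int a) * sn M q (int a)))" for p q
  have prod: "(\<Sum>a<M. \<Sum>b<M. f a * g b) = (\<Sum>a<M. f a) * (\<Sum>b<M. g b)" for f g :: "nat \<Rightarrow> real"
    by (simp add: sum_product)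
  let ?F = "\<lambda>a b. sym_sn M s (int a, int b) * sym_sn M t (int a, int b)"
  have "2 * (\<Sum>x\<in>cls False m False. sym_sn M s (board m x) * sym_sn M t (board m x)) =
    (\<Sum>a<M. \<Sum>b<M. of_bool (a \<noteq> 0 \<and> b \<noteq> 0 \<and> odd (a + b)) * ?F a b)"
    unfolding M_def
    by (rule sum_symmetric_board[of "\<lambda>p. sym_sn (2*m+1) s p * sym_sn (2*m+1) t p"]) (simp add: sym_sn_swap)
  \<comment> \<open>The indicator of odd \<open>a + b\<close> is half of one minus the alternating
    sign; terms with an index 0 vanish with the sines.\<close>
  also have "\<dots> = (\<Sum>a<M. \<Sum>b<M. (1 - (- 1) ^ a * (- 1) ^ b) / 2 * ?F a b)"
  proof (intro sum.cong refl)
    fix a b :: nat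
    show "of_bool (a \<noteq> 0 \<and> b \<noteq> 0 \<and> odd (a + b)) * ?F a b = (1 - (- 1) ^ a * (- 1) ^ b) / 2 * ?F a b"
      by (cases "a = 0"; cases "b = 0"; cases "even a"; cases "even b") (auto simp: sym_sn_def)
  qed
  also have "\<dots> = (\<Sum>a<M. \<Sum>b<M. ?F a b / 2 - (- 1) ^ a * (- 1) ^ b * ?F a b / 2)"
    by (intro sum.cong refl) (simp add: field_simps)
  also have "\<dots> = (\<Sum>a<M. \<Sum>b<M. ?F a b) / 2 - (\<Sum>a<M. \<Sum>b<M. (- 1) ^ a * (- 1) ^ b * ?F a b) / 2"
    by (simp add: sum_subtractf sum_divide_distrib)
  also have "(\<Sum>a<M. \<Sum>b<M. ?F a b) = 2 * (S k k' * S l l' + S k l' * S l k')"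
  proof -
    have "?F a b = (sn M k (int a) * sn M k' (int a)) * (sn M l (int b) * sn M l' (int b))
      + (sn M k (int a) * sn M l' (int a)) * (sn M l (int b) * sn M k' (int b))
      + (sn M l (int a) * sn M k' (int a)) * (sn M k (int b) * sn M l' (int b))
      + (sn M l (int a) * sn M l' (int a)) * (sn M k (int b) * sn M k' (int b))" for a b
      by (simp add: sym_sn_def kl kl' algebra_simps)
    then show ?thesis by (simp add: sum.distrib prod S_def[symmetric] del: mult.assoc)
  qed
  also have "(\<Sum>a<M. \<Sum>b<M. (- 1) ^ a * (- 1) ^ b * ?F a b) = 2 * (A k k' * A l l' + A k l' * A l k')"
  proof -
    have "(- 1) ^ a * (- 1) ^ b * ?F a b =
        ((- 1) ^ a * (sn M k (int a) * sn M k' (int a))) * ((- 1) ^ b * (sn M l (int b) * sn M l' (int b)))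
      + ((- 1) ^ a * (sn M k (int a) * sn M l' (int a))) * ((- 1) ^ b * (sn M l (int b) * sn M k' (int b)))
      + ((- 1) ^ a * (sn M l (int a) * sn M k' (int a))) * ((- 1) ^ b * (sn M k (int b) * sn M l' (int b)))
      + ((- 1) ^ a * (sn M l (int a) * sn M l' (int a))) * ((- 1) ^ b * (sn M k (int b) * sn M k' (int b)))" for a b
      by (simp add: sym_sn_def kl kl' algebra_simps)
    then show ?thesis by (simp add: sum.distrib prod A_def[symmetric] del: mult.assoc)
  qed
  \<comment> \<open>A nonzero product would need complementary indices in both factors, so that all
    four add up to \<open>2 * M\<close>; but \<open>k + l\<close> and \<open>k' + l'\<close> are
    both less than \<open>M\<close>.\<close>
  also have "A k k' * A l l' + A k l' * A l k' = 0"
    unfolding A_def using b by (simp add: sn_alternating_orthogonal)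
  finally have "2 * (\<Sum>x\<in>cls False m False. sym_sn M s (board m x) * sym_sn M t (board m x)) =
      S k k' * S l l' + S k l' * S l k'" by simp
  also have "\<dots> = (of_bool (k = k' \<and> l = l') + of_bool (k = l' \<and> l = k')) * (real M)\<^sup>2 / 4"
    unfolding S_def using b by (auto simp: sn_orthogonal power2_eq_square)
  also have "\<dots> = of_bool (s = t) * (of_bool (fst t = snd t) + 1) * (real M)\<^sup>2 / 4"
    using b by (auto simp: kl kl')
  finally show ?thesis by simp
qed

lemma sym_sn_face_reflect:
  fixes m :: nat
  defines "M \<equiv> 2 * m + 1"
  shows "sym_sn M t (board m (2 * - i, 2 * j)) = (- 1) ^ (fst t + snd t) * sym_sn M t (board m (2 * i, 2 * j))"
proof -
  have "board m (2 * - i, 2 * j) =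
    (int M - snd (board m (2 * i, 2 * j)), int M - fst (board m (2 * i, 2 * j)))"
    unfolding board_even by (simp add: M_def)
  then show ?thesis
    using sym_sn_reflect[of M t "snd (board m (2 * i, 2 * j))" "fst (board m (2 * i, 2 * j))"]
    by (simp add: M_def)
qed

text \<open>These are the places of the roots: the two flights of the staircase have second board
  coordinate \<open>M\<close> and first board coordinate \<open>0\<close>, respectively, and on the
  vertical axis the modes of odd index sum vanish by antisymmetry.\<close>

lemma sym_sn_face_zero:
  fixes m :: nat
  assumes t: "t \<in> modes b m" and i: "i = int m - j \<or> i = j - int m \<or> b \<and> i = 0"
  defines "M \<equiv> 2 * m + 1"
  shows "sym_sn M t (board m (2 * i, 2 * j)) = 0"
  using i
proof (elim disjE)
  assume "i = int m - j"
  then have "board m (2 * i, 2 * j) = (2 * int m - 2 * j, int M)" unfolding board_even by (simp add: M_def)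
  then show ?thesis by (simp only: sym_sn_edge)
next
  assume "i = j - int m"
  then have "board m (2 * i, 2 * j) = (0, 2 * j + 1)" unfolding board_even by simp
  then show ?thesis by (simp only: sym_sn_edge)
next
  assume bi: "b \<and> i = 0"
  then have "odd (fst t + snd t)" using t by (auto simp: modes_def)
  then have "(- 1 :: real) ^ (fst t + snd t) = - 1" by simp
  then show ?thesis using sym_sn_face_reflect[of m t i j] bi by (simp add: M_def)
qed

lemma arcs_face:
  assumes "(2 * i, 2 * j) \<in> cls b m False"
  shows "arcs b m (2 * i, 2 * j) =
    {(2 * i + 1, 2 * j), (2 * i - 1, 2 * j), (2 * i, 2 * j + 1)} \<union> (if j = 0 then {} else {(2 * i, 2 * j - 1)})"
proof -
  have ij: "0 \<le> j" "b \<longrightarrow> 1 \<le> i" "\<bar>i\<bar> \<le> int m - 1 - j" using assms by (auto simp: face_iff)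
  have "(2 * i + 1, 2 * j) \<in> region b m" "(2 * i - 1, 2 * j) \<in> region b m" "(2 * i, 2 * j + 1) \<in> region b m"
    using ij by (auto simp: region_def)
  moreover have "(2 * i, 2 * j - 1) \<in> region b m \<longleftrightarrow> j \<noteq> 0"
    using ij by (auto simp: region_def)
  ultimately show ?thesis unfolding arcs_def nbrs_def fst_conv snd_conv by auto
qed

text \<open>Roots contribute nothing since the functions vanish there, so the full recurrence over
  four neighbours is available. Only the faces of the bottom row lack an edge.\<close>

lemma dual_laplacian_eigen:
  fixes m :: nat
  assumes x: "x \<in> cls b m False" and t: "t \<in> modes b m"
  defines "M \<equiv> 2 * m + 1"
  defines "\<phi> \<equiv> \<lambda>x. sym_sn M t (board m x)"
  shows "(\<Sum>y\<in>cls b m False. (\<Sum>d\<in>arcs b m x. of_bool (x = y) - of_bool (opp x d = y)) * \<phi> y) =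
    (4 - 4 * cos (real (fst t) * pi / real M) * cos (real (snd t) * pi / real M)) * \<phi> x"
proof -
  let ?A = "cls b m False"
  obtain i j where ij: "x = (2 * i, 2 * j)" "0 \<le> j" "b \<Longrightarrow> 1 \<le> i" "\<bar>i\<bar> \<le> int m - 1 - j"
    using x by (rule face_cases) blast
  define \<psi> where "\<psi> i j = \<phi> (2 * i, 2 * j)" for i j
  have pick: "(\<Sum>y\<in>?A. of_bool (z = y) * \<phi> y) = of_bool (z \<in> ?A) * \<phi> z" for z
  proof -
    have "(\<Sum>y\<in>?A. of_bool (z = y) * \<phi> y) = (\<Sum>y\<in>?A. if z = y then \<phi> y else 0)"
      by (intro sum.cong) auto
    then show ?thesis by simp
  qed
  have "(\<Sum>y\<in>?A. (\<Sum>d\<in>arcs b m x. of_bool (x = y) - of_bool (opp x d = y)) * \<phi> y) =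
    (\<Sum>d\<in>arcs b m x. \<Sum>y\<in>?A. of_bool (x = y) * \<phi> y - of_bool (opp x d = y) * \<phi> y)"
    unfolding sum_distrib_right by (subst sum.swap) (simp only: left_diff_distrib)
  also have "\<dots> = (\<Sum>d\<in>arcs b m x. \<phi> x - of_bool (opp x d \<in> ?A) * \<phi> (opp x d))"
    unfolding sum_subtractf pick using x by simp
  also have "\<dots> = 4 * \<psi> i j - (\<psi> (i + 1) j + \<psi> (i - 1) j + \<psi> i (j + 1) + \<psi> i (j - 1))"
  proof -
    have zero: "of_bool ((2 * i', 2 * j') \<in> ?A) * \<phi> (2 * i', 2 * j') = \<psi> i' j'"
      if "(2 * i', 2 * j') \<notin> ?A \<Longrightarrow> i' = int m - j' \<or> i' = j' - int m \<or> b \<and> i' = 0" for i' j'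
      using sym_sn_face_zero[OF t, of i' j'] that
      by (cases "(2 * i', 2 * j') \<in> ?A") (simp_all add: \<psi>_def \<phi>_def M_def)
    have z: "of_bool ((2 * (i + 1), 2 * j) \<in> ?A) * \<phi> (2 * (i + 1), 2 * j) = \<psi> (i + 1) j"
      "of_bool ((2 * (i - 1), 2 * j) \<in> ?A) * \<phi> (2 * (i - 1), 2 * j) = \<psi> (i - 1) j"
      "of_bool ((2 * i, 2 * (j + 1)) \<in> ?A) * \<phi> (2 * i, 2 * (j + 1)) = \<psi> i (j + 1)"
      using ij(2-4) by (intro zero; simp only: face_iff; linarith)+
    have o: "opp x (2 * i + 1, 2 * j) = (2 * (i + 1), 2 * j)" "opp x (2 * i - 1, 2 * j) = (2 * (i - 1), 2 * j)"
      "opp x (2 * i, 2 * j + 1) = (2 * i, 2 * (j + 1))" "opp x (2 * i, 2 * j - 1) = (2 * i, 2 * (j - 1))"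
      by (simp_all add: opp_def ij(1))
    define g where "g d = \<phi> x - of_bool (opp x d \<in> ?A) * \<phi> (opp x d)" for d
    have gs: "g (2 * i + 1, 2 * j) = \<psi> i j - \<psi> (i + 1) j" "g (2 * i - 1, 2 * j) = \<psi> i j - \<psi> (i - 1) j"
      "g (2 * i, 2 * j + 1) = \<psi> i j - \<psi> i (j + 1)"
      unfolding g_def o z by (simp_all add: \<psi>_def ij(1))
    have "sum g (arcs b m x) = 4 * \<psi> i j - (\<psi> (i + 1) j + \<psi> (i - 1) j + \<psi> i (j + 1) + \<psi> i (j - 1))"
    proof (cases "j = 0")
      case True
      \<comment> \<open>The square below a bottom face is its transpose, so the term of the missing
        downward edge is zero.\<close>
      have "\<psi> i (j - 1) = \<psi> i j"
        using sym_sn_swap[of M t "int m + i" "int m + i + 1"]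
        unfolding \<psi>_def \<phi>_def board_even by (simp add: True algebra_simps)
      moreover have "sum g (arcs b m x) =
          g (2 * i + 1, 2 * j) + (g (2 * i - 1, 2 * j) + g (2 * i, 2 * j + 1))"
        unfolding arcs_face[OF x[unfolded ij(1)], folded ij(1)] using True by simp
      ultimately show ?thesis unfolding gs by simp
    next
      case False
      then have "(2 * i, 2 * (j - 1)) \<in> ?A" using ij(2-4) unfolding face_iff by linarith
      then have "g (2 * i, 2 * j - 1) = \<psi> i j - \<psi> i (j - 1)" unfolding g_def o by (simp add: \<psi>_def ij(1))
      moreover have "sum g (arcs b m x) =
          g (2 * i, 2 * j - 1) + (g (2 * i + 1, 2 * j) + (g (2 * i - 1, 2 * j) + g (2 * i, 2 * j + 1)))"
        unfolding arcs_face[OF x[unfolded ij(1)], folded ij(1)] using False by simp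
      ultimately show ?thesis unfolding gs by simp
    qed
    then show ?thesis by (simp only: g_def[abs_def])
  qed
  also have "\<psi> (i + 1) j + \<psi> (i - 1) j + \<psi> i (j + 1) + \<psi> i (j - 1) =
    4 * cos (real (fst t) * pi / real M) * cos (real (snd t) * pi / real M) * \<psi> i j"
    using sym_sn_eigen[of M t "int m + i - j" "int m + 1 + i + j"]
    unfolding \<psi>_def \<phi>_def board_even by (simp add: algebra_simps)
  finally show ?thesis by (simp add: \<psi>_def ij(1) algebra_simps)
qed

lemma sum_right_half:
  fixes f :: "int \<times> int \<Rightarrow> real"
  assumes "\<And>i j. f (2 * - i, 2 * j) = f (2 * i, 2 * j)" "\<And>j. f (0, 2 * j) = 0"
  shows "2 * sum f (cls True m False) = sum f (cls False m False)"
proof -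
  let ?R = "cls True m False" and ?r = "\<lambda>x :: int \<times> int. (- fst x, snd x)"
  let ?Z = "{x \<in> cls False m False. fst x = 0}"
  have sub: "?R \<subseteq> cls False m False" by (auto simp: cls_def region_def)
  have union: "cls False m False = ?R \<union> ?r ` ?R \<union> ?Z"
  proof (intro equalityI subsetI)
    fix x assume x: "x \<in> cls False m False"
    then obtain i j where ij: "x = (2 * i, 2 * j)" "0 \<le> j" "\<bar>i\<bar> \<le> int m - 1 - j" by (rule face_cases) blast
    consider "1 \<le> i" | "i = 0" | "1 \<le> - i" by linarith
    then show "x \<in> ?R \<union> ?r ` ?R \<union> ?Z"
    proof cases
      case 1
      then have "x \<in> ?R" unfolding ij(1) face_iff using ij by simp
      then show ?thesis by blast
    next
      case 2
      then show ?thesis using x ij(1) by simp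
    next
      case 3
      then have "(2 * - i, 2 * j) \<in> ?R" unfolding face_iff using ij by simp
      moreover have "x = ?r (2 * - i, 2 * j)" by (simp add: ij(1))
      ultimately show ?thesis by blast
    qed
  next
    fix x assume "x \<in> ?R \<union> ?r ` ?R \<union> ?Z"
    moreover have "?r y \<in> cls False m False" if "y \<in> ?R" for y
    proof -
      from that obtain i j where "y = (2 * i, 2 * j)" "0 \<le> j" "\<bar>i\<bar> \<le> int m - 1 - j" by (rule face_cases)
      then show ?thesis using face_iff[of "- i" j False m] by simp
    qed
    ultimately show "x \<in> cls False m False" using sub by blast
  qed
  have fst_pos: "1 \<le> fst x" if "x \<in> ?R" for x using that by (simp add: cls_def region_def)
  have fst_neg: "fst x \<le> - 1" if "x \<in> ?r ` ?R" for x using that fst_pos by auto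
  have disj: "?R \<inter> ?r ` ?R = {}"
  proof (rule equals0I)
    fix x assume "x \<in> ?R \<inter> ?r ` ?R"
    then show False using fst_pos[of x] fst_neg[of x] by simp
  qed
  have disj0: "(?R \<union> ?r ` ?R) \<inter> ?Z = {}"
  proof (rule equals0I)
    fix x assume x: "x \<in> (?R \<union> ?r ` ?R) \<inter> ?Z"
    then have "x \<in> ?R \<or> x \<in> ?r ` ?R" "fst x = 0" by blast+
    then show False using fst_pos[of x] fst_neg[of x] by linarith
  qed
  have "sum f (?r ` ?R) = sum f ?R"
  proof -
    have "sum f (?r ` ?R) = (\<Sum>x\<in>?R. f (?r x))" by (rule sum.reindex_cong[of ?r]) (auto simp: inj_on_def)
    also have "\<dots> = sum f ?R"
    proof (rule sum.cong[OF refl])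
      fix x assume "x \<in> ?R"
      then obtain i j where "x = (2 * i, 2 * j)" by (rule face_cases)
      then show "f (?r x) = f x" using assms(1)[of i j] by simp
    qed
    finally show ?thesis .
  qed
  moreover have "sum f ?Z = 0"
  proof (rule sum.neutral, rule ballI)
    fix x assume "x \<in> ?Z"
    then have "x \<in> cls False m False" "fst x = 0" by auto
    then obtain i j where "x = (2 * i, 2 * j)" by (auto elim: face_cases)
    then show "f x = 0" using assms(2)[of j] \<open>fst x = 0\<close> by simp
  qed
  moreover have "sum f (cls False m False) = sum f (?R \<union> ?r ` ?R) + sum f ?Z"
    by (subst union, rule sum.union_disjoint[OF _ _ disj0]) auto
  moreover have "sum f (?R \<union> ?r ` ?R) = sum f ?R + sum f (?r ` ?R)"
    by (rule sum.union_disjoint[OF _ _ disj]) auto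
  ultimately show ?thesis by simp
qed

text \<open>Products of two antisymmetric functions are symmetric and vanish on the vertical axis,
  so the right half carries half of every sum, whence 16 in place of 8.\<close>

lemma mode_functions_orthogonal:
  fixes m :: nat
  assumes s: "s \<in> modes b m" and t: "t \<in> modes b m"
  defines "M \<equiv> 2 * m + 1"
  shows "(\<Sum>x\<in>cls b m False. sym_sn M s (board m x) * sym_sn M t (board m x)) =
    of_bool (s = t) * ((of_bool (fst t = snd t) + 1) * (real M)\<^sup>2 / (if b then 16 else 8))"
proof -
  have st: "s \<in> modes False m" "t \<in> modes False m" using s t by (auto simp: modes_def)
  show ?thesis
  proof (cases b)
    case True
    let ?f = "\<lambda>x. sym_sn M s (board m x) * sym_sn M t (board m x)"
    have odd: "odd (fst s + snd s)" "odd (fst t + snd t)" using s t True by (auto simp: modes_def)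
    have p: "(- 1 :: real) ^ (fst s + snd s) = - 1" "(- 1 :: real) ^ (fst t + snd t) = - 1"
      using odd by simp_all
    have "2 * sum ?f (cls True m False) = sum ?f (cls False m False)"
    proof (rule sum_right_half)
      show "?f (2 * - i, 2 * j) = ?f (2 * i, 2 * j)" for i j
        unfolding M_def sym_sn_face_reflect p by simp
      show "?f (0, 2 * j) = 0" for j
        using sym_sn_face_zero[of s True m 0 j] s True by (simp add: M_def)
    qed
    then show ?thesis using sym_sn_orthogonal[OF st] True by (simp add: M_def)
  next
    case False
    then show ?thesis using sym_sn_orthogonal[OF st] by (simp add: M_def)
  qed
qed

text \<open>Together with orthogonality this makes the modes a complete eigenbasis.\<close>

lemma card_modes: "card (modes b m) = card (cls b m False)"
proof -
  \<comment> \<open>Mode index \<open>k\<close> is matched with row \<open>j = k - 1\<close>: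
    \<open>l\<close> runs from \<open>k\<close> to \<open>2 * m - k\<close>, and the row has as many
    faces, with \<open>l = m\<close> in the centre. If \<open>k + l\<close> is odd, every second
    \<open>l\<close> remains, matching the right half of the row.\<close>
  define f :: "nat \<times> nat \<Rightarrow> int \<times> int" where
    "f t = (if b then int (snd t) - int (fst t) + 1 else 2 * (int (snd t) - int m), 2 * (int (fst t) - 1))" for t
  have "bij_betw f (modes b m) (cls b m False)"
    unfolding bij_betw_def
  proof (intro conjI equalityI subsetI)
    show "inj_on f (modes b m)" by (rule inj_onI) (auto simp: f_def split: if_splits)
  next
    fix x assume "x \<in> f ` modes b m"
    then obtain k l where kl: "1 \<le> k" "k \<le> l" "k + l \<le> 2 * m" "b \<longrightarrow> odd (k + l)" "x = f (k, l)"
      by (auto simp: modes_def)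
    show "x \<in> cls b m False"
    proof (cases b)
      case True
      then have "odd (k + l)" using kl by simp
      then obtain c where c: "k + l = 2 * c + 1" by (rule oddE)
      have x: "x = (2 * (int c - int k + 1), 2 * (int k - 1))"
        using True c by (simp add: kl(5) f_def)
      have "k \<noteq> l" using c by presburger
      then show ?thesis unfolding x face_iff using kl(1-3) c by simp
    next
      case False
      have x: "x = (2 * (int l - int m), 2 * (int k - 1))" using False by (simp add: kl(5) f_def)
      show ?thesis unfolding x face_iff using kl(1-3) False by simp
    qed
  next
    fix x assume "x \<in> cls b m False"
    then obtain i j where ij: "x = (2 * i, 2 * j)" "0 \<le> j" "b \<Longrightarrow> 1 \<le> i" "\<bar>i\<bar> \<le> int m - 1 - j"
      by (rule face_cases) blast
    let ?k = "nat (j + 1)" and ?l = "nat (if b then 2 * i + j else i + int m)"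
    have kl: "int ?k = j + 1" "int ?l = (if b then 2 * i + j else i + int m)" using ij by auto
    have "int ?k + int ?l \<le> 2 * int m" "int ?k \<le> int ?l" "1 \<le> int ?k" unfolding kl using ij by auto
    then have "?k + ?l \<le> 2 * m" "?k \<le> ?l" "1 \<le> ?k" by linarith+
    moreover have "odd (?k + ?l)" if b
    proof -
      have "odd (int (?k + ?l))" unfolding of_nat_add kl using that by simp
      then show ?thesis unfolding even_of_nat_iff .
    qed
    ultimately have "(?k, ?l) \<in> modes b m" by (simp add: modes_def)
    moreover have "f (?k, ?l) = x" unfolding f_def fst_conv snd_conv kl using ij(1) by simp
    ultimately show "x \<in> f ` modes b m" by (metis imageI)
  qed
  then show ?thesis by (rule bij_betw_same_card)
qed

lemma finite_modes: "finite (modes b m)"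
  by (rule finite_subset[of _ "{..2 * m} \<times> {..2 * m}"]) (auto simp: modes_def)

theorem card_dual_forests:
  "real (card (forests b m False)) =
    (\<Prod>(k, l)\<in>modes b m. 4 - 4 * cos (real k * pi / real (2 * m + 1)) * cos (real l * pi / real (2 * m + 1)))"
proof -
  let ?A = "cls b m False" and ?M = "2 * m + 1"
  let ?L = "\<lambda>x y. \<Sum>d\<in>arcs b m x. of_bool (x = y) - of_bool (opp x d = y) :: real"
  define n where "n = card ?A"
  obtain e where e: "bij_betw e {0..<n} ?A"
    unfolding n_def using ex_bij_betw_nat_finite[OF finite_cls] by blast
  obtain e' where e': "bij_betw e' {0..<n} (modes b m)"
    unfolding n_def card_modes[symmetric] using ex_bij_betw_nat_finite[OF finite_modes] by blast
  have inj: "e i = e k \<longleftrightarrow> i = k" if "i < n" "k < n" for i k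
    using e that by (auto simp: bij_betw_def inj_on_def)
  have "real (card (forests b m False)) =
    det (mat n n (\<lambda>(i, k). \<Sum>d\<in>arcs b m (e i). of_bool (i = k) - of_bool (opp (e i) d = e k)))"
    unfolding forests_def by (rule card_rooted_on_det[OF e finite_arcs])
  also have "\<dots> = det (mat n n (\<lambda>(i, k). ?L (e i) (e k)))"
    using inj by (intro arg_cong[of _ _ det] cong_mat) auto
  also have "\<dots> = (\<Prod>t\<in>modes b m. 4 - 4 * cos (real (fst t) * pi / real ?M) * cos (real (snd t) * pi / real ?M))"
  proof (rule det_eq_prod_eigenvalues[OF e e', where \<phi> = "\<lambda>t x. sym_sn ?M t (board m x)" and
        c = "\<lambda>t. (of_bool (fst t = snd t) + 1) * (real ?M)\<^sup>2 / (if b then 16 else 8)"])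
    show "(of_bool (fst t = snd t) + 1) * (real ?M)\<^sup>2 / (if b then 16 else 8) \<noteq> 0" for t :: "nat \<times> nat"
    proof -
      have "real ?M > 0" by simp
      then show ?thesis by (simp add: of_bool_def del: of_nat_Suc of_nat_add)
    qed
  qed (rule dual_laplacian_eigen mode_functions_orthogonal; assumption)+
  finally show ?thesis by (simp add: case_prod_beta)
qed

section \<open>The product formulas\<close>

lemma cos_double_product:
  fixes x y :: real
  shows "2 * cos x * cos y = cos (x - y) + cos (x + y)"
  by (simp add: cos_diff cos_add)

text \<open>Each factor is the square of a half-angle sine \<open>\<sigma> j\<close>. By the
  reflection \<open>i\<close> to \<open>2 * m + 1 - i\<close> the left side is the product of
  \<open>\<sigma> (2 * i)\<close> over all \<open>i\<close> up to \<open>2 * m\<close>, and the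
  duplication formula splits this factor into
  \<open>\<sigma> i * \<sigma> (2 * m + 1 - i)\<close>.\<close>

lemma prod_even_cos:
  fixes m :: nat
  defines "c \<equiv> \<lambda>j :: nat. cos (real j * pi / real (2 * m + 1))"
  shows "(\<Prod>i = 1..m. 2 - 2 * c (2 * i)) = (\<Prod>j = 1..2 * m. 2 - 2 * c j)"
proof -
  let ?M = "2 * m + 1"
  define \<sigma> where "\<sigma> j = 2 * sin (real j * pi / real ?M / 2)" for j :: nat
  have "2 - 2 * cos x = (2 * sin (x / 2))\<^sup>2" for x :: real
    using cos_double_sin[of "x / 2"] by (simp add: power_mult_distrib)
  then have sq: "2 - 2 * c j = (\<sigma> j)\<^sup>2" for j unfolding c_def \<sigma>_def .
  have sg_refl: "\<sigma> (2 * (?M - i)) = \<sigma> (2 * i)" if "i \<le> ?M" for i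
  proof -
    have "real (2 * (?M - i)) * pi / real ?M / 2 = pi - real (2 * i) * pi / real ?M / 2"
      using that by (simp add: of_nat_diff field_simps)
    then show ?thesis unfolding \<sigma>_def by (simp only: sin_pi_minus)
  qed
  have double: "\<sigma> (2 * i) = \<sigma> i * \<sigma> (?M - i)" if "i \<le> ?M" for i
  proof -
    have "real (?M - i) * pi / real ?M / 2 = pi / 2 - real i * pi / real ?M / 2"
      using that by (simp add: of_nat_diff field_simps)
    then have "\<sigma> (?M - i) = 2 * cos (real i * pi / real ?M / 2)" unfolding \<sigma>_def by (simp only: sin_cos_eq) simp
    moreover have "sin (2 * (real i * pi / real ?M / 2)) = 2 * sin (real i * pi / real ?M / 2) * cos (real i * pi / real ?M / 2)"
      by (rule sin_double)
    ultimately show ?thesis by (simp add: \<sigma>_def mult_ac)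
  qed
  have "(\<Prod>i = 1..m. 2 - 2 * c (2 * i)) = (\<Prod>i = 1..m. \<sigma> (2 * i)) * (\<Prod>i = 1..m. \<sigma> (2 * i))"
    by (simp add: sq power2_eq_square prod.distrib)
  also have "\<dots> = (\<Prod>i = m + 1..2 * m. \<sigma> (2 * i)) * (\<Prod>i = 1..m. \<sigma> (2 * i))"
  proof (rule arg_cong[of _ _ "\<lambda>z. z * _"])
    show "(\<Prod>i = 1..m. \<sigma> (2 * i)) = (\<Prod>i = m + 1..2 * m. \<sigma> (2 * i))"
    proof (rule prod.reindex_bij_witness[of _ "\<lambda>i. ?M - i" "\<lambda>i. ?M - i"])
      fix i assume "i \<in> {1..m}"
      then show "\<sigma> (2 * (?M - i)) = \<sigma> (2 * i)" by (intro sg_refl) simp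
    qed auto
  qed
  also have "\<dots> = (\<Prod>i = 1..2 * m. \<sigma> (2 * i))"
  proof -
    have "{1..2 * m} = {m + 1..2 * m} \<union> {1..m}" by auto
    then show ?thesis by (simp add: prod.union_disjoint)
  qed
  also have "\<dots> = (\<Prod>i = 1..2 * m. \<sigma> i * \<sigma> (?M - i))" by (intro prod.cong refl double) simp
  also have "\<dots> = (\<Prod>i = 1..2 * m. \<sigma> i) * (\<Prod>i = 1..2 * m. \<sigma> (?M - i))" by (rule prod.distrib)
  also have "(\<Prod>i = 1..2 * m. \<sigma> (?M - i)) = (\<Prod>i = 1..2 * m. \<sigma> i)"
    by (rule prod.reindex_bij_witness[of _ "\<lambda>i. ?M - i" "\<lambda>i. ?M - i"]) auto
  also have "(\<Prod>i = 1..2 * m. \<sigma> i) * (\<Prod>i = 1..2 * m. \<sigma> i) = (\<Prod>j = 1..2 * m. 2 - 2 * c j)"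
    by (simp add: sq power2_eq_square prod.distrib)
  finally show ?thesis .
qed

text \<open>Since \<open>2 * c k * c l = c (l - k) + c (k + l)\<close>, the mode
  \<open>(k, l)\<close> yields the factor of the pair \<open>(l - k, k + l)\<close>. The diagonal
  modes give the pairs \<open>(0, 2 * k)\<close>; by \<open>prod_even_cos\<close> these amount to
  the product of all \<open>2 - 2 * c j\<close>, half the factors of the pairs
  \<open>(j, j)\<close>, which is the origin of \<open>1 / 2 ^ (2 * m)\<close>.\<close>

lemma prod_modes_False:
  fixes m :: nat
  defines "c \<equiv> \<lambda>j :: nat. cos (real j * pi / real (2 * m + 1))"
  shows "(\<Prod>(k, l)\<in>modes False m. 4 - 4 * c k * c l) =
    1 / 2 ^ (2 * m) * (\<Prod>(j, k)\<in>{(j, k). 1 \<le> j \<and> j \<le> k \<and> k \<le> 2 * m \<and> even (j + k)}. 4 - 2 * c j - 2 * c k)"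
proof -
  let ?Q0 = "{(j, k). j = (0 :: nat) \<and> 1 \<le> k \<and> k \<le> 2 * m \<and> even k}"
  let ?Q1 = "{(j, k). 1 \<le> j \<and> j < k \<and> k \<le> 2 * m \<and> even (j + k)}"
  let ?D = "{(j, k). 1 \<le> j \<and> j = k \<and> k \<le> 2 * m}"
  define g where "g p = (case p of (j, k) \<Rightarrow> 4 - 2 * c j - 2 * c k)" for p :: "nat \<times> nat"
  have fin: "finite ?Q0" "finite ?Q1" "finite ?D"
    by (rule finite_subset[of _ "{..2 * m} \<times> {..2 * m}"]; auto)+
  have "(\<Prod>(k, l)\<in>modes False m. 4 - 4 * c k * c l) = prod g (?Q0 \<union> ?Q1)"
  proof (rule prod.reindex_bij_witness[of _ "\<lambda>(p, q). ((q - p) div 2, (p + q) div 2)" "\<lambda>(k, l). (l - k, k + l)"])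
    fix a assume a: "a \<in> modes False m"
    obtain k l where kl: "a = (k, l)" "1 \<le> k" "k \<le> l" "k + l \<le> 2 * m" using a by (auto simp: modes_def)
    have e: "k + l - (l - k) = 2 * k" "l - k + (k + l) = 2 * l" using kl by auto
    show "(case (case a of (k, l) \<Rightarrow> (l - k, k + l)) of (p, q) \<Rightarrow> ((q - p) div 2, (p + q) div 2)) = a"
      by (simp add: kl(1) e)
    have "even (l - k + (k + l))" unfolding e by simp
    then show "(case a of (k, l) \<Rightarrow> (l - k, k + l)) \<in> ?Q0 \<union> ?Q1" using kl by (cases "k = l") auto
    have "real l * pi / real (2 * m + 1) - real k * pi / real (2 * m + 1) = real (l - k) * pi / real (2 * m + 1)"
      "real l * pi / real (2 * m + 1) + real k * pi / real (2 * m + 1) = real (k + l) * pi / real (2 * m + 1)"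
      using kl(3) by (simp_all add: of_nat_diff left_diff_distrib distrib_right diff_divide_distrib add_divide_distrib)
    then have "2 * c l * c k = c (l - k) + c (k + l)"
      using cos_double_product[of "real l * pi / real (2 * m + 1)" "real k * pi / real (2 * m + 1)"]
      by (simp only: c_def)
    then show "g (case a of (k, l) \<Rightarrow> (l - k, k + l)) = (case a of (k, l) \<Rightarrow> 4 - 4 * c k * c l)"
      by (simp add: g_def kl(1) mult_ac)
  next
    fix a assume a: "a \<in> ?Q0 \<union> ?Q1"
    obtain p q where pq: "a = (p, q)" "p < q" "q \<le> 2 * m" "even (p + q)" using a by auto
    have "even (q - p)" using pq(2,4) by simp
    then obtain k where k: "q - p = 2 * k" by (rule evenE)
    have "q = p + 2 * k" using k pq(2) by linarith
    then have e: "p + q = 2 * (p + k)" by simp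
    show "(case (case a of (p, q) \<Rightarrow> ((q - p) div 2, (p + q) div 2)) of (k, l) \<Rightarrow> (l - k, k + l)) = a"
      unfolding pq(1) prod.case e k using \<open>q = p + 2 * k\<close> by simp
    show "(case a of (p, q) \<Rightarrow> ((q - p) div 2, (p + q) div 2)) \<in> modes False m"
      unfolding pq(1) prod.case e k using pq(2,3) \<open>q = p + 2 * k\<close> by (simp add: modes_def)
  qed
  also have "\<dots> = prod g ?Q0 * prod g ?Q1" using fin by (intro prod.union_disjoint) auto
  also have "prod g ?Q0 = (\<Prod>i = 1..m. 2 - 2 * c (2 * i))"
    by (rule prod.reindex_bij_witness[of _ "\<lambda>i. (0, 2 * i)" "\<lambda>p. snd p div 2"])
      (auto simp: g_def c_def)
  also have "\<dots> = (\<Prod>j = 1..2 * m. 2 - 2 * c j)" unfolding c_def by (rule prod_even_cos)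
  also have "\<dots> = 1 / 2 ^ (2 * m) * (\<Prod>j = 1..2 * m. 2 * (2 - 2 * c j))"
    unfolding prod.distrib by simp
  also have "(\<Prod>j = 1..2 * m. 2 * (2 - 2 * c j)) = prod g ?D"
    by (rule prod.reindex_bij_witness[of _ fst "\<lambda>j. (j, j)"]) (auto simp: g_def)
  also have "1 / 2 ^ (2 * m) * prod g ?D * prod g ?Q1 = 1 / 2 ^ (2 * m) * prod g (?D \<union> ?Q1)"
    using fin by (subst prod.union_disjoint) auto
  also have "?D \<union> ?Q1 = {(j, k). 1 \<le> j \<and> j \<le> k \<and> k \<le> 2 * m \<and> even (j + k)}"
    by (auto simp: le_less)
  finally show ?thesis by (simp add: g_def)
qed

text \<open>By \<open>sin (2 * x) = 2 * sin x * cos x\<close> the left side is a quotient of two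
  products of sines, and these agree because doubling permutes the angles up to \<open>x\<close>
  versus \<open>pi - x\<close>.\<close>

lemma prod_cos:
  fixes m :: nat
  defines "c \<equiv> \<lambda>j :: nat. cos (real j * pi / real (2 * m + 1))"
  shows "2 ^ m * (\<Prod>j = 1..m. c j) = 1"
proof -
  let ?M = "2 * m + 1"
  define s where "s j = sin (real j * pi / real ?M)" for j :: nat
  have s_refl: "s (?M - i) = s i" if "i \<le> ?M" for i
  proof -
    have "real (?M - i) * pi / real ?M = pi - real i * pi / real ?M"
      using that by (simp add: of_nat_diff field_simps)
    then show ?thesis unfolding s_def by (simp only: sin_pi_minus)
  qed
  have pos: "s j \<noteq> 0" if "j \<in> {1..m}" for j
  proof -
    have "real j * pi < real ?M * pi" using that by (intro mult_strict_right_mono) auto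
    then have "real j * pi / real ?M < pi" by (subst pos_divide_less_eq) (simp_all add: mult.commute[of pi])
    moreover have "0 < real j * pi / real ?M" using that by simp
    ultimately show ?thesis unfolding s_def using sin_gt_zero by fastforce
  qed
  \<comment> \<open>Folds the doubled index back into \<open>{1..m}\<close>; the odd values come
    from the second branch.\<close>
  define \<sigma> where "\<sigma> j = (if 2 * j \<le> m then 2 * j else ?M - 2 * j)" for j
  have "inj_on \<sigma> {1..m}"
  proof (rule inj_onI)
    fix i j assume "i \<in> {1..m}" "j \<in> {1..m}" "\<sigma> i = \<sigma> j"
    then show "i = j" unfolding \<sigma>_def by (simp split: if_splits; presburger)
  qed
  moreover have "\<sigma> ` {1..m} \<subseteq> {1..m}" by (auto simp: \<sigma>_def)
  ultimately have "bij_betw \<sigma> {1..m} {1..m}"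
    by (simp add: bij_betw_def endo_inj_surj)
  then have "(\<Prod>j = 1..m. s j) = (\<Prod>j = 1..m. s (\<sigma> j))" by (rule prod.reindex_bij_betw[symmetric])
  also have "\<dots> = (\<Prod>j = 1..m. s (2 * j))"
  proof (rule prod.cong)
    fix j assume "j \<in> {1..m}"
    then show "s (\<sigma> j) = s (2 * j)" using s_refl[of "2 * j"] unfolding \<sigma>_def by simp
  qed simp
  also have "\<dots> = (\<Prod>j = 1..m. s j * (2 * c j))"
  proof (rule prod.cong)
    fix j assume "j \<in> {1..m}"
    show "s (2 * j) = s j * (2 * c j)"
      using sin_double[of "real j * pi / real ?M"] by (simp add: s_def c_def mult_ac)
  qed simp
  also have "\<dots> = (\<Prod>j = 1..m. s j) * (2 ^ m * (\<Prod>j = 1..m. c j))" by (simp add: prod.distrib)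
  finally have "(\<Prod>j = 1..m. s j) * (2 ^ m * (\<Prod>j = 1..m. c j)) = (\<Prod>j = 1..m. s j) * 1" by simp
  moreover have "(\<Prod>j = 1..m. s j) \<noteq> 0" using pos by simp
  ultimately show ?thesis by (simp only: mult_cancel_left) simp
qed

text \<open>For the angles \<open>y\<close> of \<open>j\<close> and \<open>x\<close> of
  \<open>k\<close>, the mode \<open>(k - j, 2 * m + 1 - j - k)\<close> has the cosines
  \<open>cos (x - y)\<close> and \<open>- cos (x + y)\<close>. Twice their product is
  \<open>- cos (2 * x) - cos (2 * y)\<close>, and the double-angle formula turns this into squares.
  The odd modulus makes the index sum odd.\<close>

lemma prod_modes_True:
  fixes m :: nat
  defines "c \<equiv> \<lambda>j :: nat. cos (real j * pi / real (2 * m + 1))"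
  shows "(\<Prod>(k, l)\<in>modes True m. 4 - 4 * c k * c l) =
    (\<Prod>(j, k)\<in>{(j, k). 1 \<le> j \<and> j < k \<and> k \<le> m}. 4 * (c j)\<^sup>2 + 4 * (c k)\<^sup>2)"
proof (rule sym, rule prod.reindex_bij_witness[of _ "\<lambda>(k, l). ((2 * m + 1 - k - l) div 2, (2 * m + 1 + k - l) div 2)"
      "\<lambda>(j, k). (k - j, 2 * m + 1 - j - k)"])
  let ?M = "2 * m + 1"
  fix a assume "a \<in> {(j, k). 1 \<le> j \<and> j < k \<and> k \<le> m}"
  then obtain j k where jk: "a = (j, k)" "1 \<le> j" "j < k" "k \<le> m" by auto
  have e: "?M - (k - j) - (?M - j - k) = 2 * j" "?M + (k - j) - (?M - j - k) = 2 * k"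
    using jk by linarith+
  show "(case (case a of (j, k) \<Rightarrow> (k - j, ?M - j - k)) of (k, l) \<Rightarrow> ((?M - k - l) div 2, (?M + k - l) div 2)) = a"
    unfolding jk(1) prod.case e by simp
  have "k - j + (?M - j - k) = 2 * (m - j) + 1" using jk by linarith
  then have "odd (k - j + (?M - j - k))" by simp
  then show "(case a of (j, k) \<Rightarrow> (k - j, ?M - j - k)) \<in> modes True m"
    unfolding jk(1) prod.case modes_def using jk(2-4) by auto
  let ?x = "real k * pi / real ?M" and ?y = "real j * pi / real ?M"
  have "real (k - j) * pi / real ?M = ?x - ?y"
    using jk by (simp add: of_nat_diff left_diff_distrib diff_divide_distrib)
  then have 1: "c (k - j) = cos (?x - ?y)" by (simp only: c_def)
  have "real (?M - j - k) * pi / real ?M = pi - (?x + ?y)"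
  proof -
    have "real (?M - j - k) = real ?M - (real k + real j)" using jk by (simp add: of_nat_diff)
    moreover have "(u - (v + w)) * z / u = z - (v * z / u + w * z / u)" if "u \<noteq> 0" for u v w z :: real
      using that by (simp add: field_simps)
    ultimately show ?thesis by simp
  qed
  then have 2: "c (?M - j - k) = - cos (?x + ?y)" unfolding c_def by (simp only: cos_pi_minus)
  have "2 * cos (?x - ?y) * cos (?x + ?y) = cos (2 * ?y) + cos (2 * ?x)"
    unfolding cos_double_product by (simp add: algebra_simps flip: cos_minus[of "2 * ?y"])
  also have "\<dots> = 2 * (c j)\<^sup>2 - 1 + (2 * (c k)\<^sup>2 - 1)" unfolding cos_double_cos c_def ..
  finally show "(case (case a of (j, k) \<Rightarrow> (k - j, ?M - j - k)) of (k, l) \<Rightarrow> 4 - 4 * c k * c l) =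
      (case a of (j, k) \<Rightarrow> 4 * (c j)\<^sup>2 + 4 * (c k)\<^sup>2)"
    unfolding jk(1) prod.case 1 2 by simp
next
  let ?M = "2 * m + 1"
  fix a assume "a \<in> modes True m"
  then obtain k l where kl: "a = (k, l)" "1 \<le> k" "k \<le> l" "k + l \<le> 2 * m" "odd (k + l)"
    by (auto simp: modes_def)
  from kl(5) obtain d where d: "k + l = 2 * d + 1" by (rule oddE)
  have e: "?M - k - l = 2 * (m - d)" "?M + k - l = 2 * (m - d + k)"
  proof -
    have "d \<le> m" using d kl by linarith
    then obtain t where "m = d + t" using le_Suc_ex by blast
    then show "?M - k - l = 2 * (m - d)" "?M + k - l = 2 * (m - d + k)" using d by simp_all
  qed
  show "(case (case a of (k, l) \<Rightarrow> ((?M - k - l) div 2, (?M + k - l) div 2)) of (j, k) \<Rightarrow> (k - j, ?M - j - k)) = a"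
    unfolding kl(1) prod.case e using d kl by simp
  show "(case a of (k, l) \<Rightarrow> ((?M - k - l) div 2, (?M + k - l) div 2)) \<in> {(j, k). 1 \<le> j \<and> j < k \<and> k \<le> m}"
  proof -
    have "1 \<le> m - d" "m - d < m - d + k" "m - d + k \<le> m" using d kl by linarith+
    then show ?thesis unfolding kl(1) prod.case e by simp
  qed
qed

section \<open>Symmetric spanning trees of the mixed Aztec diamond\<close>

text \<open>The choice of \<open>s\<close> links the two sides: \<open>True\<close> leads to
  spanning trees, \<open>False\<close> to the determinant.\<close>

lemma num_perfect_matchings_eq_forests:
  "num_perfect_matchings (C (2 * m)) = card (forests False m s)"
  "num_perfect_matchings (B m) = card (forests True m s)"
  unfolding C_eq num_perfect_matchings_B num_perfect_matchings_region
  by (rule card_dimers_eq_card_forests)+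

theorem theorem4p6:
  fixes n :: nat
  assumes "n \<ge> 1"
  shows
    "num_inv_spanning_trees (sym_generated {hrefl}) (MD n) = num_perfect_matchings (C (2 * n - 2)) \<and>
     real (num_perfect_matchings (C (2 * n - 2))) =
       1 / 2 ^ (2 * n - 2) *
       (\<Prod>(j, k)\<in>{(j :: nat, k :: nat). 1 \<le> j \<and> j \<le> k \<and> k \<le> 2 * n - 2 \<and> even (j + k)}.
          4 - 2 * cos (real j * pi / (2 * real n - 1)) - 2 * cos (real k * pi / (2 * real n - 1))) \<and>
     num_inv_spanning_trees (sym_generated {hrefl, vrefl}) (MD n) = num_perfect_matchings (B (n - 1)) \<and>
     real (num_perfect_matchings (B (n - 1))) =
       2 ^ (n - 1) *
       (\<Prod>j = 1..n - 1. cos (real j * pi / (2 * real n - 1))) *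
       (\<Prod>(j, k)\<in>{(j :: nat, k :: nat). 1 \<le> j \<and> j < k \<and> k \<le> n - 1}.
          4 * (cos (real j * pi / (2 * real n - 1)))\<^sup>2 + 4 * (cos (real k * pi / (2 * real n - 1)))\<^sup>2)"
proof -
  \<comment> \<open>With \<open>m = n - 1\<close> the modulus \<open>2 * m + 1\<close> is the
    denominator \<open>2 * n - 1\<close> of the statement.\<close>
  obtain m where n: "n = Suc m" using assms by (cases n) auto
  have e: "2 * n - 2 = 2 * m" "n - 1 = m" "2 * real n - 1 = real (2 * m + 1)" by (simp_all add: n)
  have h: "num_inv_spanning_trees (sym_generated {hrefl}) (MD n) = num_perfect_matchings (C (2 * m))"
    unfolding n num_h_invariant_trees num_perfect_matchings_eq_forests(1)[of m True] ..
  have hv: "num_inv_spanning_trees (sym_generated {hrefl, vrefl}) (MD n) = num_perfect_matchings (B m)"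
    unfolding n num_hv_invariant_trees card_mirror_forests num_perfect_matchings_eq_forests(2)[of m True] ..
  have c: "real (num_perfect_matchings (C (2 * m))) =
      1 / 2 ^ (2 * m) * (\<Prod>(j, k)\<in>{(j, k). 1 \<le> j \<and> j \<le> k \<and> k \<le> 2 * m \<and> even (j + k)}.
        4 - 2 * cos (real j * pi / real (2 * m + 1)) - 2 * cos (real k * pi / real (2 * m + 1)))"
    unfolding num_perfect_matchings_eq_forests(1)[of m False] card_dual_forests by (rule prod_modes_False)
  \<comment> \<open>The power of 2 and the product of cosines cancel by \<open>prod_cos\<close>;
    only the product over pairs comes from the determinant.\<close>
  have b: "real (num_perfect_matchings (B m)) =
      2 ^ m * (\<Prod>j = 1..m. cos (real j * pi / real (2 * m + 1))) *
      (\<Prod>(j, k)\<in>{(j, k). 1 \<le> j \<and> j < k \<and> k \<le> m}.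
        4 * (cos (real j * pi / real (2 * m + 1)))\<^sup>2 + 4 * (cos (real k * pi / real (2 * m + 1)))\<^sup>2)"
    unfolding num_perfect_matchings_eq_forests(2)[of m False] card_dual_forests prod_cos
    using prod_modes_True[of m] by simp
  show ?thesis unfolding e using h c hv b by (intro conjI)
qed

end
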